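(* Let $G$ be a finite group and $r$ an integer relatively prime to $\exp(G)$. Let $\tau_r\colon{}^{G}_{G}\mathcal{YD}\to{}^{G}_{G}\mathcal{YD}$ be the functor described in the context. Then $\tau_r$ is a quasitensor autoequivalence of ${}^{G}_{G}\mathcal{YD}$. Moreover, $S_{\tau_r(i),\tau_r(j)}=\gamma_r(S_{ij})$ for all simple objects $i,j$ of ${}^{G}_{G}\mathcal{YD}$, and $\nu_m(\tau_r(V))=\gamma_r(\nu_m(V))=\nu_{mr}(V)$ for all $V\in{}^{G}_{G}\mathcal{YD}$ and all $m\in\mathbb{Z}$.
   Context: ${}^{G}_{G}\mathcal{YD}$ is the category of finite-dimensional Yetter–Drinfeld modules over $\mathbb{C}G$: $G$-graded complex vector spaces with a left $G$-action such that $|gv|=g|v|g^{-1}$; it is a modular tensor category (ordinary tensor product with diagonal action and grading $|v\otimes w|=|v||w|$, braiding $c(v\otimes w)=|v|w\otimes v$, ribbon twist $\theta(v)=|v|v$). Let $(X_i)_{i\in I}$ be representatives of the isomorphism classes of simple objects; $S_{ij}$ denotes the trace of the double braiding $c^2$ on $X_i\otimes X_j$. For $M\in{}^{G}_{G}\mathcal{YD}$, $\tau_r(M)$ is $M$ with the same $G$-action but with grading $\tau_r(M)_{g^r}=M_g$; $\tau_r(i)$ is defined by $\tau_r(X_i)\cong X_{\tau_r(i)}$. $\gamma_r$ is the Galois automorphism of $\mathbb{Q}(\zeta_e)$, $e=\exp(G)$, with $\zeta_e\mapsto\zeta_e^r$. A quasitensor functor is a functor $F$ with a natural isomorphism $F(X)\otimes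 F(Y)\cong F(X\otimes Y)$, not required to be compatible with associativity constraints. $\nu_m$ denotes the $m$-th (higher) Frobenius–Schur indicator. *)

theory Defs
  imports "Jordan_Normal_Form.Matrix" "HOL-Algebra.Multiplicative_Group"
    "HOL-Computational_Algebra.Polynomial" "HOL-Library.FuncSet" Complex_Main
begin

text \<open>An object is given by a dimension n, a homogeneous basis e_0,...,e_(n-1)
  with degrees ydeg i in G, and the G-action as n x n complex matrices.\<close>

record 'g yd =
  ydim :: nat
  ydeg :: "nat \<Rightarrow> 'g"
  yact :: "'g \<Rightarrow> complex mat"

definition is_yd :: "('g, 'b) monoid_scheme \<Rightarrow> 'g yd \<Rightarrow> bool" where
  "is_yd G X \<longleftrightarrow>
     (\<forall>i < ydim X. ydeg X i \<in> carrier G) \<and>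
     (\<forall>g \<in> carrier G. yact X g \<in> carrier_mat (ydim X) (ydim X)) \<and>
     yact X \<one>\<^bsub>G\<^esub> = 1\<^sub>m (ydim X) \<and>
     (\<forall>g \<in> carrier G. \<forall>h \<in> carrier G. yact X (g \<otimes>\<^bsub>G\<^esub> h) = yact X g * yact X h) \<and>
     (\<forall>g \<in> carrier G. \<forall>i < ydim X. \<forall>j < ydim X.
        yact X g $$ (i, j) \<noteq> 0 \<longrightarrow>
        ydeg X i = g \<otimes>\<^bsub>G\<^esub> ydeg X j \<otimes>\<^bsub>G\<^esub> inv\<^bsub>G\<^esub> g)"

definition is_yd_mor :: "('g, 'b) monoid_scheme \<Rightarrow> 'g yd \<Rightarrow> 'g yd \<Rightarrow> complex mat \<Rightarrow> bool" where
  "is_yd_mor G X Y f \<longleftrightarrow>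
     f \<in> carrier_mat (ydim Y) (ydim X) \<and>
     (\<forall>g \<in> carrier G. f * yact X g = yact Y g * f) \<and>
     (\<forall>i < ydim Y. \<forall>j < ydim X. f $$ (i, j) \<noteq> 0 \<longrightarrow> ydeg Y i = ydeg X j)"

definition is_yd_iso :: "('g, 'b) monoid_scheme \<Rightarrow> 'g yd \<Rightarrow> 'g yd \<Rightarrow> complex mat \<Rightarrow> bool" where
  "is_yd_iso G X Y f \<longleftrightarrow> is_yd_mor G X Y f \<and>
     (\<exists>f'. is_yd_mor G Y X f' \<and> f' * f = 1\<^sub>m (ydim X) \<and> f * f' = 1\<^sub>m (ydim Y))"

definition yd_isomorphic :: "('g, 'b) monoid_scheme \<Rightarrow> 'g yd \<Rightarrow> 'g yd \<Rightarrow> bool" where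
  "yd_isomorphic G X Y \<longleftrightarrow> (\<exists>f. is_yd_iso G X Y f)"

definition yd_simple :: "('g, 'b) monoid_scheme \<Rightarrow> 'g yd \<Rightarrow> bool" where
  "yd_simple G X \<longleftrightarrow> is_yd G X \<and> ydim X \<noteq> 0 \<and>
     (\<forall>Y f. is_yd G Y \<and> is_yd_mor G Y X f \<and>
        (\<forall>v \<in> carrier_vec (ydim Y). f *\<^sub>v v = 0\<^sub>v (ydim X) \<longrightarrow> v = 0\<^sub>v (ydim Y))
        \<longrightarrow> ydim Y = 0 \<or> is_yd_iso G Y X f)"

subsection \<open>Tensor product (basis e_i (x) f_j has index i * dim Y + j)\<close>

definition kron :: "complex mat \<Rightarrow> complex mat \<Rightarrow> complex mat" where
  "kron A B = mat (dim_row A * dim_row B) (dim_col A * dim_col B)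
     (\<lambda>(r, c). A $$ (r div dim_row B, c div dim_col B) * B $$ (r mod dim_row B, c mod dim_col B))"

definition yd_tensor :: "('g, 'b) monoid_scheme \<Rightarrow> 'g yd \<Rightarrow> 'g yd \<Rightarrow> 'g yd" where
  "yd_tensor G X Y =
     \<lparr> ydim = ydim X * ydim Y,
       ydeg = (\<lambda>k. ydeg X (k div ydim Y) \<otimes>\<^bsub>G\<^esub> ydeg Y (k mod ydim Y)),
       yact = (\<lambda>g. kron (yact X g) (yact Y g)) \<rparr>"

abbreviation yd_tensor_mor :: "complex mat \<Rightarrow> complex mat \<Rightarrow> complex mat" where
  "yd_tensor_mor f g \<equiv> kron f g"

subsection \<open>Braiding c(v (x) w) = |v| w (x) v and the S-matrix entries\<close>

definition yd_braid :: "'g yd \<Rightarrow> 'g yd \<Rightarrow> complex mat" where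
  "yd_braid X Y = mat (ydim Y * ydim X) (ydim X * ydim Y)
     (\<lambda>(r, c). if r mod ydim X = c div ydim Y
               then yact Y (ydeg X (c div ydim Y)) $$ (r div ydim X, c mod ydim Y) else 0)"

definition mat_trace :: "complex mat \<Rightarrow> complex" where
  "mat_trace A = (\<Sum>i < dim_row A. A $$ (i, i))"

definition yd_S :: "'g yd \<Rightarrow> 'g yd \<Rightarrow> complex" where
  "yd_S X Y = mat_trace (yd_braid Y X * yd_braid X Y)"

definition yd_tau :: "('g, 'b) monoid_scheme \<Rightarrow> int \<Rightarrow> 'g yd \<Rightarrow> 'g yd" where
  "yd_tau G r X = X \<lparr> ydeg := (\<lambda>i. ydeg X i [^]\<^bsub>G\<^esub> r) \<rparr>"

definition yd_tau_mor :: "int \<Rightarrow> complex mat \<Rightarrow> complex mat" where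
  "yd_tau_mor r f = f"

definition group_exp :: "('g, 'b) monoid_scheme \<Rightarrow> nat" where
  "group_exp G = Lcm (group.ord G ` carrier G)"

definition zeta :: "nat \<Rightarrow> complex" where
  "zeta e = cis (2 * pi / real e)"

definition gal_gamma :: "nat \<Rightarrow> int \<Rightarrow> complex \<Rightarrow> complex" where
  "gal_gamma e r z = (SOME w. \<exists>p :: rat poly.
      z = poly (map_poly of_rat p) (zeta e) \<and> w = poly (map_poly of_rat p) (zeta e powi r))"

text \<open>Via the Drinfeld double D(G) (YD = Rep D(G)): nu_m(V) = chi_V(Lambda^[m]) with
  Lambda = (1/|G|) sum_h delta_1 h the normalized integral, Delta(delta_x h) =
  sum_{yz=x} delta_y h (x) delta_z h, delta_y h acting as P_y rho(h) (P_y the projection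
  onto degree y). For m \<ge> 1, Lambda^[m] = Lambda_(1)...Lambda_(m); Lambda^[0] = 1;
  for m = -k < 0, Lambda^[m] = S(Lambda_(1))...S(Lambda_(k)), with
  S(delta_x h) = h^-1 delta_(x^-1) acting as rho(h^-1) P_(x^-1).\<close>

definition yd_proj :: "'g yd \<Rightarrow> 'g \<Rightarrow> complex mat" where
  "yd_proj X y = mat (ydim X) (ydim X) (\<lambda>(i, j). if i = j \<and> ydeg X i = y then 1 else 0)"

definition gprod_list :: "('g, 'b) monoid_scheme \<Rightarrow> nat \<Rightarrow> (nat \<Rightarrow> 'g) \<Rightarrow> 'g" where
  "gprod_list G k y = foldr (\<lambda>i acc. y i \<otimes>\<^bsub>G\<^esub> acc) [0..<k] \<one>\<^bsub>G\<^esub>"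

definition FS_ind :: "('g, 'b) monoid_scheme \<Rightarrow> int \<Rightarrow> 'g yd \<Rightarrow> complex" where
  "FS_ind G m V =
    (let k = nat \<bar>m\<bar>;
         tuples = {y \<in> {0..<k} \<rightarrow>\<^sub>E carrier G. gprod_list G k y = \<one>\<^bsub>G\<^esub>}
     in (1 / of_nat (card (carrier G))) *
        (\<Sum>h \<in> carrier G. \<Sum>y \<in> tuples.
           mat_trace (foldr (\<lambda>i A.
              (if m \<ge> 0 then yd_proj V (y i) * yact V h
               else yact V (inv\<^bsub>G\<^esub> h) * yd_proj V (inv\<^bsub>G\<^esub> (y i))) * A)
             [0..<k] (1\<^sub>m (ydim V)))))"

end

theory Submission
  imports Defs "Jordan_Normal_Form.Schur_Decomposition"
    "HOL-Number_Theory.Residues"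
begin

text \<open>
  Choose a positive \<open>n \<equiv> r\<close> modulo the exponent all of whose prime factors are large. Everything
  rests on one count: if \<open>C\<close>, \<open>D\<close> are unions of conjugacy classes of a finite group and \<open>z\<close> is an
  element, then \<open>x y = z\<close> and \<open>x\<^sup>n y\<^sup>n = z\<^sup>n\<close> have equally many solutions in \<open>C \<times> D\<close>. For a prime
  \<open>p\<close> this holds modulo \<open>p\<close>, by rotating the factors of products of length \<open>p\<close>, and \<open>p\<close> exceeds both
  counts.

  Applied in all centralizers, the count shows that two \<open>G\<close>-sets of pairs have equal fixed point
  counts, hence are isomorphic. This yields conjugation-equivariant functions \<open>a\<close>, \<open>b\<close> on pairs
  such that \<open>(x, y) \<mapsto> (x', y') = (a x a\<^sup>-\<^sup>1, b y b\<^sup>-\<^sup>1)\<close> is a bijection with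
  \<open>(x' y')\<^sup>n = x\<^sup>n y\<^sup>n\<close>, where \<open>a\<close>, \<open>b\<close> are evaluated at \<open>(x, y)\<close>; then
  \<open>v \<otimes> w \<mapsto> a v \<otimes> b w\<close>, with \<open>x = |v|\<close> and \<open>y = |w|\<close>, is the quasitensor structure.

  The \<open>S\<close>-matrix and the indicators are sums of values of the characters
  \<open>\<chi>(y, g) = tr (g | V\<^sub>y)\<close>. The automorphism \<open>\<gamma>\<^sub>r\<close> sends \<open>\<chi>(y, g)\<close> to \<open>\<chi>(y, g\<^sup>n)\<close>, while
  \<open>\<tau>\<^sub>r\<close> replaces \<open>\<chi>(y\<^sup>n, g)\<close> by \<open>\<chi>(y, g)\<close>; for the indicators the two are compared by the count
  in the centralizer of \<open>g\<close>.
\<close>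

text \<open>The two objects that a quasitensor structure must identify carry the same action, but
  one is graded by x^n y^n and the other by (x y)^n. These differ in general, so the structure map
  comes from a counting argument and not from a formula. Every set of pairs that is counted has at
  most \<open>order G ^ 2\<close> elements, so a congruence modulo a larger prime is an equality.
  The prime factors of n are treated one at a time; n itself may be composite, and the Chinese
  remainder theorem finds it. Counting in G alone would only give a bijection of pairs. For the
  linear map to commute with G, the conjugator must satisfy a(g t) = g a(t) g^-1, so a(t) has to
  commute with the stabilizer of t. This forces the count to be made in centralizers, with conjugacy
  classes taken inside them. A map built from the action of a and b is then natural at once, because
  morphisms preserve degrees and commute with the action.\<close>

hide_const (open) Polynomial.order

subsection \<open>Galois conjugation of polynomial values at roots of unity\<close>

text \<open>The inner binomial coefficients are divisible by p. Stated as a divisibility in an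
  arbitrary commutative ring, this applies directly to integer polynomials.\<close>

lemma prime_dvd_binomial_diff:
  fixes a b :: "'a::comm_ring_1"
  assumes "prime p"
  shows "of_nat p dvd (a + b) ^ p - a ^ p - b ^ p"
proof -
  have p: "p \<ge> 2" using assms prime_ge_2_nat by blast
  have "{..p} = insert 0 (insert p {0<..<p})" using p by auto
  then have "(a + b) ^ p = b ^ p + (a ^ p + (\<Sum>k\<in>{0<..<p}. of_nat (p choose k) * a ^ k * b ^ (p - k)))"
    unfolding binomial_ring using p by simp
  moreover have "of_nat p dvd (\<Sum>k\<in>{0<..<p}. of_nat (p choose k) * a ^ k * b ^ (p - k))"
  proof (rule dvd_sum)
    fix k assume "k \<in> {0<..<p}"
    then have "p dvd (p choose k)" using dvd_choose_prime assms by auto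
    then have "(of_nat p :: 'a) dvd of_nat (p choose k)" by (auto simp: dvd_def)
    then show "of_nat p dvd of_nat (p choose k) * a ^ k * b ^ (p - k)"
      by (simp add: dvd_mult2)
  qed
  ultimately show ?thesis by simp
qed

lemma prime_dvd_power_diff_int:
  assumes "prime p"
  shows "int p dvd a ^ p - a"
proof -
  have "[a ^ p = a] (mod int p)"
  proof (cases "int p dvd a")
    case True
    moreover have "a dvd a ^ p" using assms prime_gt_0_nat by (simp add: dvd_power)
    ultimately show ?thesis by (meson cong_iff_dvd_diff dvd_diff dvd_trans)
  next
    case False
    have "\<not> p dvd nat (a mod int p)"
      using False prime_gt_0_nat[OF assms] by (simp add: nat_dvd_iff flip: int_dvd_int_iff) (simp add: dvd_eq_mod_eq_0)
    then have "[nat (a mod int p) ^ (p - 1) = 1] (mod p)"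
      using assms by (intro Residues.fermat_theorem)
    then have "[int (nat (a mod int p) ^ (p - 1)) = int 1] (mod int p)" by (simp only: cong_int_iff)
    then have "[a ^ (p - 1) = 1] (mod int p)"
      using assms prime_gt_0_nat by (simp add: cong_def power_mod)
    then have "[a * a ^ (p - 1) = a * 1] (mod int p)" by (rule cong_scalar_left)
    then show ?thesis using assms prime_gt_0_nat by (simp flip: power_Suc)
  qed
  then show ?thesis by (simp add: cong_iff_dvd_diff)
qed

text \<open>Frobenius modulo p, with \<open>pcompose h (monom 1 p)\<close> standing for h(X^p). The
  induction is on the coefficients: the preceding divisibility splits off the constant term a, and
  Fermat's little theorem turns a^p into a.\<close>

lemma int_poly_frobenius:
  assumes "prime p"
  shows "of_nat p dvd h ^ p - pcompose h (monom (1::int) p)"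
proof (induction h)
  case 0
  then show ?case using assms prime_gt_0_nat by (simp add: power_0_left)
next
  case (pCons a h)
  define X where "X = [:0, 1::int:]"
  have 1: "pCons a h = [:a:] + X * h" by (simp add: X_def)
  have 2: "pcompose (pCons a h) (monom 1 p) = [:a:] + X ^ p * pcompose h (monom 1 p)"
    by (simp add: pcompose_pCons X_def monom_altdef)
  have "of_nat p dvd [:a:] ^ p - [:a:]"
  proof -
    have "[:a:] ^ p - [:a:] = [:a ^ p - a:]" by (simp add: poly_const_pow)
    moreover have "of_nat p = [:int p:]" by (simp add: of_nat_poly)
    ultimately show ?thesis using prime_dvd_power_diff_int[OF assms] by (simp add: const_poly_dvd)
  qed
  moreover have "of_nat p dvd X ^ p * (h ^ p - pcompose h (monom 1 p))"
    using pCons by simp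
  moreover note prime_dvd_binomial_diff[OF assms, of "[:a:]" "X * h"]
  moreover have "(pCons a h) ^ p - pcompose (pCons a h) (monom 1 p) =
    (([:a:] + X * h) ^ p - [:a:] ^ p - (X * h) ^ p) + ([:a:] ^ p - [:a:])
      + X ^ p * (h ^ p - pcompose h (monom 1 p))"
    unfolding 2 unfolding 1 by (simp add: algebra_simps power_mult_distrib)
  ultimately show ?case by (metis dvd_add)
qed

text \<open>Gauss's lemma in disguise. \<open>f\<close> is the primitive part of an annihilating
  polynomial of least degree. Pseudo-division by it leaves remainder 0 by minimality, and since
  \<open>f\<close> has content 1, the factor introduced by pseudo-division divides the content of
  the quotient and cancels.\<close>

lemma int_minimal_poly:
  fixes w :: complex
  assumes "\<exists>g. g \<noteq> 0 \<and> poly (of_int_poly g) w = 0"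
  obtains f :: "int poly" where "f \<noteq> 0" "\<And>g. poly (of_int_poly g) w = 0 \<longleftrightarrow> f dvd g"
proof -
  define P where "P g \<longleftrightarrow> g \<noteq> 0 \<and> poly (of_int_poly g) w = 0" for g :: "int poly"
  obtain f0 where f0: "P f0" "\<And>g. P g \<Longrightarrow> degree f0 \<le> degree g"
    using assms ex_has_least_nat[of P _ degree] unfolding P_def by blast
  define f where "f = primitive_part f0"
  have f0f: "f0 = Polynomial.smult (content f0) f" by (simp add: f_def)
  have c0: "content f0 \<noteq> 0" using f0 by (simp add: P_def)
  have f: "f \<noteq> 0" "content f = 1" "degree f = degree f0"
    using f0(1) by (auto simp: f_def P_def)
  have "poly (of_int_poly f0) w = of_int (content f0) * poly (of_int_poly f) w"
    by (subst f0f) (simp add: hom_distribs)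
  then have root: "poly (of_int_poly f) w = 0" using f0(1) c0 unfolding P_def by auto
  have "f dvd g" if g: "poly (of_int_poly g) w = 0" for g
  proof -
    obtain q r where qr: "pseudo_divmod g f = (q, r)" by fastforce
    define c where "c = lead_coeff f ^ (Suc (degree g) - degree f)"
    have e: "Polynomial.smult c g = f * q + r" "r = 0 \<or> degree r < degree f"
      using pseudo_divmod[OF f(1) qr] by (auto simp: c_def)
    have "poly (of_int_poly (Polynomial.smult c g)) w = poly (of_int_poly (f * q + r)) w"
      using e by simp
    then have "poly (of_int_poly r) w = 0" using g root by (simp add: hom_distribs)
    then have "r = 0" using f0(2)[of r] e(2) f(3) unfolding P_def by (metis not_le)
    then have e1: "Polynomial.smult c g = f * q" using e by simp
    have "content (Polynomial.smult c g) = content q" using e1 f(2) by (simp add: content_mult)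
    then have "content q = normalize c * content g" by (simp add: content_smult)
    then have "c dvd content q" by simp
    then obtain q' where "q = Polynomial.smult c q'"
      by (metis content_times_primitive_part dvdE smult_smult)
    then have "Polynomial.smult c g = Polynomial.smult c (f * q')" using e1 by simp
    moreover have "c \<noteq> 0" using f(1) by (simp add: c_def)
    ultimately have "g = f * q'" by (simp add: smult_cancel)
    then show ?thesis by simp
  qed
  moreover have "poly (of_int_poly g) w = 0" if "f dvd g" for g
    using that root by (auto simp: dvd_def hom_distribs)
  ultimately show ?thesis using that f(1) by blast
qed

text \<open>A polynomial of positive degree with unit leading coefficient stays a nonunit modulo
  every p > 1, whereas \<open>A\<close> and \<open>B\<close> make it invertible. After
  \<open>B\<close> is reduced modulo \<open>f\<close>, the multiple 1 - p s' of \<open>f\<close> has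
  smaller degree than \<open>f\<close> and vanishes; its constant coefficient then shows that p
  divides 1.\<close>

lemma unit_lead_coeff_coprime_prime:
  fixes f A B :: "int poly"
  assumes "lead_coeff f * l = 1" "degree f > 0" "f * A + of_nat p * B = 1"
  shows "p = 1"
proof -
  have f0: "f \<noteq> 0" using assms by auto
  obtain q s where qs: "pseudo_divmod B f = (q, s)" by fastforce
  define k where "k = Suc (degree B) - degree f"
  define c where "c = lead_coeff f ^ k"
  have e: "Polynomial.smult c B = f * q + s" "s = 0 \<or> degree s < degree f"
    using pseudo_divmod[OF f0 qs] by (auto simp: c_def k_def)
  \<comment> \<open>\<open>l\<close> inverts the leading coefficient, so pseudo-division becomes
    genuine division over the integers.\<close>
  have l: "l ^ k * c = 1" using assms(1) by (simp add: c_def mult.commute flip: power_mult_distrib)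
  define s' where "s' = Polynomial.smult (l ^ k) s"
  have "B = Polynomial.smult (l ^ k) (Polynomial.smult c B)" using l by simp
  also have "\<dots> = f * Polynomial.smult (l ^ k) q + s'" unfolding e s'_def by (simp add: smult_add_right)
  finally have B: "B = f * Polynomial.smult (l ^ k) q + s'" .
  have s': "degree s' < degree f" using e(2) assms(2) unfolding s'_def 
    by (metis degree_0 degree_smult_le le_less_trans smult_0_right)
  define r where "r = 1 - of_nat p * s'"
  have r: "r = f * (A + of_nat p * Polynomial.smult (l ^ k) q)"
    using assms(3) unfolding r_def B by (simp add: algebra_simps)
  have pp: "of_nat p * s' = Polynomial.smult (int p) s'" by (simp add: of_nat_poly)
  have "degree r < degree f"
    unfolding r_def pp using s' assms(2) by (intro degree_diff_less) (auto intro: le_less_trans[OF degree_smult_le])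
  then have "r = 0" using r by (metis degree_mult_right_le leD mult_zero_right f0 mult_eq_0_iff)
  then have "coeff (of_nat p * s') 0 = 1" unfolding r_def by simp
  then have "int p * coeff s' 0 = 1" unfolding pp by simp
  then show ?thesis by (metis dvd_triv_left int_dvd_int_iff nat_dvd_1_iff_1 of_nat_1)
qed

text \<open>Dedekind's argument for the irreducibility of cyclotomic polynomials. Let X^e - 1 = f h
  with f minimal for w. If f did not vanish at w^p, then h would, so f would divide h(X^p), which is
  h^p modulo p. Then f and h would have a common factor modulo p, although X^e - 1 is separable
  there.\<close>

lemma root_power_prime:
  fixes w :: complex
  assumes w: "w ^ e = 1" and e: "e > 0" and p: "prime p" "\<not> p dvd e"
    and g: "poly (of_int_poly g) w = 0"
  shows "poly (of_int_poly g) (w ^ p) = 0"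
proof -
  define X where "X = [:0, 1::int:]"
  define c where "c = X ^ e - 1"
  have polyc: "poly (of_int_poly c) z = z ^ e - 1" for z :: complex
    by (simp add: c_def X_def hom_distribs)
  have c0: "c \<noteq> 0" 
  proof
    assume "c = 0"
    then have "poly (of_int_poly c) 0 = (0::complex)" by simp
    then show False using e unfolding polyc by (simp add: power_0_left)
  qed
  obtain f where f0: "f \<noteq> 0" and f: "\<And>g. poly (of_int_poly g) w = 0 \<longleftrightarrow> f dvd g"
    using int_minimal_poly[of w] c0 polyc w by (metis diff_self)
  have "f dvd c" using f[of c] polyc[of w] w by simp
  then obtain h where h: "c = f * h" by (elim dvdE)
  have "poly (of_int_poly f) (w ^ p) = 0"
  proof (rule ccontr)
    assume nz: "poly (of_int_poly f) (w ^ p) \<noteq> 0"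
    have "poly (of_int_poly c) (w ^ p) = 0" unfolding polyc using w by (metis diff_self mult.commute power_mult power_one)
    then have "poly (of_int_poly h) (w ^ p) = 0" using nz by (simp add: h hom_distribs)
    then have "poly (of_int_poly (pcompose h (Polynomial.monom 1 p))) w = 0"
      by (simp add: of_int_hom.map_poly_pcompose poly_pcompose poly_monom hom_distribs)
    then obtain a where a: "pcompose h (Polynomial.monom 1 p) = f * a" using f by (auto elim: dvdE)
    obtain b where "h ^ p - pcompose h (Polynomial.monom 1 p) = of_nat p * b"
      using int_poly_frobenius[OF p(1), of h] by (auto elim: dvdE)
    then have hp: "h ^ p = f * a + of_nat p * b" using a by (simp add: algebra_simps)
    \<comment> \<open>Separability as an identity over the integers: the derivative puts e into the
      ideal generated by f and h.\<close>
    have "X * pderiv c = of_nat e * X ^ e"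
      using e unfolding c_def X_def
      by (simp add: pderiv_diff pderiv_power pderiv_pCons of_nat_poly flip: power_Suc)
    also have "X ^ e = 1 + f * h" using h by (simp add: c_def algebra_simps)
    finally have "of_nat e = f * (X * pderiv h - of_nat e * h) + h * (X * pderiv f)"
      unfolding h pderiv_mult by (simp add: algebra_simps)
    then obtain u v where uv: "of_nat e = f * u + h * v" by blast
    \<comment> \<open>The p-th power of e = f u + h v trades h for h^p, which lies in the ideal (f,
      p). As e^p is prime to p, this ideal contains 1.\<close>
    have "f * u + h * v - h * v dvd (f * u + h * v) ^ p - (h * v) ^ p"
      by (metis dvd_triv_left power_diff_sumr2)
    then have "f dvd (f * u + h * v) ^ p - (h * v) ^ p"
      by (metis add_diff_cancel_right' dvd_mult_left)
    then obtain d where "of_nat e ^ p - (h * v) ^ p = f * d" unfolding uv by (elim dvdE)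
    then have ep: "of_nat e ^ p = f * (d + a * v ^ p) + of_nat p * (b * v ^ p)"
      by (simp add: power_mult_distrib hp algebra_simps)
    have "coprime (int e ^ p) (int p)"
      using p by (metis coprime_commute coprime_power_left_iff of_nat_power coprime_int_iff prime_imp_coprime)
    then obtain s t where st: "s * int e ^ p + t * int p = 1"
      by (metis bezout_int coprime_imp_gcd_eq_1)
    have "of_int (s * int e ^ p + t * int p) = (1 :: int poly)" unfolding st by simp
    then have "of_int s * of_nat e ^ p + of_int t * of_nat p = (1 :: int poly)" by simp
    then have 1: "f * (of_int s * (d + a * v ^ p)) + of_nat p * (of_int s * b * v ^ p + of_int t) = 1"
      unfolding ep by (simp add: algebra_simps)
    have "lead_coeff c = 1" 
    proof -
      have "degree (1::int poly) < degree (X ^ e)" using e by (simp add: X_def degree_power_eq)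
      then have "lead_coeff (- 1 + X ^ e) = lead_coeff (X ^ e)" by (intro lead_coeff_add_le) simp
      then show ?thesis by (simp add: c_def X_def lead_coeff_power)
    qed
    then have lc: "lead_coeff f * lead_coeff h = 1" by (simp add: h lead_coeff_mult)
    have "degree f > 0"
    proof (rule ccontr)
      assume "\<not> degree f > 0"
      then obtain k where k: "f = [:k:]" using degree_eq_zeroE by auto
      have "poly (of_int_poly f) w = 0" using f by simp
      then show False using f0 k by simp
    qed
    then have "p = 1" using unit_lead_coeff_coprime_prime[OF lc _ 1] by simp
    then show False using p by simp
  qed
  moreover obtain k where "g = f * k" using f g by (auto elim: dvdE)
  ultimately show ?thesis by (simp add: hom_distribs)
qed

text \<open>Each prime factor p of n replaces w by w^p, again an e-th root of unity; hence the
  induction generalizes over w.\<close>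

lemma root_power_coprime:
  fixes w :: complex
  assumes "e > 0" "coprime n e" "n > 0" "w ^ e = 1" "poly (of_int_poly g) w = 0"
  shows "poly (of_int_poly g) (w ^ n) = 0"
  using assms(2-5)
proof (induction n arbitrary: w rule: prime_divisors_induct)
  case (factor p x)
  have p: "prime p" "\<not> p dvd e" using factor.hyps factor.prems(1)
    by (auto dest: prime_imp_prime_elem simp: prime_nat_iff)
  have "poly (of_int_poly g) (w ^ p) = 0" using root_power_prime[OF _ assms(1) p] factor.prems by auto
  moreover have "(w ^ p) ^ e = 1" using factor.prems by (metis mult.commute power_mult power_one)
  ultimately show ?case using factor.IH[of "w ^ p"] factor.prems by (simp add: power_mult)
qed auto

lemma rat_poly_common_denominator:
  fixes q :: "rat poly"
  obtains d :: int and g where "d \<noteq> 0" "Polynomial.smult (of_int d) q = of_int_poly g"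
proof (induction q arbitrary: thesis)
  case 0
  show ?case using 0[of 1 0] by simp
next
  case (pCons a q)
  obtain d g where d: "d \<noteq> 0" "Polynomial.smult (of_int d) q = of_int_poly g" using pCons by blast
  obtain m k where "quotient_of a = (m, k)" by fastforce
  then have a: "a = of_int m / of_int k" "k > 0" using quotient_of_div quotient_of_denom_pos by auto
  have "Polynomial.smult (of_int (k * d)) (pCons a q) = 
    pCons (of_int (d * m)) (Polynomial.smult (of_int k) (Polynomial.smult (of_int d) q))"
    using a by simp
  also have "\<dots> = of_int_poly (pCons (d * m) (Polynomial.smult k g))"
    unfolding d by (simp add: hom_distribs)
  finally show ?case using pCons.prems a d by (metis less_irrefl mult_eq_0_iff)
qed

lemma zeta_power: "e > 0 \<Longrightarrow> zeta e ^ e = 1"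
  unfolding zeta_def by (simp add: DeMoivre)

text \<open>This makes the choice in \<open>gal_gamma\<close> well defined: it is irreducibility of the
  cyclotomic polynomial in disguise.\<close>
lemma gal_gamma_poly:
  assumes e: "e > 0" and n: "coprime n e" "n > 0" and r: "[r = int n] (mod int e)"
  shows "gal_gamma e r (poly (map_poly of_rat p) (zeta e)) = poly (map_poly of_rat p) (zeta e ^ n)"
proof -
  let ?z = "zeta e"
  have z: "?z ^ e = 1" and z0: "?z \<noteq> 0" using zeta_power[OF e] by (auto simp: zeta_def)
  obtain k where k: "r = int n + int e * k" using r by (metis cong_iff_lin cong_sym)
  have zr: "?z powi r = ?z ^ n"
    unfolding k using z z0 by (simp add: power_int_add power_int_mult)
  \<comment> \<open>Independence of the chosen polynomial: the difference of two representations
    vanishes at \<open>zeta e\<close>, and once denominators are cleared,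
    \<open>root_power_coprime\<close> moves the zero to \<open>zeta e ^ n\<close>.\<close>
  have eq: "poly (map_poly of_rat q) (?z ^ n) = poly (map_poly of_rat p) (?z ^ n)"
    if "poly (map_poly of_rat q) ?z = poly (map_poly of_rat p) ?z" for q
  proof -
    obtain d g where d: "d \<noteq> 0" "Polynomial.smult (of_int d) (q - p) = of_int_poly g"
      using rat_poly_common_denominator by blast
    have dd: "of_int d * (poly (map_poly of_rat q) x - poly (map_poly of_rat p) x) =
       poly (of_int_poly g) x" for x :: complex
    proof -
      have "poly (map_poly of_rat (Polynomial.smult (of_int d) (q - p))) x 
          = of_int d * (poly (map_poly of_rat q) x - poly (map_poly of_rat p) x)"
      proof -
        have "map_poly of_rat (q - p) = (map_poly of_rat q - map_poly of_rat p :: complex poly)"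
          by (rule poly_eqI) (simp add: coeff_map_poly of_rat_diff)
        then show ?thesis by (simp add: hom_distribs)
      qed
      moreover have "map_poly of_rat (of_int_poly g) = (of_int_poly g :: complex poly)"
        by (rule poly_eqI) (simp add: coeff_map_poly)
      ultimately show ?thesis using d by simp
    qed
    have "poly (of_int_poly g) ?z = 0" using dd[of ?z] that by simp
    then have "poly (of_int_poly g) (?z ^ n) = 0" using root_power_coprime e n z by blast
    then show ?thesis using dd[of "?z ^ n"] d by simp
  qed
  show ?thesis unfolding gal_gamma_def zr
  proof (rule some_equality)
    fix w assume "\<exists>q. poly (map_poly of_rat p) ?z = poly (map_poly of_rat q) ?z \<and> w = poly (map_poly of_rat q) (?z ^ n)"
    then obtain q where "poly (map_poly of_rat q) ?z = poly (map_poly of_rat p) ?z" "w = poly (map_poly of_rat q) (?z ^ n)"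
      by metis
    then show "w = poly (map_poly of_rat p) (?z ^ n)" using eq[of q] by simp
  qed blast
qed

subsection \<open>Traces of powers of matrices of finite order\<close>

lemma mat_trace_mult_swap:
  assumes "A \<in> carrier_mat n m" "B \<in> carrier_mat m n"
  shows "mat_trace (A * B) = mat_trace (B * A)"
proof -
  have "mat_trace (A * B) = (\<Sum>i<n. \<Sum>j<m. A $$ (i, j) * B $$ (j, i))"
    using assms unfolding mat_trace_def
    by (auto simp: scalar_prod_def lessThan_atLeast0 intro!: sum.cong)
  also have "\<dots> = (\<Sum>j<m. \<Sum>i<n. B $$ (j, i) * A $$ (i, j))"
    by (subst sum.swap) (simp add: mult.commute)
  also have "\<dots> = mat_trace (B * A)"
    using assms unfolding mat_trace_def
    by (auto simp: scalar_prod_def lessThan_atLeast0 intro!: sum.cong)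
  finally show ?thesis .
qed

lemma mat_trace_similar:
  assumes "similar_mat_wit A B P Q"
  shows "mat_trace A = mat_trace B"
proof -
  define n where "n = dim_row A"
  note d = similar_mat_witD[OF n_def assms]
  have "mat_trace A = mat_trace (P * (B * Q))" using d by simp
  also have "\<dots> = mat_trace ((B * Q) * P)" using d by (intro mat_trace_mult_swap[of _ n n]) auto
  also have "(B * Q) * P = B" using d by simp
  finally show ?thesis .
qed

lemma upper_triangular_mult:
  fixes A :: "'a::semiring_1 mat"
  assumes "A \<in> carrier_mat n n" "B \<in> carrier_mat n n" "upper_triangular A" "upper_triangular B"
  shows "upper_triangular (A * B)" "\<And>i. i < n \<Longrightarrow> (A * B) $$ (i, i) = A $$ (i, i) * B $$ (i, i)"
proof -
  show "upper_triangular (A * B)"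
  proof
    fix i j assume ij: "j < i" "i < dim_row (A * B)"
    then have "(A * B) $$ (i, j) = (\<Sum>k<n. A $$ (i, k) * B $$ (k, j))"
      using assms(1,2) by (auto simp: scalar_prod_def lessThan_atLeast0)
    also have "\<dots> = 0"
    proof (intro sum.neutral ballI)
      fix k assume "k \<in> {..<n}"
      then show "A $$ (i, k) * B $$ (k, j) = 0"
        using assms ij by (cases "k < i") (auto simp: upper_triangularD)
    qed
    finally show "(A * B) $$ (i, j) = 0" .
  qed
  fix i assume i: "i < n"
  then have "(A * B) $$ (i, i) = (\<Sum>k<n. A $$ (i, k) * B $$ (k, i))"
    using assms(1,2) by (auto simp: scalar_prod_def lessThan_atLeast0)
  also have "\<dots> = (\<Sum>k\<in>{i}. A $$ (i, k) * B $$ (k, i))"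
  proof (intro sum.mono_neutral_right ballI)
    fix k assume "k \<in> {..<n} - {i}"
    then show "A $$ (i, k) * B $$ (k, i) = 0"
      using assms i by (cases "k < i") (auto simp: upper_triangularD)
  qed (use i in auto)
  finally show "(A * B) $$ (i, i) = A $$ (i, i) * B $$ (i, i)" by simp
qed

lemma upper_triangular_power:
  fixes B :: "'a::semiring_1 mat"
  assumes "B \<in> carrier_mat n n" "upper_triangular B"
  shows "upper_triangular (B ^\<^sub>m k) \<and> (\<forall>i<n. (B ^\<^sub>m k) $$ (i, i) = (B $$ (i, i)) ^ k)"
proof (induction k)
  case 0
  then show ?case using assms by auto
next
  case (Suc k)
  then show ?case
    using upper_triangular_mult[of "B ^\<^sub>m k" n B] assms by (auto simp: power_commutes)
qed

lemma zeta_root_of_unity: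
  assumes "e > 0" "z ^ e = 1"
  obtains j where "z = zeta e ^ j"
proof -
  have "z \<in> (\<lambda>k. cis (2 * pi * real k / real e)) ` {..<e}"
    using bij_betw_roots_unity[OF assms(1)] assms(2) unfolding bij_betw_def by auto
  then show ?thesis using that unfolding zeta_def by (auto simp: DeMoivre mult_ac)
qed

text \<open>The eigenvalues of \<open>A\<close> are zero or powers of \<open>zeta e\<close>.\<close>
lemma trace_powers_poly:
  assumes A: "A \<in> carrier_mat n n" and e: "e > 0" and Ae: "A ^\<^sub>m Suc e = A"
  obtains p :: "rat poly"
  where "\<And>k. k > 0 \<Longrightarrow> mat_trace (A ^\<^sub>m k) = poly (map_poly of_rat p) (zeta e ^ k)"
proof -
  obtain es where es: "char_poly A = (\<Prod>a\<leftarrow>es. [:- a, 1:])" using char_poly_factorized[OF A] by blast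
  obtain B P Q where B: "upper_triangular B" and sim: "similar_mat_wit A B P Q"
    using schur_decomposition_exists[OF A es] unfolding similar_mat_def by blast
  have Bc: "B \<in> carrier_mat n n" using similar_mat_witD2[OF A sim] by simp
  have up: "(B ^\<^sub>m k) $$ (i, i) = (B $$ (i, i)) ^ k" if "i < n" for i k
    using upper_triangular_power[OF Bc B] that by blast
  have tr: "mat_trace (A ^\<^sub>m k) = (\<Sum>i<n. (B $$ (i, i)) ^ k)" for k
  proof -
    have "mat_trace (A ^\<^sub>m k) = mat_trace (B ^\<^sub>m k)"
      by (rule mat_trace_similar[OF similar_mat_wit_pow[OF sim]])
    also have "\<dots> = (\<Sum>i<n. (B ^\<^sub>m k) $$ (i, i))" using Bc unfolding mat_trace_def by simp
    finally show ?thesis using up by simp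
  qed
  \<comment> \<open>The relation A^(e+1) = A passes to the triangular matrix. Unlike A^e = 1 it
    allows zero eigenvalues, as occur for an invertible matrix cut down by a projection.\<close>
  have "similar_mat_wit B A Q P" using sim by (rule similar_mat_wit_sym)
  then have "B ^\<^sub>m Suc e = Q * A ^\<^sub>m Suc e * P" by (rule similar_mat_wit_pow_id)
  also have "\<dots> = Q * A * P" unfolding Ae ..
  also have "\<dots> = B" using similar_mat_witD2[OF Bc \<open>similar_mat_wit B A Q P\<close>] by simp
  finally have Be: "B ^\<^sub>m Suc e = B" .
  have "\<exists>j. B $$ (i, i) = 0 \<or> B $$ (i, i) = zeta e ^ j" if "i < n" for i
  proof (cases "B $$ (i, i) = 0")
    case False
    have "(B $$ (i, i)) ^ Suc e = B $$ (i, i)" using up[OF that, of "Suc e"] unfolding Be by simp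
    then have "(B $$ (i, i)) ^ e = 1" using False by simp
    then show ?thesis using zeta_root_of_unity[OF e] by metis
  qed simp
  then obtain j where j: "\<And>i. i < n \<Longrightarrow> B $$ (i, i) = 0 \<or> B $$ (i, i) = zeta e ^ j i" by metis
  \<comment> \<open>One monomial for each nonzero eigenvalue. Zero eigenvalues drop out of positive
    powers only, whence the condition k > 0.\<close>
  define p :: "rat poly" where "p = (\<Sum>i | i < n \<and> B $$ (i, i) \<noteq> 0. Polynomial.monom 1 (j i))"
  show ?thesis
  proof
    fix k :: nat assume k: "k > 0"
    have "map_poly of_rat p = (\<Sum>i | i < n \<and> B $$ (i, i) \<noteq> 0. Polynomial.monom (1::complex) (j i))"
      unfolding p_def by (rule poly_eqI) (simp add: coeff_map_poly coeff_sum of_rat_sum if_distrib cong: if_cong)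
    then have "poly (map_poly of_rat p) (zeta e ^ k) = (\<Sum>i | i < n \<and> B $$ (i, i) \<noteq> 0. (zeta e ^ k) ^ j i)"
      by (simp add: poly_sum poly_monom)
    also have "\<dots> = (\<Sum>i | i < n \<and> B $$ (i, i) \<noteq> 0. (B $$ (i, i)) ^ k)"
    proof (intro sum.cong refl)
      fix i assume "i \<in> {i. i < n \<and> B $$ (i, i) \<noteq> 0}"
      then have "B $$ (i, i) = zeta e ^ j i" using j by blast
      then show "(zeta e ^ k) ^ j i = (B $$ (i, i)) ^ k" by (simp add: mult.commute flip: power_mult)
    qed
    also have "\<dots> = (\<Sum>i<n. (B $$ (i, i)) ^ k)"
      using k by (intro sum.mono_neutral_left) (auto simp: power_0_left)
    finally show "mat_trace (A ^\<^sub>m k) = poly (map_poly of_rat p) (zeta e ^ k)" using tr by simp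
  qed
qed

subsection \<open>Products of conjugacy classes and power maps\<close>

lemma card_preimage_eq_sum:
  assumes "finite T" "finite E"
  shows "card {t \<in> T. m t \<in> E} = (\<Sum>v\<in>E. card {t \<in> T. m t = v})"
proof -
  have "{t \<in> T. m t \<in> E} = (\<Union>v\<in>E. {t \<in> T. m t = v})" by auto
  also have "card \<dots> = (\<Sum>v\<in>E. card {t \<in> T. m t = v})"
    using assms by (intro card_UN_disjoint) auto
  finally show ?thesis .
qed

text \<open>Orbit counting for a cyclic group of prime order: a point that \<open>f\<close> moves
  has an orbit of exactly p points, and removing this orbit changes neither the count modulo p nor
  the fixed points.\<close>

lemma card_cong_fixed_points:
  assumes "finite S" "f ` S \<subseteq> S" "\<And>x. x \<in> S \<Longrightarrow> (f ^^ p) x = x" "prime p"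
  shows "[card S = card {x \<in> S. f x = x}] (mod p)"
  using assms(1-3)
proof (induction "card S" arbitrary: S rule: less_induct)
  case less
  show ?case
  proof (cases "\<forall>x\<in>S. f x = x")
    case True
    then have "{x \<in> S. f x = x} = S" by auto
    then show ?thesis by simp
  next
    case False
    then obtain x where x: "x \<in> S" "f x \<noteq> x" by blast
    have p: "p > 0" using assms(4) prime_gt_0_nat by simp
    have fS: "(f ^^ i) y \<in> S" if "y \<in> S" for i y
      by (induction i) (use less.prems that in auto)
    have mult: "(f ^^ (p * i)) y = y" if "y \<in> S" for i y
      by (induction i) (use less.prems that in \<open>auto simp: funpow_add\<close>)
    have ret: "(f ^^ (p - i)) ((f ^^ i) y) = y" if "i \<le> p" "y \<in> S" for i y
      using that less.prems(3) by (metis comp_apply funpow_add le_add_diff_inverse2)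
    define Q where "Q = (\<lambda>i. (f ^^ i) x) ` {..<p}"
    have "inj_on (\<lambda>i. (f ^^ i) x) {..<p}"
    proof (rule linorder_inj_onI')
      fix i j assume ij: "i \<in> {..<p}" "j \<in> {..<p}" "i < j"
      show "(f ^^ i) x \<noteq> (f ^^ j) x"
      proof
        assume eq: "(f ^^ i) x = (f ^^ j) x"
        have "(f ^^ j) x = (f ^^ i) ((f ^^ (j - i)) x)"
          using ij by (metis comp_apply funpow_add le_add_diff_inverse less_imp_le)
        then have "(f ^^ (p - i)) ((f ^^ i) x) = (f ^^ (p - i)) ((f ^^ i) ((f ^^ (j - i)) x))"
          using eq by simp
        then have d: "(f ^^ (j - i)) x = x"
          using ret ij x fS by (metis lessThan_iff less_imp_le)
        have d': "(f ^^ ((j - i) * k)) x = x" for k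
          by (induction k) (use d in \<open>auto simp: funpow_add\<close>)
        \<comment> \<open>If two of the first p iterates agreed, then \<open>f ^^ (j - i)\<close>
          and \<open>f ^^ p\<close> would both fix x, and by Bezout so would
          \<open>f\<close>.\<close>
        have "coprime (j - i) p"
          using assms(4) ij by (metis coprime_commute diff_is_0_eq dvd_imp_le lessThan_iff less_imp_diff_less not_less prime_imp_coprime zero_less_diff)
        then obtain a b where ab: "(j - i) * a = p * b + 1"
          using bezout_nat[of "j - i" p] ij by (metis coprime_imp_gcd_eq_1 diff_is_0_eq not_less)
        have "f x = (f ^^ (1 + p * b)) x" using mult[OF x(1)] by (simp add: funpow_add)
        also have "\<dots> = x" using d'[of a] ab by (simp add: add.commute)
        finally show False using x by simp
      qed
    qed
    then have cQ: "card Q = p" by (simp add: Q_def card_image)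
    have QS: "Q \<subseteq> S" using fS x by (auto simp: Q_def)
    have notfix: "f y \<noteq> y" if yQ: "y \<in> Q" for y
    proof
      assume fy: "f y = y"
      obtain i where i: "i < p" "y = (f ^^ i) x" using yQ by (auto simp: Q_def)
      have "(f ^^ k) y = y" for k by (induction k) (use fy in auto)
      then have "x = y" using ret[of i x] i x by (metis less_imp_le)
      then show False using fy x by simp
    qed
    have "f ` (S - Q) \<subseteq> S - Q"
    proof safe
      fix y assume y: "y \<in> S" "y \<notin> Q" "f y \<in> Q"
      then obtain i where i: "i < p" "f y = (f ^^ i) x" by (auto simp: Q_def)
      have "y = (f ^^ (p - 1)) ((f ^^ 1) y)" using ret[of 1 y] y p by simp
      also have "\<dots> = (f ^^ (p - 1 + i)) x" unfolding funpow_add using i by simp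
      also have "\<dots> = (f ^^ ((p - 1 + i) mod p)) x"
      proof -
        have "(f ^^ (p - 1 + i)) x = (f ^^ ((p - 1 + i) mod p + p * ((p - 1 + i) div p))) x" by simp
        then show ?thesis unfolding funpow_add using mult x by simp
      qed
      also have "\<dots> \<in> Q" using p by (auto simp: Q_def)
      finally show False using y by simp
    qed (use less.prems in auto)
    moreover have "card (S - Q) < card S"
      using QS cQ p less.prems(1) by (metis card_0_eq card_Diff_subset card_mono diff_less finite_subset le_zero_eq neq0_conv)
    ultimately have "[card (S - Q) = card {x \<in> S - Q. f x = x}] (mod p)"
      using less.prems by (intro less.hyps) auto
    moreover have "{x \<in> S - Q. f x = x} = {x \<in> S. f x = x}" using notfix by auto
    moreover have "card S = card (S - Q) + p"
      using QS cQ less.prems(1) by (metis card_Diff_subset card_mono finite_subset le_add_diff_inverse2)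
    ultimately show ?thesis by (simp add: cong_def)
  qed
qed

text \<open>\<open>rotate1\<close> generates an action of the cyclic group of order p on lists of
  length p, and its fixed points are the constant lists.\<close>

lemma card_lists_cong_constant:
  assumes C: "finite C" and p: "prime p"
    and P: "\<And>xs. length xs = p \<Longrightarrow> set xs \<subseteq> C \<Longrightarrow> P xs \<Longrightarrow> P (rotate1 xs)"
  shows "[card {xs. length xs = p \<and> set xs \<subseteq> C \<and> P xs} = card {x \<in> C. P (replicate p x)}] (mod p)"
proof -
  define S where "S = {xs. length xs = p \<and> set xs \<subseteq> C \<and> P xs}"
  have p0: "p > 0" using p prime_gt_0_nat by simp
  have "S \<subseteq> {xs. set xs \<subseteq> C \<and> length xs = p}" by (auto simp: S_def)
  then have "finite S" using finite_lists_length_eq[OF C] finite_subset by blast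
  moreover have "rotate1 ` S \<subseteq> S" using P by (auto simp: S_def)
  moreover have "(rotate1 ^^ p) xs = xs" if "xs \<in> S" for xs
    using that by (simp add: S_def flip: rotate_def)
  ultimately have "[card S = card {xs \<in> S. rotate1 xs = xs}] (mod p)"
    using card_cong_fixed_points p by blast
  moreover have "{xs \<in> S. rotate1 xs = xs} = replicate p ` {x \<in> C. P (replicate p x)}"
  proof (intro equalityI subsetI)
    fix xs assume xs: "xs \<in> {xs \<in> S. rotate1 xs = xs}"
    then have len: "length xs = p" by (simp add: S_def)
    have rot: "rotate k xs = xs" for k
      unfolding rotate_def by (induction k) (use xs in auto)
    have "xs ! k = hd xs" if "k < p" for k
      using rot[of k] that len by (metis hd_rotate_conv_nth length_0_conv mod_less not_less_zero)
    then have "xs = replicate p (hd xs)" using len by (intro nth_equalityI) auto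
    moreover have "hd xs \<in> C" using xs p0 by (auto simp: S_def)
    ultimately show "xs \<in> replicate p ` {x \<in> C. P (replicate p x)}"
      using xs by (auto simp: S_def intro!: image_eqI[of _ _ "hd xs"])
  next
    fix xs assume "xs \<in> replicate p ` {x \<in> C. P (replicate p x)}"
    then obtain x where x: "x \<in> C" "P (replicate p x)" "xs = replicate p x" by blast
    have "rotate1 (replicate p x) = replicate p x"
      using p0 by (cases p) (auto simp: replicate_append_same)
    then show "xs \<in> {xs \<in> S. rotate1 xs = xs}" using x by (auto simp: S_def)
  qed
  moreover have "inj (replicate p :: 'a \<Rightarrow> _)" using p0 by (intro injI) (metis replicate_eq_replicate neq0_conv)
  ultimately show ?thesis unfolding S_def by (metis (no_types, lifting) card_image inj_on_subset subset_UNIV)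
qed

definition lprod :: "('a, 'b) monoid_scheme \<Rightarrow> 'a list \<Rightarrow> 'a" where
  "lprod G xs = foldr (\<lambda>x a. x \<otimes>\<^bsub>G\<^esub> a) xs \<one>\<^bsub>G\<^esub>"

definition conj_invariant :: "('a, 'b) monoid_scheme \<Rightarrow> 'a set \<Rightarrow> bool" where
  "conj_invariant G C \<longleftrightarrow> C \<subseteq> carrier G \<and>
     (\<forall>g\<in>carrier G. \<forall>x\<in>C. g \<otimes>\<^bsub>G\<^esub> x \<otimes>\<^bsub>G\<^esub> inv\<^bsub>G\<^esub> g \<in> C)"

section \<open>Conjugation and ordered products in a group\<close>

context group
begin

definition conj_by :: "'a \<Rightarrow> 'a \<Rightarrow> 'a" where
  "conj_by g x = g \<otimes> x \<otimes> inv g"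

lemma conj_by_closed [simp]: "\<lbrakk>g \<in> carrier G; x \<in> carrier G\<rbrakk> \<Longrightarrow> conj_by g x \<in> carrier G"
  by (simp add: conj_by_def)

lemma conj_by_one [simp]: "x \<in> carrier G \<Longrightarrow> conj_by \<one> x = x" "g \<in> carrier G \<Longrightarrow> conj_by g \<one> = \<one>"
  by (simp_all add: conj_by_def)

lemma conj_conj [simp]:
  "\<lbrakk>g \<in> carrier G; h \<in> carrier G; x \<in> carrier G\<rbrakk> \<Longrightarrow> conj_by g (conj_by h x) = conj_by (g \<otimes> h) x"
  by (simp add: conj_by_def inv_mult_group m_assoc)

lemma conj_inv_conj:
  assumes "g \<in> carrier G" "x \<in> carrier G"
  shows "conj_by (inv g) (conj_by g x) = x" "conj_by g (conj_by (inv g) x) = x"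
  using assms by simp_all

lemma conj_mult:
  "\<lbrakk>g \<in> carrier G; x \<in> carrier G; y \<in> carrier G\<rbrakk> \<Longrightarrow> conj_by g (x \<otimes> y) = conj_by g x \<otimes> conj_by g y"
  by (simp add: conj_by_def m_assoc inv_solve_left)

lemma conj_inj: "\<lbrakk>g \<in> carrier G; x \<in> carrier G; y \<in> carrier G; conj_by g x = conj_by g y\<rbrakk> \<Longrightarrow> x = y"
  by (metis conj_inv_conj(1))

lemma conj_pow:
  assumes "g \<in> carrier G" "x \<in> carrier G"
  shows "conj_by g (x [^] (n::nat)) = conj_by g x [^] n"
proof (induction n)
  case (Suc n)
  then show ?case using assms conj_mult[of g "x [^] n" x] by simp
qed (use assms in simp)

lemma conj_by_inv:
  "\<lbrakk>g \<in> carrier G; x \<in> carrier G\<rbrakk> \<Longrightarrow> inv (conj_by g x) = conj_by g (inv x)"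
  by (simp add: conj_by_def inv_mult_group m_assoc)

lemma conj_by_conj_by:
  assumes "g \<in> carrier G" "c \<in> carrier G" "x \<in> carrier G"
  shows "conj_by (conj_by g c) (conj_by g x) = conj_by g (conj_by c x)"
proof -
  have "conj_by g c \<otimes> g = g \<otimes> c" using assms by (simp add: conj_by_def m_assoc)
  then show ?thesis using assms by simp
qed

lemma subgroup_nat_pow_closed:
  "subgroup H G \<Longrightarrow> x \<in> H \<Longrightarrow> x [^] (k::nat) \<in> H"
  by (induction k) (simp_all add: subgroup.one_closed subgroup.m_closed)

lemma conj_invariantD:
  assumes "conj_invariant G C"
  shows "x \<in> C \<Longrightarrow> x \<in> carrier G" "\<lbrakk>g \<in> carrier G; x \<in> C\<rbrakk> \<Longrightarrow> conj_by g x \<in> C"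
  using assms by (auto simp: conj_invariant_def conj_by_def)

lemma conj_invariant_iff:
  assumes "conj_invariant G C" "g \<in> carrier G" "x \<in> carrier G"
  shows "conj_by g x \<in> C \<longleftrightarrow> x \<in> C"
  by (metis assms conj_invariantD(2) conj_inv_conj(1) inv_closed)

definition conj_class :: "'a \<Rightarrow> 'a set" where
  "conj_class u = (\<lambda>g. conj_by g u) ` carrier G"

lemma conj_class:
  assumes "u \<in> carrier G"
  shows "conj_invariant G (conj_class u)" "u \<in> conj_class u"
proof -
  have "conj_by g (conj_by h u) \<in> (\<lambda>g. conj_by g u) ` carrier G" if "g \<in> carrier G" "h \<in> carrier G" for g h
    using that assms by simp
  then show "conj_invariant G (conj_class u)"
    using assms unfolding conj_class_def conj_invariant_def by (auto simp flip: conj_by_def)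
  show "u \<in> conj_class u" using assms by (auto simp: conj_class_def intro!: image_eqI[of _ _ \<one>])
qed

lemma lprod_simps [simp]: "lprod G [] = \<one>" "lprod G (x # xs) = x \<otimes> lprod G xs"
  by (simp_all add: lprod_def)

lemma lprod_closed [simp]: "set xs \<subseteq> carrier G \<Longrightarrow> lprod G xs \<in> carrier G"
  by (induction xs) auto

lemma lprod_append: "set xs \<subseteq> carrier G \<Longrightarrow> set ys \<subseteq> carrier G \<Longrightarrow>
    lprod G (xs @ ys) = lprod G xs \<otimes> lprod G ys"
  by (induction xs) (auto simp: m_assoc)

lemma lprod_replicate: "x \<in> carrier G \<Longrightarrow> lprod G (replicate n x) = x [^] n"
  by (induction n) (simp, metis lprod_simps(2) nat_pow_Suc2 replicate_Suc)

lemma conj_lprod: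
  assumes "g \<in> carrier G" "set xs \<subseteq> carrier G"
  shows "conj_by g (lprod G xs) = lprod G (map (conj_by g) xs)"
  using assms(2)
proof (induction xs)
  case (Cons x xs)
  then show ?case using assms(1) conj_mult[of g x "lprod G xs"] by simp
qed (use assms in simp)

text \<open>Moving the first factor x to the end conjugates the product by \<open>inv x\<close>. The
  product itself may change, but not its conjugacy class.\<close>

lemma lprod_rotate1:
  assumes "set xs \<subseteq> carrier G" "conj_invariant G E" "lprod G xs \<in> E"
  shows "lprod G (rotate1 xs) \<in> E"
proof (cases xs)
  case (Cons x ys)
  then have x: "x \<in> carrier G" "set ys \<subseteq> carrier G" using assms by auto
  then have "lprod G (rotate1 xs) = lprod G ys \<otimes> x" using Cons by (simp add: lprod_append)
  also have "\<dots> = conj_by (inv x) (lprod G xs)" using x Cons by (simp add: conj_by_def m_assoc[symmetric])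
  also have "\<dots> \<in> E" using conj_invariantD(2)[OF assms(2) inv_closed[OF x(1)] assms(3)] .
  finally show ?thesis .
qed (use assms in simp)

text \<open>The map \<open>f\<close> admits entries that are not group elements: it will be the
  identity for elements of a set and multiplication for pairs.\<close>

lemma card_lists_lprod_cong:
  assumes "finite C" "prime p" "f ` C \<subseteq> carrier G" "conj_invariant G E"
  shows "[card {xs. length xs = p \<and> set xs \<subseteq> C \<and> lprod G (map f xs) \<in> E} =
     card {x \<in> C. f x [^] p \<in> E}] (mod p)"
proof -
  have "[card {xs. length xs = p \<and> set xs \<subseteq> C \<and> lprod G (map f xs) \<in> E} =
     card {x \<in> C. lprod G (map f (replicate p x)) \<in> E}] (mod p)"
  proof (rule card_lists_cong_constant[OF assms(1,2)])
    fix xs assume xs: "set xs \<subseteq> C" "lprod G (map f xs) \<in> E"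
    then show "lprod G (map f (rotate1 xs)) \<in> E"
      using assms(3,4) lprod_rotate1[of "map f xs" E] by (auto simp: rotate1_map)
  qed
  moreover have "{x \<in> C. lprod G (map f (replicate p x)) \<in> E} = {x \<in> C. f x [^] p \<in> E}"
    using assms(3) by (auto simp: lprod_replicate)
  ultimately show ?thesis by simp
qed

section \<open>Counting factorizations with factors in conjugation-invariant sets\<close>

definition ntuples :: "nat \<Rightarrow> 'a set \<Rightarrow> 'a \<Rightarrow> 'a list set" where
  "ntuples n C u = {xs. length xs = n \<and> set xs \<subseteq> C \<and> lprod G xs = u}"

lemma finite_ntuples: "finite C \<Longrightarrow> finite (ntuples n C u)"
  using finite_lists_length_eq[of C n] by (rule finite_subset[rotated]) (auto simp: ntuples_def)

lemma card_ntuples_conj_le: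
  assumes "finite (carrier G)" "conj_invariant G C" "g \<in> carrier G" "u \<in> carrier G"
  shows "card (ntuples n C u) \<le> card (ntuples n C (conj_by g u))"
proof (rule card_inj_on_le)
  have "finite C" using assms(1,2) finite_subset by (auto simp: conj_invariant_def)
  then show "finite (ntuples n C (conj_by g u))" by (rule finite_ntuples)
  show "inj_on (map (conj_by g)) (ntuples n C u)"
  proof (rule inj_onI)
    fix xs ys assume "xs \<in> ntuples n C u" "ys \<in> ntuples n C u" and eq: "map (conj_by g) xs = map (conj_by g) ys"
    then have "set xs \<union> set ys \<subseteq> carrier G"
      using conj_invariantD(1)[OF assms(2)] by (auto simp: ntuples_def)
    then have "inj_on (conj_by g) (set xs \<union> set ys)"
      using conj_inj[OF assms(3)] by (meson inj_onI subsetD)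
    then show "xs = ys" using eq by (metis map_inj_on)
  qed
  show "map (conj_by g) ` ntuples n C u \<subseteq> ntuples n C (conj_by g u)"
  proof
    fix ys assume "ys \<in> map (conj_by g) ` ntuples n C u"
    then obtain xs where xs: "xs \<in> ntuples n C u" "ys = map (conj_by g) xs" by blast
    then have "set xs \<subseteq> carrier G" using assms(2) by (auto simp: ntuples_def conj_invariant_def)
    then have "lprod G ys = conj_by g u" using conj_lprod[OF assms(3), of xs] xs by (simp add: ntuples_def)
    then show "ys \<in> ntuples n C (conj_by g u)"
      using xs assms conj_invariantD(2)[OF assms(2,3)] by (auto simp: ntuples_def)
  qed
qed

lemma card_ntuples_conj:
  assumes "finite (carrier G)" "conj_invariant G C" "g \<in> carrier G" "u \<in> carrier G"
  shows "card (ntuples n C (conj_by g u)) = card (ntuples n C u)"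
  using card_ntuples_conj_le[OF assms, of n] card_ntuples_conj_le[of C "inv g" "conj_by g u" n] assms
  by (simp add: conj_inv_conj)

lemma pow_inj_on:
  assumes "finite (carrier G)" "coprime n (order G)"
  shows "inj_on (\<lambda>x. x [^] (n::nat)) (carrier G)"
proof -
  obtain s where "[n * s = 1] (mod order G)" using cong_solve_coprime_nat[OF assms(2)] by auto
  then obtain a b where ab: "n * s + a * order G = 1 + b * order G"
    unfolding cong_iff_lin_nat by (metis mult.commute)
  have "(x [^] n) [^] s = x" if x: "x \<in> carrier G" for x
  proof -
    have one: "x [^] (k * order G) = \<one>" for k :: nat
    proof -
      have "x [^] (order G * k) = (x [^] order G) [^] k" using x by (simp only: nat_pow_pow)
      also have "\<dots> = \<one>" using x by (simp add: pow_order_eq_1)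
      finally show ?thesis by (simp add: mult.commute)
    qed
    have "x [^] (n * s) \<otimes> x [^] (a * order G) = x [^] (1::nat) \<otimes> x [^] (b * order G)"
      using x ab by (simp only: nat_pow_mult)
    then show ?thesis using x by (simp add: one nat_pow_pow)
  qed
  then show ?thesis by (intro inj_on_inverseI[of _ "\<lambda>y. y [^] s"])
qed

lemma conj_invariant_pow_image:
  assumes "conj_invariant G C"
  shows "conj_invariant G ((\<lambda>x. x [^] (n::nat)) ` C)"
  unfolding conj_invariant_def conj_by_def[symmetric]
proof safe
  fix x assume "x \<in> C"
  then have x: "x \<in> carrier G" using assms conj_invariantD by blast
  then show "x [^] n \<in> carrier G" by simp
  fix g assume g: "g \<in> carrier G"
  have "conj_by g (x [^] n) = conj_by g x [^] n" using conj_pow g x by simp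
  then show "conj_by g (x [^] n) \<in> (\<lambda>x. x [^] n) ` C"
    using conj_invariantD(2)[OF assms g \<open>x \<in> C\<close>] by blast
qed

text \<open>Rotation preserves only the class of the product, so factorizations are counted over the
  whole class of u. All members of the class have equally many, and the class has fewer than p
  elements, so its size cancels modulo p. The fixed points are the x in C with x^p in the class; as
  p-th powers are injective, there are as many of them as class members, or none.\<close>

lemma card_ntuples_cong:
  assumes fin: "finite (carrier G)" and C: "conj_invariant G C" and p: "prime p" "p > order G"
    and u: "u \<in> carrier G"
  shows "[card (ntuples p C u) = (if u \<in> (\<lambda>x. x [^] p) ` C then 1 else 0)] (mod p)"
proof -
  have finC: "finite C" and CG: "C \<subseteq> carrier G" using fin C finite_subset by (auto simp: conj_invariant_def)
  have cop: "coprime p (order G)"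
  proof (rule prime_imp_coprime[OF p(1)])
    have "order G > 0" using fin by (simp add: order_gt_0_iff_finite)
    then show "\<not> p dvd order G" using p(2) by (auto dest: dvd_imp_le)
  qed
  note cl = conj_class[OF u]
  have clG: "conj_class u \<subseteq> carrier G" using cl by (simp add: conj_invariant_def)
  then have fincl: "finite (conj_class u)" using fin finite_subset by blast
  have "{xs. length xs = p \<and> set xs \<subseteq> C \<and> lprod G (map (\<lambda>x. x) xs) \<in> conj_class u} =
      {xs \<in> {xs. set xs \<subseteq> C \<and> length xs = p}. lprod G xs \<in> conj_class u}" by auto
  also have "card \<dots> = (\<Sum>v\<in>conj_class u. card {xs \<in> {xs. set xs \<subseteq> C \<and> length xs = p}. lprod G xs = v})"
    by (rule card_preimage_eq_sum[OF finite_lists_length_eq[OF finC] fincl])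
  also have "\<dots> = (\<Sum>v\<in>conj_class u. card (ntuples p C v))"
    by (intro sum.cong refl arg_cong[of _ _ card]) (auto simp: ntuples_def)
  also have "\<dots> = (\<Sum>v\<in>conj_class u. card (ntuples p C u))"
    by (intro sum.cong refl) (auto simp: conj_class_def card_ntuples_conj fin C u)
  finally have 1: "[card (conj_class u) * card (ntuples p C u) = card {x \<in> C. x [^] p \<in> conj_class u}] (mod p)"
    using card_lists_lprod_cong[OF finC p(1), of "\<lambda>x. x", OF _ cl(1)] CG by simp
  have 2: "card {x \<in> C. x [^] p \<in> conj_class u} = card (conj_class u) * (if u \<in> (\<lambda>x. x [^] p) ` C then 1 else 0)"
  proof (cases "u \<in> (\<lambda>x. x [^] p) ` C")
    case True
    have inv: "conj_invariant G ((\<lambda>x. x [^] p) ` C)" using C by (rule conj_invariant_pow_image)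
    have "(\<lambda>x. x [^] p) ` {x \<in> C. x [^] p \<in> conj_class u} = conj_class u"
    proof (intro equalityI subsetI)
      fix v assume v: "v \<in> conj_class u"
      then have "v \<in> (\<lambda>x. x [^] p) ` C" using conj_invariantD(2)[OF inv _ True] by (auto simp: conj_class_def)
      then show "v \<in> (\<lambda>x. x [^] p) ` {x \<in> C. x [^] p \<in> conj_class u}" using v by blast
    qed auto
    moreover have "inj_on (\<lambda>x. x [^] p) {x \<in> C. x [^] p \<in> conj_class u}"
      using pow_inj_on[OF fin cop] CG by (auto intro: inj_on_subset)
    ultimately show ?thesis using True card_image[of "\<lambda>x. x [^] p" "{x \<in> C. x [^] p \<in> conj_class u}"] by simp
  next
    case False
    have "{x \<in> C. x [^] p \<in> conj_class u} = {}"
    proof safe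
      fix x assume x: "x \<in> C" "x [^] p \<in> conj_class u"
      have "x [^] p \<in> (\<lambda>x. x [^] p) ` C" using x by blast
      moreover obtain g where g: "g \<in> carrier G" "x [^] p = conj_by g u" using x by (auto simp: conj_class_def)
      ultimately have "u \<in> (\<lambda>x. x [^] p) ` C"
        using conj_invariant_iff[OF conj_invariant_pow_image[OF C] g(1) u] by auto
      then show "x \<in> {}" using False by simp
    qed
    then have "card {x \<in> C. x [^] p \<in> conj_class u} = 0" by (simp only: card.empty)
    then show ?thesis using False by simp
  qed
  have "coprime (card (conj_class u)) p"
  proof -
    have "card (conj_class u) \<le> order G" "card (conj_class u) > 0"
      using card_mono[OF fin clG] fincl cl(2) by (auto simp: Coset.order_def card_gt_0_iff)
    then have "\<not> p dvd card (conj_class u)" using p(2) by (auto dest: dvd_imp_le)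
    then show ?thesis using prime_imp_coprime[OF p(1)] coprime_commute by blast
  qed
  note cancel = cong_mult_lcancel_nat[OF this]
  show ?thesis using 1 unfolding 2 cancel .
qed

text \<open>Pulling every second factor \<open>y\<close> of \<open>x\<^sub>1 y\<^sub>1 \<dots> x\<^sub>p y\<^sub>p\<close> to the right.\<close>
fun shuffle_pairs :: "('a \<times> 'a) list \<Rightarrow> ('a \<times> 'a) list" where
  "shuffle_pairs [] = []"
| "shuffle_pairs ((x, y) # l) = (x, conj_by (lprod G (map fst l)) y) # shuffle_pairs l"

lemma map_fst_shuffle_pairs [simp]: "map fst (shuffle_pairs l) = map fst l"
  by (induction l rule: shuffle_pairs.induct) auto

lemma length_shuffle_pairs [simp]: "length (shuffle_pairs l) = length l"
  by (induction l rule: shuffle_pairs.induct) auto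

lemma set_shuffle_pairs:
  assumes "conj_invariant G C" "conj_invariant G D" "set l \<subseteq> C \<times> D"
  shows "set (shuffle_pairs l) \<subseteq> C \<times> D"
  using assms(3)
proof (induction l rule: shuffle_pairs.induct)
  case (2 x y l)
  have "set (map fst l) \<subseteq> carrier G" using 2 conj_invariantD(1)[OF assms(1)] by auto
  then show ?case using 2 conj_invariantD(2)[OF assms(2)] by auto
qed auto

text \<open>The conjugator of y is the product P of the first entries behind it. If Q is the product
  of the second entries behind it, then x (P y P^-1) (P Q) = (x P) (y Q).\<close>

lemma lprod_shuffle_pairs:
  assumes "set l \<subseteq> carrier G \<times> carrier G"
  shows "lprod G (map (\<lambda>(x, y). x \<otimes> y) (shuffle_pairs l)) = lprod G (map fst l) \<otimes> lprod G (map snd l)"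
  using assms
proof (induction l rule: shuffle_pairs.induct)
  case (2 x y l)
  define P where "P = lprod G (map fst l)"
  define Q where "Q = lprod G (map snd l)"
  have "set (map fst l) \<subseteq> carrier G" "set (map snd l) \<subseteq> carrier G" using 2 by auto
  then have PQ: "P \<in> carrier G" "Q \<in> carrier G" unfolding P_def Q_def by (simp_all del: set_map)
  have xy: "x \<in> carrier G" "y \<in> carrier G" using 2 by auto
  have "P \<otimes> y \<otimes> inv P \<otimes> (P \<otimes> Q) = P \<otimes> (y \<otimes> Q)"
    using PQ xy by (metis inv_closed inv_solve_right' m_assoc m_closed)
  then have "x \<otimes> conj_by P y \<otimes> (P \<otimes> Q) = x \<otimes> P \<otimes> (y \<otimes> Q)"
    using PQ xy by (simp add: conj_by_def m_assoc)
  then show ?case using 2 by (simp add: P_def Q_def)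
qed auto

text \<open>First entries are untouched and the conjugators depend on them alone, so the shuffle can
  be undone.\<close>

lemma inj_on_shuffle_pairs: "inj_on shuffle_pairs (lists (carrier G \<times> carrier G))"
proof (rule inj_onI)
  fix l m assume "l \<in> lists (carrier G \<times> carrier G)" "m \<in> lists (carrier G \<times> carrier G)"
    "shuffle_pairs l = shuffle_pairs m"
  then show "l = m"
  proof (induction l arbitrary: m rule: shuffle_pairs.induct)
    case 1
    then show ?case by (metis length_0_conv length_shuffle_pairs)
  next
    case (2 x y l)
    obtain x' y' k where m: "m = (x', y') # k"
      using 2 by (cases m rule: shuffle_pairs.cases) auto
    then have "l = k" using 2 by auto
    moreover have "set (map fst k) \<subseteq> carrier G" using 2 m by auto
    then have "lprod G (map fst k) \<in> carrier G" by (rule lprod_closed)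
    ultimately show ?case using 2 m conj_inj by auto
  qed
qed

lemma card_pair_lists:
  assumes fin: "finite C" "finite D" "finite E"
  shows "card {l. length l = n \<and> set l \<subseteq> C \<times> D \<and> (lprod G (map fst l), lprod G (map snd l)) \<in> E}
     = (\<Sum>(u, v)\<in>E. card (ntuples n C u) * card (ntuples n D v))"
proof -
  let ?L = "{l. set l \<subseteq> C \<times> D \<and> length l = n}" and ?p = "\<lambda>l. (lprod G (map fst l), lprod G (map snd l))"
  have "{l. length l = n \<and> set l \<subseteq> C \<times> D \<and> (lprod G (map fst l), lprod G (map snd l)) \<in> E} =
    {l \<in> ?L. ?p l \<in> E}" by auto
  also have "card \<dots> = (\<Sum>w\<in>E. card {l \<in> ?L. ?p l = w})"
    using fin by (intro card_preimage_eq_sum finite_lists_length_eq) auto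
  also have "\<dots> = (\<Sum>(u, v)\<in>E. card (ntuples n C u) * card (ntuples n D v))"
  proof (intro sum.cong refl, clarify)
    fix u v
    have b: "bij_betw (\<lambda>(xs, ys). zip xs ys) (ntuples n C u \<times> ntuples n D v)
      {l \<in> ?L. ?p l = (u, v)}"
    proof (rule bij_betw_byWitness[where f' = "\<lambda>l. (map fst l, map snd l)"])
      show "\<forall>a\<in>ntuples n C u \<times> ntuples n D v. (\<lambda>l. (map fst l, map snd l)) (case a of (xs, ys) \<Rightarrow> zip xs ys) = a"
        by (simp add: ntuples_def)
      show "\<forall>l\<in>{l \<in> ?L. ?p l = (u, v)}.
        (case (map fst l, map snd l) of (xs, ys) \<Rightarrow> zip xs ys) = l"
        by (simp add: zip_map_fst_snd)
      have "set (zip xs ys) \<subseteq> C \<times> D" if "set xs \<subseteq> C" "set ys \<subseteq> D" for xs ys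
      proof
        fix w assume "w \<in> set (zip xs ys)"
        moreover obtain x y where w: "w = (x, y)" by fastforce
        ultimately have "x \<in> set xs" "y \<in> set ys"
          using set_zip_leftD[of x y xs ys] set_zip_rightD[of x y xs ys] by blast+
        then show "w \<in> C \<times> D" using that w by blast
      qed
      then show "(\<lambda>(xs, ys). zip xs ys) ` (ntuples n C u \<times> ntuples n D v)
        \<subseteq> {l \<in> ?L. ?p l = (u, v)}"
        by (simp add: ntuples_def image_subset_iff)
      have "set (map fst l) \<subseteq> C" "set (map snd l) \<subseteq> D" if "set l \<subseteq> C \<times> D" for l
        using that by auto
      then show "(\<lambda>l. (map fst l, map snd l)) ` {l \<in> ?L. ?p l = (u, v)} \<subseteq> ntuples n C u \<times> ntuples n D v"
        by (simp add: ntuples_def image_subset_iff del: set_map)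
    qed
    show "card {l \<in> ?L. ?p l = (u, v)} =
      card (ntuples n C u) * card (ntuples n D v)"
      unfolding bij_betw_same_card[OF b, symmetric] card_cartesian_product ..
  qed
  finally show ?thesis .
qed

text \<open>Lists of p pairs with x_1 y_1 ... x_p y_p among the p-th powers of E are counted in two
  ways. Rotation leaves, modulo p, the pairs with (x y)^p among these powers, which by injectivity
  means x y in E. The shuffle separates the first from the second entries, and
  \<open>card_ntuples_cong\<close> replaces the number of factorizations of each product by the
  indicator of the p-th powers of C and of D. Both resulting counts are at most
  \<open>order G ^ 2\<close>, hence below p.\<close>

lemma card_product_in_prime_power:
  assumes fin: "finite (carrier G)" and p: "prime p" "p > order G ^ 2"
    and C: "conj_invariant G C" and D: "conj_invariant G D" and E: "conj_invariant G E"
  shows "card {(x, y) \<in> C \<times> D. x \<otimes> y \<in> E} =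
    card {(x, y) \<in> (\<lambda>x. x [^] p) ` C \<times> (\<lambda>x. x [^] p) ` D. x \<otimes> y \<in> (\<lambda>x. x [^] p) ` E}"
proof -
  let ?f = "\<lambda>x. x [^] p" and ?m = "\<lambda>(x, y). x \<otimes> y"
  have sub: "C \<subseteq> carrier G" "D \<subseteq> carrier G" "E \<subseteq> carrier G"
    using C D E by (auto simp: conj_invariant_def)
  then have finCD: "finite C" "finite D" using fin by (auto intro: finite_subset)
  have oG: "order G > 0" using fin by (simp add: order_gt_0_iff_finite)
  then have "order G \<le> order G ^ 2" by (simp add: power2_eq_square)
  then have po: "p > order G" using p(2) by simp
  then have "\<not> p dvd order G" using oG by (auto dest: dvd_imp_le)
  then have "coprime p (order G)" using p(1) by (simp add: prime_imp_coprime)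
  then have inj: "inj_on ?f (carrier G)" using pow_inj_on fin by blast
  have E': "conj_invariant G (?f ` E)" using conj_invariant_pow_image[OF E] .
  define L where "L = {l. length l = p \<and> set l \<subseteq> C \<times> D \<and> lprod G (map ?m l) \<in> ?f ` E}"
  define L' where "L' = {l. length l = p \<and> set l \<subseteq> C \<times> D \<and> lprod G (map fst l) \<otimes> lprod G (map snd l) \<in> ?f ` E}"
  define S where "S = {l. set l \<subseteq> C \<times> D \<and> length l = p}"
  \<comment> \<open>The admissible values of the two separated products; for a fixed value the two
    factorizations are independent.\<close>
  define U where "U = {(u, v) \<in> carrier G \<times> carrier G. u \<otimes> v \<in> ?f ` E}"
  have finS: "finite S" unfolding S_def using finCD by (intro finite_lists_length_eq) auto
  have 1: "[card L = card {z \<in> C \<times> D. ?m z [^] p \<in> ?f ` E}] (mod p)"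
    unfolding L_def using finCD sub by (intro card_lists_lprod_cong p E') auto
  have "?m z [^] p \<in> ?f ` E \<longleftrightarrow> ?m z \<in> E" if "z \<in> C \<times> D" for z
    by (rule inj_on_image_mem_iff[OF inj _ sub(3)]) (use that sub in auto)
  then have "{z \<in> C \<times> D. ?m z [^] p \<in> ?f ` E} = {z \<in> C \<times> D. ?m z \<in> E}" by blast
  also have "\<dots> = {(x, y) \<in> C \<times> D. x \<otimes> y \<in> E}" by auto
  finally have 2: "{z \<in> C \<times> D. ?m z [^] p \<in> ?f ` E} = {(x, y) \<in> C \<times> D. x \<otimes> y \<in> E}" .
  have Slists: "S \<subseteq> lists (carrier G \<times> carrier G)" using sub by (auto simp: S_def)
  then have injS: "inj_on shuffle_pairs S" using inj_on_shuffle_pairs inj_on_subset by blast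
  have "shuffle_pairs ` S \<subseteq> S" using set_shuffle_pairs[OF C D] unfolding S_def by (simp add: image_subset_iff)
  then have surj: "shuffle_pairs ` S = S" using finS injS by (simp add: endo_inj_surj)
  have "shuffle_pairs ` L' = L"
  proof -
    have "lprod G (map ?m (shuffle_pairs l)) = lprod G (map fst l) \<otimes> lprod G (map snd l)" if "l \<in> S" for l
      using that Slists by (intro lprod_shuffle_pairs) auto
    then have eq: "l \<in> L' \<longleftrightarrow> shuffle_pairs l \<in> L" if "l \<in> S" for l
      using that surj by (auto simp: L_def L'_def S_def)
    have LS: "L \<subseteq> S" "L' \<subseteq> S" by (auto simp: L_def L'_def S_def)
    show ?thesis
    proof (intro equalityI subsetI)
      fix l assume "l \<in> L"
      then obtain m where "m \<in> S" "l = shuffle_pairs m" using surj LS by (metis imageE subsetD)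
      then show "l \<in> shuffle_pairs ` L'" using eq \<open>l \<in> L\<close> by simp
    next
      fix l assume "l \<in> shuffle_pairs ` L'"
      then show "l \<in> L" using eq LS by (metis imageE subsetD)
    qed
  qed
  moreover have "inj_on shuffle_pairs L'" using injS by (rule inj_on_subset) (auto simp: L'_def S_def)
  ultimately have 3: "card L = card L'" by (metis card_image)
  have finU: "finite U" using fin by (auto simp: U_def intro: finite_subset[of _ "carrier G \<times> carrier G"])
  have "L' = {l. length l = p \<and> set l \<subseteq> C \<times> D \<and> (lprod G (map fst l), lprod G (map snd l)) \<in> U}"
  proof -
    have "lprod G (map fst l) \<in> carrier G \<and> lprod G (map snd l) \<in> carrier G" if "set l \<subseteq> C \<times> D" for l
    proof -
      have "set (map fst l) \<subseteq> carrier G" "set (map snd l) \<subseteq> carrier G" using that sub by auto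
      then show ?thesis using lprod_closed by blast
    qed
    then show ?thesis by (auto simp: L'_def U_def)
  qed
  then have 4: "card L' = (\<Sum>(u, v)\<in>U. card (ntuples p C u) * card (ntuples p D v))"
    using card_pair_lists[OF finCD finU, of p] by simp
  have "[(\<Sum>(u, v)\<in>U. card (ntuples p C u) * card (ntuples p D v)) =
     (\<Sum>(u, v)\<in>U. (if u \<in> ?f ` C then 1 else 0) * (if v \<in> ?f ` D then 1 else 0))] (mod p)"
  proof (rule cong_sum)
    fix z assume "z \<in> U"
    then obtain u v where z: "z = (u, v)" "u \<in> carrier G" "v \<in> carrier G" by (auto simp: U_def)
    show "[(case z of (u, v) \<Rightarrow> card (ntuples p C u) * card (ntuples p D v)) =
      (case z of (u, v) \<Rightarrow> (if u \<in> ?f ` C then 1 else 0) * (if v \<in> ?f ` D then 1 else 0))] (mod p)"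
      unfolding z prod.case
      by (intro cong_mult card_ntuples_cong fin C D p(1) po z)
  qed
  also have "(\<Sum>(u, v)\<in>U. (if u \<in> ?f ` C then 1 else 0) * (if v \<in> ?f ` D then 1 else (0::nat))) =
     (\<Sum>w\<in>U. if w \<in> ?f ` C \<times> ?f ` D then 1 else 0)"
    by (intro sum.cong refl) (auto split: if_splits)
  also have "\<dots> = card (U \<inter> (?f ` C \<times> ?f ` D))" using finU by (simp add: sum.If_cases)
  also have "U \<inter> (?f ` C \<times> ?f ` D) = {(x, y) \<in> ?f ` C \<times> ?f ` D. x \<otimes> y \<in> ?f ` E}"
    using sub by (auto simp: U_def)
  finally have "[card L' = card {(x, y) \<in> ?f ` C \<times> ?f ` D. x \<otimes> y \<in> ?f ` E}] (mod p)"
    unfolding 4 .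
  from cong_trans[OF cong_sym[OF 1[unfolded 3]] this]
  have cong: "[card {(x, y) \<in> C \<times> D. x \<otimes> y \<in> E} =
      card {(x, y) \<in> ?f ` C \<times> ?f ` D. x \<otimes> y \<in> ?f ` E}] (mod p)"
    unfolding 2 .
  have lt: "card T < p" if "T \<subseteq> carrier G \<times> carrier G" for T
  proof -
    have "card T \<le> card (carrier G \<times> carrier G)" using that fin by (intro card_mono) auto
    then show ?thesis using p(2) by (simp add: card_cartesian_product Coset.order_def power2_eq_square)
  qed
  show ?thesis
    using cong by (rule cong_less_modulus_unique_nat) (rule lt; use sub in auto)+
qed

text \<open>The p-th powers of a conjugation-invariant set form such a set again, so the prime
  factors of n can be stripped off one after the other, with C, D and E replaced by their
  powers.\<close>

lemma card_product_in_power: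
  assumes fin: "finite (carrier G)" and n: "n > 0" "\<And>q. prime q \<Longrightarrow> q dvd n \<Longrightarrow> q > order G ^ 2"
    and CDE: "conj_invariant G C" "conj_invariant G D" "conj_invariant G E"
  shows "card {(x, y) \<in> C \<times> D. x \<otimes> y \<in> E} =
    card {(x, y) \<in> (\<lambda>x. x [^] n) ` C \<times> (\<lambda>x. x [^] n) ` D. x \<otimes> y \<in> (\<lambda>x. x [^] n) ` E}"
  using n CDE
proof (induction n arbitrary: C D E rule: prime_divisors_induct)
  case (unit x)
  then have "x = 1" by simp
  moreover have "(\<lambda>x. x [^] (1::nat)) ` A = A" if "conj_invariant G A" for A
    using that by (force simp: conj_invariant_def)
  ultimately show ?case using unit by simp
next
  case (factor p x)
  have im: "(\<lambda>z. z [^] (p * x)) ` A = (\<lambda>z. z [^] x) ` (\<lambda>z. z [^] p) ` A" if "conj_invariant G A" for A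
    using that unfolding image_image conj_invariant_def by (intro image_cong) (auto simp: nat_pow_pow)
  have x: "x > 0" "\<And>q. prime q \<Longrightarrow> q dvd x \<Longrightarrow> q > order G ^ 2" using factor.prems(1,2) by auto
  have p: "prime p" "p > order G ^ 2" using factor.hyps factor.prems by auto
  note inv = factor.prems(3-5)[THEN conj_invariant_pow_image, of p]
  show ?case
    unfolding im[OF factor.prems(3)] im[OF factor.prems(4)] im[OF factor.prems(5)]
    by (rule trans[OF card_product_in_prime_power[OF fin p factor.prems(3-5)] factor.IH[OF x inv]])
qed auto

text \<open>Conjugation carries the factorizations of one member of the class to those of any
  other.\<close>

lemma card_conj_class_factor:
  assumes fin: "finite (carrier G)" and C: "conj_invariant G C" and D: "conj_invariant G D" and z: "z \<in> carrier G"
  shows "card {(x, y) \<in> C \<times> D. x \<otimes> y \<in> conj_class z} =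
     card (conj_class z) * card {(x, y) \<in> C \<times> D. x \<otimes> y = z}"
proof -
  have sub: "C \<subseteq> carrier G" "D \<subseteq> carrier G" using C D by (auto simp: conj_invariant_def)
  then have finCD: "finite (C \<times> D)" using fin finite_subset by (metis finite_cartesian_product)
  have fcl: "finite (conj_class z)" using fin by (simp add: conj_class_def)
  have le: "card {w \<in> C \<times> D. (\<lambda>(x, y). x \<otimes> y) w = v} \<le> card {w \<in> C \<times> D. (\<lambda>(x, y). x \<otimes> y) w = conj_by g v}"
    if g: "g \<in> carrier G" "v \<in> carrier G" for g v
  proof (rule card_inj_on_le[of "\<lambda>(x, y). (conj_by g x, conj_by g y)"])
    show "inj_on (\<lambda>(x, y). (conj_by g x, conj_by g y)) {w \<in> C \<times> D. (\<lambda>(x, y). x \<otimes> y) w = v}"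
      using sub g by (auto simp: inj_on_def intro: conj_inj)
    show "(\<lambda>(x, y). (conj_by g x, conj_by g y)) ` {w \<in> C \<times> D. (\<lambda>(x, y). x \<otimes> y) w = v}
      \<subseteq> {w \<in> C \<times> D. (\<lambda>(x, y). x \<otimes> y) w = conj_by g v}"
      using sub g conj_invariantD(2)[OF C] conj_invariantD(2)[OF D] by (auto simp: conj_mult subset_iff)
  qed (use finCD in auto)
  have eq: "card {w \<in> C \<times> D. (\<lambda>(x, y). x \<otimes> y) w = conj_by g z} = card {w \<in> C \<times> D. (\<lambda>(x, y). x \<otimes> y) w = z}"
    if g: "g \<in> carrier G" for g
    using le[OF g z] le[of "inv g" "conj_by g z"] g z by (simp add: conj_inv_conj)
  have "{(x, y) \<in> C \<times> D. x \<otimes> y \<in> conj_class z} = {w \<in> C \<times> D. (\<lambda>(x, y). x \<otimes> y) w \<in> conj_class z}" by auto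
  also have "card \<dots> = (\<Sum>v\<in>conj_class z. card {w \<in> C \<times> D. (\<lambda>(x, y). x \<otimes> y) w = v})"
    by (rule card_preimage_eq_sum[OF finCD fcl])
  also have "\<dots> = (\<Sum>v\<in>conj_class z. card {w \<in> C \<times> D. (\<lambda>(x, y). x \<otimes> y) w = z})"
    by (intro sum.cong refl) (auto simp: conj_class_def eq)
  also have "{w \<in> C \<times> D. (\<lambda>(x, y). x \<otimes> y) w = z} = {(x, y) \<in> C \<times> D. x \<otimes> y = z}" by auto
  finally show ?thesis by simp
qed

lemma coprime_order_if_large_primes:
  assumes "finite (carrier G)" "n > 0" "\<And>q. prime q \<Longrightarrow> q dvd n \<Longrightarrow> q > order G ^ 2"
  shows "coprime n (order G)"
proof (rule ccontr)
  assume "\<not> coprime n (order G)"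
  then have "gcd n (order G) \<noteq> 1" by (simp add: coprime_iff_gcd_eq_1)
  then obtain q where q: "prime q" "q dvd n" "q dvd order G" using prime_factor_nat by (metis gcd_greatest_iff)
  have "order G > 0" using assms(1) by (simp add: order_gt_0_iff_finite)
  then have "q \<le> order G" using q by (simp add: dvd_imp_le)
  also have "\<dots> \<le> order G ^ 2" by (simp add: power2_eq_square)
  finally show False using assms(3)[OF q(1,2)] by simp
qed

text \<open>With the class of z as E, whose n-th powers form the class of z^n of the same size, this
  size cancels on both sides; the powers of C and D are then pulled back along the injective power
  map.\<close>

lemma card_product_eq_power:
  assumes fin: "finite (carrier G)" and n: "n > 0" "\<And>q. prime q \<Longrightarrow> q dvd n \<Longrightarrow> q > order G ^ 2"
    and C: "conj_invariant G C" and D: "conj_invariant G D" and z: "z \<in> carrier G"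
  shows "card {(x, y) \<in> C \<times> D. x \<otimes> y = z} = card {(x, y) \<in> C \<times> D. x [^] n \<otimes> y [^] n = z [^] n}"
proof -
  let ?f = "\<lambda>x. x [^] n"
  have sub: "C \<subseteq> carrier G" "D \<subseteq> carrier G" using C D by (auto simp: conj_invariant_def)
  have inj: "inj_on ?f (carrier G)"
    using pow_inj_on[OF fin coprime_order_if_large_primes[OF fin n]] .
  note cl = conj_class[OF z]
  have clG: "conj_class z \<subseteq> carrier G" using cl by (simp add: conj_invariant_def)
  have fcl: "finite (conj_class z)" using fin by (simp add: conj_class_def)
  have cn: "?f ` conj_class z = conj_class (?f z)"
    unfolding conj_class_def image_image using z by (intro image_cong) (auto simp: conj_pow)
  have "card (conj_class z) * card {(x, y) \<in> C \<times> D. x \<otimes> y = z} = card {(x, y) \<in> C \<times> D. x \<otimes> y \<in> conj_class z}"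
    using card_conj_class_factor[OF fin C D z] by simp
  also have "\<dots> = card {(x, y) \<in> ?f ` C \<times> ?f ` D. x \<otimes> y \<in> conj_class (?f z)}"
    using card_product_in_power[OF fin n C D cl(1)] unfolding cn .
  also have "\<dots> = card (conj_class (?f z)) * card {(x, y) \<in> ?f ` C \<times> ?f ` D. x \<otimes> y = ?f z}"
    using card_conj_class_factor[OF fin conj_invariant_pow_image[OF C] conj_invariant_pow_image[OF D], of "?f z"] z by simp
  also have "card (conj_class (?f z)) = card (conj_class z)"
    unfolding cn[symmetric] using inj clG by (intro card_image) (auto intro: inj_on_subset)
  finally have "card {(x, y) \<in> C \<times> D. x \<otimes> y = z} = card {(x, y) \<in> ?f ` C \<times> ?f ` D. x \<otimes> y = ?f z}"
    using fcl cl(2) by (auto simp: card_gt_0_iff)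
  also have "{(x, y) \<in> ?f ` C \<times> ?f ` D. x \<otimes> y = ?f z} = (\<lambda>(x, y). (?f x, ?f y)) ` {(x, y) \<in> C \<times> D. ?f x \<otimes> ?f y = ?f z}"
    by force
  also have "card \<dots> = card {(x, y) \<in> C \<times> D. ?f x \<otimes> ?f y = ?f z}"
    using inj sub by (intro card_image) (auto simp: inj_on_def subset_iff)
  finally show ?thesis .
qed

text \<open>Elementary form of the Galois invariance of class algebra structure constants.\<close>
lemma subgroup_card_product_eq_power:
  assumes fin: "finite (carrier G)" and n: "n > 0" "\<And>q. prime q \<Longrightarrow> q dvd n \<Longrightarrow> q > order G ^ 2"
    and H: "subgroup H G" and C: "C \<subseteq> H" "\<And>h x. h \<in> H \<Longrightarrow> x \<in> C \<Longrightarrow> conj_by h x \<in> C"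
    and D: "D \<subseteq> H" "\<And>h x. h \<in> H \<Longrightarrow> x \<in> D \<Longrightarrow> conj_by h x \<in> D" and z: "z \<in> H"
  shows "card {(x, y) \<in> C \<times> D. x \<otimes> y = z} = card {(x, y) \<in> C \<times> D. x [^] n \<otimes> y [^] n = z [^] n}"
proof -
  interpret H: group "G\<lparr>carrier := H\<rparr>" using subgroup_imp_group[OF H] .
  have HG: "H \<subseteq> carrier G" using H by (simp add: subgroup.subset)
  have "order (G\<lparr>carrier := H\<rparr>) \<le> order G" using HG fin by (simp add: Coset.order_def card_mono)
  then have sq: "(order (G\<lparr>carrier := H\<rparr>))\<^sup>2 \<le> (order G)\<^sup>2" by (intro power_mono) auto
  have n': "q > (order (G\<lparr>carrier := H\<rparr>))\<^sup>2" if "prime q" "q dvd n" for q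
    by (rule le_less_trans[OF sq n(2)[OF that]])
  have "conj_invariant (G\<lparr>carrier := H\<rparr>) C" "conj_invariant (G\<lparr>carrier := H\<rparr>) D"
    using C D H by (auto simp: conj_invariant_def conj_by_def m_inv_consistent)
  moreover have "finite (carrier (G\<lparr>carrier := H\<rparr>))" using HG fin finite_subset by auto
  ultimately show ?thesis
    using H.card_product_eq_power[OF _ n(1) n', of C D z] z by (simp flip: nat_pow_consistent)
qed

end

subsection \<open>Matching power products by conjugation\<close>

context group
begin

definition act :: "'a \<Rightarrow> 'a \<times> 'a \<Rightarrow> 'a \<times> 'a" where
  "act g t = (conj_by g (fst t), conj_by g (snd t))"

text \<open>For a subset K of the group, the pairs fixed by K under \<open>act\<close> are those
  with both entries in \<open>centr K\<close>. This is how fixed point counts become counts in a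
  subgroup.\<close>

definition centr :: "'a set \<Rightarrow> 'a set" where
  "centr K = {h \<in> carrier G. \<forall>k\<in>K. h \<otimes> k = k \<otimes> h}"

text \<open>Conjugacy is taken inside \<open>centr K\<close> and not in G, so that the conjugating
  elements commute with K.\<close>

definition cls :: "'a set \<Rightarrow> 'a \<Rightarrow> 'a set" where
  "cls K x = (\<lambda>h. conj_by h x) ` centr K"

definition stab :: "'a \<times> 'a \<Rightarrow> 'a set" where
  "stab t = {g \<in> carrier G. g \<otimes> fst t = fst t \<otimes> g \<and> g \<otimes> snd t = snd t \<otimes> g}"

definition orbit :: "'a \<times> 'a \<Rightarrow> ('a \<times> 'a) set" where
  "orbit t = (\<lambda>g. act g t) ` carrier G"

lemma act_act [simp]:
  "\<lbrakk>g \<in> carrier G; h \<in> carrier G; t \<in> carrier G \<times> carrier G\<rbrakk> \<Longrightarrow> act g (act h t) = act (g \<otimes> h) t"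
  by (auto simp: act_def)

lemma act_closed [simp]: "\<lbrakk>g \<in> carrier G; t \<in> carrier G \<times> carrier G\<rbrakk> \<Longrightarrow> act g t \<in> carrier G \<times> carrier G"
  by (auto simp: act_def)

lemma act_one [simp]: "t \<in> carrier G \<times> carrier G \<Longrightarrow> act \<one> t = t"
  by (auto simp: act_def)

lemma conj_by_fixed_iff:
  assumes "g \<in> carrier G" "x \<in> carrier G"
  shows "conj_by g x = x \<longleftrightarrow> g \<otimes> x = x \<otimes> g"
  using assms unfolding conj_by_def by (metis inv_solve_right m_closed)

lemma act_fixed_iff:
  "\<lbrakk>g \<in> carrier G; t \<in> carrier G \<times> carrier G\<rbrakk> \<Longrightarrow> act g t = t \<longleftrightarrow> g \<in> stab t"
  by (cases t) (auto simp: act_def stab_def conj_by_fixed_iff)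

lemma act_eq_iff:
  assumes "g \<in> carrier G" "h \<in> carrier G" "t \<in> carrier G \<times> carrier G"
  shows "act g t = act h t \<longleftrightarrow> inv h \<otimes> g \<in> stab t"
proof
  assume "act g t = act h t"
  then have "act (inv h) (act g t) = act (inv h) (act h t)" by simp
  then have "act (inv h \<otimes> g) t = t" using assms by simp
  then show "inv h \<otimes> g \<in> stab t" using assms act_fixed_iff by simp
next
  assume "inv h \<otimes> g \<in> stab t"
  then have "act (inv h \<otimes> g) t = t" using assms act_fixed_iff by simp
  then have "act h (act (inv h \<otimes> g) t) = act h t" by simp
  then show "act g t = act h t" using assms by (simp add: m_assoc[symmetric])
qed

lemma centr_subgroup:
  assumes "K \<subseteq> carrier G"
  shows "subgroup (centr K) G"
proof (rule subgroupI)
  show "inv a \<in> centr K" if "a \<in> centr K" for a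
  proof -
    have "inv a \<otimes> k = k \<otimes> inv a" if k: "k \<in> K" for k
    proof -
      have "a \<in> carrier G" "k \<in> carrier G" "a \<otimes> k = k \<otimes> a" using \<open>a \<in> centr K\<close> k assms by (auto simp: centr_def)
      then show ?thesis by (metis inv_closed inv_solve_left inv_solve_right m_assoc m_closed)
    qed
    then show ?thesis using that by (auto simp: centr_def)
  qed
  show "a \<otimes> b \<in> centr K" if "a \<in> centr K" "b \<in> centr K" for a b
  proof -
    have "a \<otimes> b \<otimes> k = k \<otimes> (a \<otimes> b)" if "k \<in> K" for k
    proof -
      have "a \<in> carrier G" "b \<in> carrier G" "k \<in> carrier G" "a \<otimes> k = k \<otimes> a" "b \<otimes> k = k \<otimes> b"
        using \<open>a \<in> centr K\<close> \<open>b \<in> centr K\<close> that assms by (auto simp: centr_def)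
      then show ?thesis by (metis m_assoc)
    qed
    then show ?thesis using that by (auto simp: centr_def)
  qed
qed (use assms in \<open>auto simp: centr_def intro!: exI[of _ \<one>]\<close>)

lemma centr_mono: "K \<subseteq> L \<Longrightarrow> centr L \<subseteq> centr K"
  by (auto simp: centr_def)

lemma cls_subset:
  assumes "K \<subseteq> carrier G" "x \<in> centr K"
  shows "cls K x \<subseteq> centr K" "x \<in> cls K x"
proof -
  interpret H: subgroup "centr K" G using assms centr_subgroup by blast
  show "cls K x \<subseteq> centr K"
    unfolding cls_def conj_by_def using assms(2) by (intro image_subsetI H.m_closed H.m_inv_closed)
  have "x = conj_by \<one> x" using assms(2) by simp
  then show "x \<in> cls K x" unfolding cls_def using H.one_closed by (rule image_eqI)
qed

lemma cls_conj:
  assumes "K \<subseteq> carrier G" "x \<in> carrier G" "h \<in> centr K" "w \<in> cls K x"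
  shows "conj_by h w \<in> cls K x"
proof -
  interpret H: subgroup "centr K" G using assms centr_subgroup by blast
  obtain k where k: "k \<in> centr K" "w = conj_by k x" using assms by (auto simp: cls_def)
  then have "conj_by h w = conj_by (h \<otimes> k) x" using assms by simp
  then show ?thesis using k assms(3) by (auto simp: cls_def)
qed

lemma cls_conj_iff:
  assumes "K \<subseteq> carrier G" "x \<in> carrier G" "h \<in> centr K" "w \<in> carrier G"
  shows "conj_by h w \<in> cls K x \<longleftrightarrow> w \<in> cls K x"
proof -
  interpret H: subgroup "centr K" G using assms centr_subgroup by blast
  show ?thesis
    using cls_conj[OF assms(1-3)] cls_conj[OF assms(1,2), of "inv h" "conj_by h w"] assms(3,4)
    by (auto simp: conj_inv_conj)
qed

lemma orbit_act:
  assumes "t \<in> carrier G \<times> carrier G" "g \<in> carrier G" "s \<in> carrier G \<times> carrier G"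
  shows "act g s \<in> orbit t \<longleftrightarrow> s \<in> orbit t"
proof
  assume "act g s \<in> orbit t"
  then obtain h where h: "h \<in> carrier G" "act g s = act h t" by (auto simp: orbit_def)
  have "s = act (inv g) (act g s)" using assms by simp
  also have "\<dots> = act (inv g \<otimes> h) t" unfolding h(2) using assms h(1) by simp
  finally show "s \<in> orbit t" using assms h by (auto simp: orbit_def)
next
  assume "s \<in> orbit t"
  then show "act g s \<in> orbit t" using assms by (auto simp: orbit_def)
qed

text \<open>If \<open>act g t\<close> and \<open>act h t\<close> agree, then g and h differ by a
  member of the stabilizer, with which a and b commute. So the conjugates of a and b by g depend
  only on the point \<open>act g t\<close> of the orbit.\<close>

lemma orbit_matching:
  assumes t: "t \<in> carrier G \<times> carrier G" and K: "stab t = K" "stab t' = K"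
    and ab: "a \<in> centr K" "b \<in> centr K" and t': "t' = (conj_by a (fst t), conj_by b (snd t))"
  obtains a1 b1 where
    "\<And>g. g \<in> carrier G \<Longrightarrow> a1 (act g t) = conj_by g a"
    "\<And>g. g \<in> carrier G \<Longrightarrow> b1 (act g t) = conj_by g b"
proof -
  have f: "\<exists>f. \<forall>g\<in>carrier G. f (act g t) = conj_by g c" if c: "c \<in> centr K" for c
  proof -
    have cG: "c \<in> carrier G" using c by (simp add: centr_def)
    have "conj_by g c = conj_by h c" if gh: "g \<in> carrier G" "h \<in> carrier G" "act g t = act h t" for g h
    proof -
      have "inv h \<otimes> g \<in> K" using gh act_eq_iff t K(1) by blast
      then have "conj_by (inv h \<otimes> g) c = c"
        using c cG gh by (subst conj_by_fixed_iff) (auto simp: centr_def)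
      then have "conj_by h (conj_by (inv h \<otimes> g) c) = conj_by h c" by simp
      then show ?thesis using gh cG by (simp add: m_assoc[symmetric])
    qed
    then show ?thesis
      by (intro exI[of _ "\<lambda>s. conj_by (SOME g. g \<in> carrier G \<and> act g t = s) c"] ballI)
        (metis (mono_tags, lifting) someI_ex)
  qed
  show ?thesis using f[OF ab(1)] f[OF ab(2)] that by blast
qed

text \<open>For x and y in \<open>centr K\<close>, these are pairs fixed by K, sorted by label and
  by the classes of both entries; counting them refines the fixed point count of K.\<close>

definition cell :: "'a set \<Rightarrow> 'a \<Rightarrow> 'a \<Rightarrow> ('a \<times> 'a \<Rightarrow> 'a) \<Rightarrow> 'a \<Rightarrow> ('a \<times> 'a) set" where
  "cell K x y d z = {t \<in> cls K x \<times> cls K y. d t = z}"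

text \<open>Labelled version of the fact that two finite \<open>G\<close>-sets whose fixed point counts agree on
  all subgroups are isomorphic; the classes \<open>cls\<close> ensure that
  the conjugating elements \<open>a\<close>, \<open>b\<close> can be chosen in the centralizer of the stabilizer, hence equivariantly.\<close>
lemma labelled_matching:
  fixes d1 d2 :: "'a \<times> 'a \<Rightarrow> 'a"
  assumes fin: "finite (carrier G)"
    and T: "T1 \<subseteq> carrier G \<times> carrier G" "T2 \<subseteq> carrier G \<times> carrier G"
    and inv: "\<And>g t. g \<in> carrier G \<Longrightarrow> t \<in> T1 \<Longrightarrow> act g t \<in> T1" "\<And>g t. g \<in> carrier G \<Longrightarrow> t \<in> T2 \<Longrightarrow> act g t \<in> T2"
    and d: "\<And>g t. g \<in> carrier G \<Longrightarrow> t \<in> carrier G \<times> carrier G \<Longrightarrow> d1 (act g t) = conj_by g (d1 t)"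
      "\<And>g t. g \<in> carrier G \<Longrightarrow> t \<in> carrier G \<times> carrier G \<Longrightarrow> d2 (act g t) = conj_by g (d2 t)"
    and card: "\<And>K x y z. K \<subseteq> carrier G \<Longrightarrow> x \<in> centr K \<Longrightarrow> y \<in> centr K \<Longrightarrow>
      card (T1 \<inter> cell K x y d1 z) = card (T2 \<inter> cell K x y d2 z)"
  shows "\<exists>a b. (\<forall>t\<in>T1. a t \<in> carrier G \<and> b t \<in> carrier G) \<and>
    (\<forall>t\<in>T1. \<forall>g\<in>carrier G. a (act g t) = conj_by g (a t) \<and> b (act g t) = conj_by g (b t)) \<and>
    bij_betw (\<lambda>t. (conj_by (a t) (fst t), conj_by (b t) (snd t))) T1 T2 \<and>
    (\<forall>t\<in>T1. d2 (conj_by (a t) (fst t), conj_by (b t) (snd t)) = d1 t)"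
  using T inv card
\<comment> \<open>Each step matches one orbit of T1 with one orbit of T2 and removes both.\<close>
proof (induction "card T1" arbitrary: T1 T2 rule: less_induct)
  case less
  note T = less.prems(1,2) and inv = less.prems(3,4) and card = less.prems(5)
  have finT: "finite T1" "finite T2" using T fin by (auto intro: finite_subset)
  have in_cell: "(x, y) \<in> cell K x y d (d (x, y))" if "K \<subseteq> carrier G" "x \<in> centr K" "y \<in> centr K" for K x y and d :: "'a \<times> 'a \<Rightarrow> 'a"
    using cls_subset that by (auto simp: cell_def)
  have centrG: "centr {} = carrier G" by (auto simp: centr_def)
  have ex2: "\<exists>s. s \<in> T2 \<inter> cell K x y d2 z" if "s' \<in> T1 \<inter> cell K x y d1 z" "K \<subseteq> carrier G" "x \<in> centr K" "y \<in> centr K" for s' K x y z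
  proof -
    have "card (T1 \<inter> cell K x y d1 z) \<noteq> 0" using that finT by (auto simp: card_eq_0_iff)
    then have "T2 \<inter> cell K x y d2 z \<noteq> {}" using card that by (metis card.empty)
    then show ?thesis by blast
  qed
  have ex1: "\<exists>s. s \<in> T1 \<inter> cell K x y d1 z" if "s' \<in> T2 \<inter> cell K x y d2 z" "K \<subseteq> carrier G" "x \<in> centr K" "y \<in> centr K" for s' K x y z
  proof -
    have "card (T2 \<inter> cell K x y d2 z) \<noteq> 0" using that finT by (auto simp: card_eq_0_iff)
    then have "T1 \<inter> cell K x y d1 z \<noteq> {}" using card that by (metis card.empty)
    then show ?thesis by blast
  qed
  show ?case
  proof (cases "T1 = {}")
    case True
    \<comment> \<open>Cells for the empty K, whose centralizer is the whole group, see every pair,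
      so T2 cannot contain a pair if T1 has none.\<close>
    have "T2 = {}"
    proof (rule ccontr)
      assume "T2 \<noteq> {}"
      then obtain x y where xy: "(x, y) \<in> T2" by auto
      then have "x \<in> centr {}" "y \<in> centr {}" using T centrG by auto
      then show False using ex1[of "(x, y)" "{}" x y] in_cell[of "{}" x y d2] xy True by auto
    qed
    then show ?thesis using True by (intro exI[of _ "\<lambda>_. \<one>"]) (simp add: bij_betw_def)
  next
    case False
    \<comment> \<open>The sets that fix some pair of T1. One of largest cardinality is the full
      stabilizer of every pair of T1 it fixes; equality of the cell counts extends this to
      T2.\<close>
    define Ks where "Ks = {K. K \<subseteq> carrier G \<and> (\<exists>x y. (x, y) \<in> T1 \<and> x \<in> centr K \<and> y \<in> centr K)}"
    have "finite Ks" using fin by (auto simp: Ks_def)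
    moreover obtain u v where "(u, v) \<in> T1" using False by auto
    then have "{} \<in> Ks" using T centrG by (auto simp: Ks_def)
    ultimately have "Max (card ` Ks) \<in> card ` Ks" by (intro Max_in) auto
    then obtain K where KKs: "K \<in> Ks" and K: "card K = Max (card ` Ks)" by auto
    have Kmax: "card L \<le> card K" if "L \<in> Ks" for L
      unfolding K using that \<open>finite Ks\<close> by simp
    obtain x y where t1: "(x, y) \<in> T1" and xyK: "x \<in> centr K" "y \<in> centr K" and KG: "K \<subseteq> carrier G"
      using KKs by (auto simp: Ks_def)
    have xyG: "x \<in> carrier G" "y \<in> carrier G" using t1 T by auto
    have stabKs: "stab s \<subseteq> carrier G" "fst s \<in> centr (stab s)" "snd s \<in> centr (stab s)" 
      if "s \<in> carrier G \<times> carrier G" for s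
      using that by (auto simp: stab_def centr_def)
    have sub_stab: "K' \<subseteq> stab s" if "fst s \<in> centr K'" "snd s \<in> centr K'" "K' \<subseteq> carrier G" for K' s
      using that by (auto simp: stab_def centr_def)
    have finK: "finite L" if "L \<subseteq> carrier G" for L using that fin finite_subset by blast
    define t where "t = (x, y)"
    have tT: "t \<in> T1" and tG: "t \<in> carrier G \<times> carrier G" using t1 xyG by (auto simp: t_def)
    have "stab t \<in> Ks" using stabKs[OF tG] tT by (cases t) (auto simp: Ks_def)
    moreover have "K \<subseteq> stab t" using sub_stab[of t K] xyK KG by (simp add: t_def)
    ultimately have st: "stab t = K"
      using Kmax finK stabKs(1)[OF tG] by (metis card_seteq)
    \<comment> \<open>Equal counts put a pair of T2 with the right label into the cell of t; its
      entries arise from x and y by conjugation with members of \<open>centr K\<close>.\<close>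
    obtain t' where t': "t' \<in> T2" "t' \<in> cell K x y d2 (d1 t)"
      using ex2[of t K x y "d1 t"] in_cell[OF KG xyK, of d1] tT KG xyK by (auto simp: t_def)
    then obtain a0 b0 where ab: "a0 \<in> centr K" "b0 \<in> centr K" "t' = (conj_by a0 x, conj_by b0 y)" and dt: "d2 t' = d1 t"
      by (auto simp: cell_def cls_def)
    have t'G: "t' \<in> carrier G \<times> carrier G" using t' T by auto
    have "fst t' \<in> centr K" "snd t' \<in> centr K"
      using t'(2) cls_subset(1)[OF KG xyK(1)] cls_subset(1)[OF KG xyK(2)] by (auto simp: cell_def)
    then have "K \<subseteq> stab t'" using sub_stab KG by blast
    \<comment> \<open>The counts read backwards, for the set \<open>stab t'\<close>, yield a pair of
      T1 fixed by it, so maximality applies to t' as well.\<close>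
    moreover have "stab t' \<in> Ks"
    proof -
      obtain s where "s \<in> T1 \<inter> cell (stab t') (fst t') (snd t') d1 (d2 t')"
        using ex1[of t' "stab t'" "fst t'" "snd t'" "d2 t'"] in_cell[OF stabKs[OF t'G], of d2] t' stabKs[OF t'G] by auto
      then have "s \<in> T1" "fst s \<in> centr (stab t')" "snd s \<in> centr (stab t')"
        using cls_subset(1)[OF stabKs(1,2)[OF t'G]] cls_subset(1)[OF stabKs(1,3)[OF t'G]] by (auto simp: cell_def)
      then show ?thesis using stabKs[OF t'G] by (cases s) (auto simp: Ks_def)
    qed
    ultimately have st': "stab t' = K"
      using Kmax finK stabKs(1)[OF t'G] by (metis card_seteq)
    obtain a1 b1 where a1: "\<And>g. g \<in> carrier G \<Longrightarrow> a1 (act g t) = conj_by g a0"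
      and b1: "\<And>g. g \<in> carrier G \<Longrightarrow> b1 (act g t) = conj_by g b0"
      using orbit_matching[OF tG st st' ab(1,2)] ab(3) by (auto simp: t_def)
    have abG: "a0 \<in> carrier G" "b0 \<in> carrier G" using ab by (auto simp: centr_def)
    define F where "F s = (conj_by (a1 s) (fst s), conj_by (b1 s) (snd s))" for s
    have F: "F (act g t) = act g t'" if g: "g \<in> carrier G" for g
    proof -
      show ?thesis using a1[OF g] b1[OF g] abG xyG g by (simp add: F_def act_def t_def ab(3) conj_by_conj_by del: conj_conj)
    qed
    have bij: "bij_betw F (orbit t) (orbit t')"
    proof -
      have "inj_on F (orbit t)"
      proof (rule inj_onI)
        fix s s' assume "s \<in> orbit t" "s' \<in> orbit t" "F s = F s'"
        then obtain g h where gh: "g \<in> carrier G" "h \<in> carrier G" "s = act g t" "s' = act h t"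
          by (auto simp: orbit_def)
        then have "act g t' = act h t'" using F \<open>F s = F s'\<close> by simp
        then show "s = s'" using gh act_eq_iff[OF _ _ tG] act_eq_iff[OF _ _ t'G] st st' by simp
      qed
      moreover have "F ` orbit t = orbit t'" unfolding orbit_def image_image using F by (intro image_cong) auto
      ultimately show ?thesis by (simp add: bij_betw_def)
    qed
    have orb: "orbit t \<subseteq> T1" "orbit t' \<subseteq> T2" unfolding orbit_def by (intro image_subsetI inv tT t'(1); assumption)+
    have "t = act \<one> t" using tG by simp
    then have orbt: "t \<in> orbit t" unfolding orbit_def using one_closed by (rule image_eqI)
    \<comment> \<open>If s or F s lies in a cell for L, then L is contained in their common
      stabilizer, the conjugate of K by g. Then a1 s and b1 s centralize L, and conjugation by them
      preserves the classes relative to L. Hence the removal of both orbits keeps all cell counts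
      equal.\<close>
    have Fcell: "s \<in> cell L u v d1 z \<longleftrightarrow> F s \<in> cell L u v d2 z"
      if L: "L \<subseteq> carrier G" and uv: "u \<in> centr L" "v \<in> centr L" and s: "s \<in> orbit t" for L u v z s
    proof -
      obtain g where g: "g \<in> carrier G" "s = act g t" using s by (auto simp: orbit_def)
      have sG: "s \<in> carrier G \<times> carrier G" "F s \<in> carrier G \<times> carrier G" using g F tG t'G by auto
      have uvG: "u \<in> carrier G" "v \<in> carrier G" using uv by (auto simp: centr_def)
      have dd: "d2 (F s) = d1 s" using g F d(1)[OF g(1) tG] d(2)[OF g(1) t'G] dt by simp
      have stabs: "stab s = conj_by g ` K" "stab (F s) = conj_by g ` K"
      proof -
        have "stab (act g w) = conj_by g ` stab w" if w: "w \<in> carrier G \<times> carrier G" for w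
        proof -
          have "k \<in> stab (act g w) \<longleftrightarrow> conj_by (inv g) k \<in> stab w" if k: "k \<in> carrier G" for k
          proof -
            have "k \<in> stab (act g w) \<longleftrightarrow> act (k \<otimes> g) w = act g w"
              using act_fixed_iff[OF k, of "act g w"] g(1) w k by simp
            also have "\<dots> \<longleftrightarrow> inv g \<otimes> (k \<otimes> g) \<in> stab w" using act_eq_iff g(1) w k by simp
            also have "inv g \<otimes> (k \<otimes> g) = conj_by (inv g) k" using g(1) k by (simp add: conj_by_def m_assoc)
            finally show ?thesis .
          qed
          note 1 = this
          have "stab (act g w) \<subseteq> carrier G" "stab w \<subseteq> carrier G" by (auto simp: stab_def)
          show ?thesis
          proof (intro equalityI subsetI)
            fix k assume k: "k \<in> stab (act g w)"
            then have kG: "k \<in> carrier G" by (simp add: stab_def)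
            then have "k = conj_by g (conj_by (inv g) k)" using g by (simp add: conj_inv_conj)
            then show "k \<in> conj_by g ` stab w" using 1[OF kG] k by blast
          next
            fix k assume "k \<in> conj_by g ` stab w"
            then obtain l where l: "l \<in> stab w" "k = conj_by g l" by blast
            then have "l \<in> carrier G" by (simp add: stab_def)
            then show "k \<in> stab (act g w)" using 1[of k] l g by (simp add: conj_inv_conj)
          qed
        qed
        then show "stab s = conj_by g ` K" "stab (F s) = conj_by g ` K" using g F tG t'G st st' by auto
      qed
      have cent: "conj_by g c \<in> centr (conj_by g ` K)" if c: "c \<in> centr K" for c
      proof -
        have "conj_by g c \<otimes> conj_by g k = conj_by g k \<otimes> conj_by g c" if "k \<in> K" for k
        proof -
          have "c \<in> carrier G" "k \<in> carrier G" "c \<otimes> k = k \<otimes> c" using c that KG by (auto simp: centr_def)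
          then show ?thesis using g(1) conj_mult[of g c k] conj_mult[of g k c] by simp
        qed
        then show ?thesis using c g by (auto simp: centr_def)
      qed
      have iff: "fst s \<in> cls L u \<and> snd s \<in> cls L v \<longleftrightarrow> fst (F s) \<in> cls L u \<and> snd (F s) \<in> cls L v"
        if "L \<subseteq> conj_by g ` K"
      proof -
        have "a1 s \<in> centr L" "b1 s \<in> centr L"
          using a1[OF g(1)] b1[OF g(1)] g(2) cent ab(1,2) centr_mono[OF that] by auto
        then show ?thesis unfolding F_def fst_conv snd_conv using cls_conj_iff[OF L] uvG sG by (simp add: mem_Times_iff)
      qed
      have LK: "L \<subseteq> conj_by g ` K" if "fst w \<in> cls L u \<and> snd w \<in> cls L v" "w = s \<or> w = F s" for w
      proof -
        have "fst w \<in> centr L" "snd w \<in> centr L"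
          using subsetD[OF cls_subset(1)[OF L uv(1)]] subsetD[OF cls_subset(1)[OF L uv(2)]] that(1) by blast+
        then have "L \<subseteq> stab w" using sub_stab L by blast
        then show ?thesis using that(2) stabs by auto
      qed
      have "fst s \<in> cls L u \<and> snd s \<in> cls L v \<longleftrightarrow> fst (F s) \<in> cls L u \<and> snd (F s) \<in> cls L v"
        using iff LK[of s] LK[of "F s"] by blast
      then show ?thesis unfolding cell_def using dd by (simp add: mem_Times_iff) blast
    qed
    have card': "card ((T1 - orbit t) \<inter> cell L u v d1 z) = card ((T2 - orbit t') \<inter> cell L u v d2 z)"
      if L: "L \<subseteq> carrier G" "u \<in> centr L" "v \<in> centr L" for L u v z
    proof -
      have "F ` (orbit t \<inter> cell L u v d1 z) = orbit t' \<inter> cell L u v d2 z"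
      proof (intro equalityI subsetI)
        fix w assume "w \<in> F ` (orbit t \<inter> cell L u v d1 z)"
        then obtain s where "s \<in> orbit t" "s \<in> cell L u v d1 z" "w = F s" by blast
        then show "w \<in> orbit t' \<inter> cell L u v d2 z" using bij_betwE[OF bij] Fcell[OF L] by simp
      next
        fix w assume w: "w \<in> orbit t' \<inter> cell L u v d2 z"
        then obtain s where "s \<in> orbit t" "w = F s" using bij unfolding bij_betw_def by blast
        then show "w \<in> F ` (orbit t \<inter> cell L u v d1 z)" using Fcell[OF L] w by simp
      qed
      moreover have "inj_on F (orbit t \<inter> cell L u v d1 z)"
        using bij unfolding bij_betw_def by (auto intro: inj_on_subset)
      ultimately have "card (orbit t \<inter> cell L u v d1 z) = card (orbit t' \<inter> cell L u v d2 z)"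
        using card_image[of F "orbit t \<inter> cell L u v d1 z"] by simp
      moreover have "(T1 - orbit t) \<inter> cell L u v d1 z = T1 \<inter> cell L u v d1 z - orbit t \<inter> cell L u v d1 z"
         "(T2 - orbit t') \<inter> cell L u v d2 z = T2 \<inter> cell L u v d2 z - orbit t' \<inter> cell L u v d2 z" by auto
      moreover have "card (T1 \<inter> cell L u v d1 z - orbit t \<inter> cell L u v d1 z) = card (T1 \<inter> cell L u v d1 z) - card (orbit t \<inter> cell L u v d1 z)"
        "card (T2 \<inter> cell L u v d2 z - orbit t' \<inter> cell L u v d2 z) = card (T2 \<inter> cell L u v d2 z) - card (orbit t' \<inter> cell L u v d2 z)"
        using finT orb by (auto intro!: card_Diff_subset intro: finite_subset)
      ultimately show ?thesis using card[OF L] by simp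
    qed
    have inv': "act g s \<in> T1 - orbit t" if "g \<in> carrier G" "s \<in> T1 - orbit t" for g s
      using that inv(1) orbit_act[OF tG] T by auto
    have inv'': "act g s \<in> T2 - orbit t'" if "g \<in> carrier G" "s \<in> T2 - orbit t'" for g s
      using that inv(2) orbit_act[OF t'G] T by auto
    have "card (T1 - orbit t) < card T1" using finT orbt tT by (intro psubset_card_mono) auto
    moreover have "T1 - orbit t \<subseteq> carrier G \<times> carrier G" "T2 - orbit t' \<subseteq> carrier G \<times> carrier G"
      using T by auto
    ultimately have rest: "\<exists>a b. (\<forall>s\<in>T1 - orbit t. a s \<in> carrier G \<and> b s \<in> carrier G) \<and>
      (\<forall>s\<in>T1 - orbit t. \<forall>g\<in>carrier G. a (act g s) = conj_by g (a s) \<and> b (act g s) = conj_by g (b s)) \<and>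
      bij_betw (\<lambda>s. (conj_by (a s) (fst s), conj_by (b s) (snd s))) (T1 - orbit t) (T2 - orbit t') \<and>
      (\<forall>s\<in>T1 - orbit t. d2 (conj_by (a s) (fst s), conj_by (b s) (snd s)) = d1 s)"
      using inv' inv'' card' by (rule less.hyps)
    obtain a2 b2 where
      ab2: "\<forall>s\<in>T1 - orbit t. a2 s \<in> carrier G \<and> b2 s \<in> carrier G"
        "\<forall>s\<in>T1 - orbit t. \<forall>g\<in>carrier G. a2 (act g s) = conj_by g (a2 s) \<and> b2 (act g s) = conj_by g (b2 s)"
      and bij2: "bij_betw (\<lambda>s. (conj_by (a2 s) (fst s), conj_by (b2 s) (snd s))) (T1 - orbit t) (T2 - orbit t')"
      and dd2: "\<forall>s\<in>T1 - orbit t. d2 (conj_by (a2 s) (fst s), conj_by (b2 s) (snd s)) = d1 s"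
      using rest by (elim exE conjE) (rule that, assumption+)
    have ab1: "a1 s \<in> carrier G \<and> b1 s \<in> carrier G" if "s \<in> orbit t" for s
      using that a1 b1 abG by (auto simp: orbit_def)
    have ab1': "a1 (act g s) = conj_by g (a1 s) \<and> b1 (act g s) = conj_by g (b1 s)" if "s \<in> orbit t" "g \<in> carrier G" for s g
      using that a1 b1 abG tG by (auto simp: orbit_def)
    have dd1: "d2 (F s) = d1 s" if "s \<in> orbit t" for s
      using that F d(1)[OF _ tG] d(2)[OF _ t'G] dt by (auto simp: orbit_def)
    define a where "a s = (if s \<in> orbit t then a1 s else a2 s)" for s
    define b where "b s = (if s \<in> orbit t then b1 s else b2 s)" for s
    define P where "P s = (conj_by (a s) (fst s), conj_by (b s) (snd s))" for s
    have P1: "P s = F s" if "s \<in> orbit t" for s using that by (simp add: P_def F_def a_def b_def)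
    have P2: "P s = (conj_by (a2 s) (fst s), conj_by (b2 s) (snd s))" if "s \<in> T1 - orbit t" for s
      using that by (simp add: P_def a_def b_def)
    have "bij_betw P (orbit t) (orbit t')" by (rule iffD2[OF bij_betw_cong[OF P1] bij])
    moreover have "bij_betw P (T1 - orbit t) (T2 - orbit t')" by (rule iffD2[OF bij_betw_cong[OF P2] bij2])
    ultimately have "bij_betw P (orbit t \<union> (T1 - orbit t)) (orbit t' \<union> (T2 - orbit t'))"
      by (rule bij_betw_combine) auto
    then have "bij_betw P T1 T2" using orb by (simp add: Un_absorb1 Un_Diff_cancel)
    moreover have "\<forall>s\<in>T1. d2 (P s) = d1 s" 
    proof
      fix s assume "s \<in> T1"
      then show "d2 (P s) = d1 s" using dd1[of s] dd2 by (cases "s \<in> orbit t") (simp_all add: P1 P2)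
    qed
    moreover have "\<forall>s\<in>T1. a s \<in> carrier G \<and> b s \<in> carrier G" using ab1 ab2 by (simp add: a_def b_def)
    moreover have "\<forall>s\<in>T1. \<forall>g\<in>carrier G. a (act g s) = conj_by g (a s) \<and> b (act g s) = conj_by g (b s)"
    proof (intro ballI)
      fix s g assume s: "s \<in> T1" "g \<in> carrier G"
      then have "act g s \<in> orbit t \<longleftrightarrow> s \<in> orbit t" using orbit_act[OF tG] T by blast
      then show "a (act g s) = conj_by g (a s) \<and> b (act g s) = conj_by g (b s)"
        using ab1'[of s g] ab2(2) s by (simp add: a_def b_def)
    qed
    ultimately show ?thesis unfolding P_def by (intro exI[of _ a] exI[of _ b] conjI)
  qed
qed

text \<open>The n-th power map is injective and maps the finite subgroup into itself, so it is
  onto.\<close>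

lemma subgroup_root:
  assumes fin: "finite (carrier G)" and n: "coprime n (order G)" and H: "subgroup H G" and z: "z \<in> H"
  obtains z0 where "z0 \<in> H" "z = z0 [^] (n::nat)"
proof -
  have HG: "H \<subseteq> carrier G" using H by (rule subgroup.subset)
  have "(\<lambda>x. x [^] n) ` H = H"
  proof (rule endo_inj_surj)
    show "finite H" by (rule finite_subset[OF HG fin])
    show "inj_on (\<lambda>x. x [^] n) H" using pow_inj_on[OF fin n] HG by (rule inj_on_subset)
  qed (use subgroup_nat_pow_closed[OF H] in blast)
  then show ?thesis using z that by blast
qed

definition equivariant :: "('a \<times> 'a \<Rightarrow> 'a) \<Rightarrow> bool" where
  "equivariant a \<longleftrightarrow> (\<forall>t\<in>carrier G \<times> carrier G. a t \<in> carrier G \<and>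
     (\<forall>g\<in>carrier G. a (act g t) = conj_by g (a t)))"

lemma equivariantD:
  assumes "equivariant a" "t \<in> carrier G \<times> carrier G"
  shows "a t \<in> carrier G" "g \<in> carrier G \<Longrightarrow> a (act g t) = conj_by g (a t)"
  using assms unfolding equivariant_def by blast+

text \<open>The labels are x^n y^n and (x y)^n. For z in \<open>centr K\<close>, written as z0^n
  with z0 in \<open>centr K\<close>, the cell counts agree by
  \<open>subgroup_card_product_eq_power\<close>; for any other z both cells are empty.\<close>

lemma power_mult_matching:
  assumes fin: "finite (carrier G)" and n: "n > 0" "\<And>q. prime q \<Longrightarrow> q dvd n \<Longrightarrow> q > order G ^ 2"
  obtains a b :: "'a \<times> 'a \<Rightarrow> 'a" where "equivariant a" "equivariant b"
    "bij_betw (\<lambda>t. (conj_by (a t) (fst t), conj_by (b t) (snd t))) (carrier G \<times> carrier G) (carrier G \<times> carrier G)"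
    "\<forall>t\<in>carrier G \<times> carrier G.
      (conj_by (a t) (fst t) \<otimes> conj_by (b t) (snd t)) [^] n = fst t [^] n \<otimes> snd t [^] n"
proof -
  define d1 where "d1 t = fst t [^] n \<otimes> snd t [^] n" for t
  define d2 where "d2 t = (fst t \<otimes> snd t) [^] n" for t
  have inj: "inj_on (\<lambda>x. x [^] n) (carrier G)"
    using pow_inj_on[OF fin coprime_order_if_large_primes[OF fin n]] .
  have d1: "d1 (act g t) = conj_by g (d1 t)" if "g \<in> carrier G" "t \<in> carrier G \<times> carrier G" for g t
    using that by (auto simp: d1_def act_def conj_pow conj_mult)
  have d2: "d2 (act g t) = conj_by g (d2 t)" if "g \<in> carrier G" "t \<in> carrier G \<times> carrier G" for g t
    using that by (auto simp: d2_def act_def conj_pow conj_mult)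
  have count: "card ((carrier G \<times> carrier G) \<inter> cell K x y d1 z) = card ((carrier G \<times> carrier G) \<inter> cell K x y d2 z)"
    if K: "K \<subseteq> carrier G" and x: "x \<in> centr K" and y: "y \<in> centr K" for K x y z
  proof -
    have H: "subgroup (centr K) G" using centr_subgroup[OF K] .
    have HG: "centr K \<subseteq> carrier G" using H by (rule subgroup.subset)
    note C = cls_subset(1)[OF K x] and D = cls_subset(1)[OF K y]
    have xG: "x \<in> carrier G" "y \<in> carrier G" using x y HG by auto
    have e: "(carrier G \<times> carrier G) \<inter> cell K x y d z = {(u, v) \<in> cls K x \<times> cls K y. d (u, v) = z}" for d
      using C D HG by (auto simp: cell_def)
    have uv: "u \<otimes> v \<in> centr K" if "u \<in> cls K x" "v \<in> cls K y" for u v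
      using subgroup.m_closed[OF H] C D that by blast
    show ?thesis
    proof (cases "z \<in> centr K")
      case True
      then obtain z0 where z0: "z0 \<in> centr K" "z = z0 [^] n"
        using subgroup_root[OF fin coprime_order_if_large_primes[OF fin n] H] by blast
      have "card {(u, v) \<in> cls K x \<times> cls K y. u \<otimes> v = z0} =
        card {(u, v) \<in> cls K x \<times> cls K y. u [^] n \<otimes> v [^] n = z0 [^] n}"
        using subgroup_card_product_eq_power[OF fin n H C _ D _ z0(1)] cls_conj[OF K] xG by blast
      moreover have "d2 (u, v) = z \<longleftrightarrow> u \<otimes> v = z0" if "u \<in> cls K x" "v \<in> cls K y" for u v
        using inj_on_eq_iff[OF inj, of "u \<otimes> v" z0] uv[OF that] HG z0 by (auto simp: d2_def)
      then have "{(u, v) \<in> cls K x \<times> cls K y. d2 (u, v) = z} = {(u, v) \<in> cls K x \<times> cls K y. u \<otimes> v = z0}"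
        by blast
      ultimately show ?thesis unfolding e by (simp add: d1_def z0(2))
    next
      case False
      have "d2 (u, v) \<in> centr K" "d1 (u, v) \<in> centr K" if "u \<in> cls K x" "v \<in> cls K y" for u v
        using subgroup_nat_pow_closed[OF H] subgroup.m_closed[OF H] subsetD[OF C that(1)] subsetD[OF D that(2)]
        by (simp_all add: d1_def d2_def)
      then have "{(u, v) \<in> cls K x \<times> cls K y. d1 (u, v) = z} = {}" "{(u, v) \<in> cls K x \<times> cls K y. d2 (u, v) = z} = {}"
        using False by auto
      then show ?thesis unfolding e by (simp only:)
    qed
  qed
  have "\<exists>a b. (\<forall>t\<in>carrier G \<times> carrier G. a t \<in> carrier G \<and> b t \<in> carrier G) \<and>
    (\<forall>t\<in>carrier G \<times> carrier G. \<forall>g\<in>carrier G. a (act g t) = conj_by g (a t) \<and> b (act g t) = conj_by g (b t)) \<and>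
    bij_betw (\<lambda>t. (conj_by (a t) (fst t), conj_by (b t) (snd t))) (carrier G \<times> carrier G) (carrier G \<times> carrier G) \<and>
    (\<forall>t\<in>carrier G \<times> carrier G. d2 (conj_by (a t) (fst t), conj_by (b t) (snd t)) = d1 t)"
    by (rule labelled_matching[OF fin _ _ _ _ d1 d2 count]) (simp_all only: subset_refl act_closed)
  then obtain a b where R: "\<forall>t\<in>carrier G \<times> carrier G. a t \<in> carrier G \<and> b t \<in> carrier G"
    "\<forall>t\<in>carrier G \<times> carrier G. \<forall>g\<in>carrier G. a (act g t) = conj_by g (a t) \<and> b (act g t) = conj_by g (b t)"
    "bij_betw (\<lambda>t. (conj_by (a t) (fst t), conj_by (b t) (snd t))) (carrier G \<times> carrier G) (carrier G \<times> carrier G)"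
    "\<forall>t\<in>carrier G \<times> carrier G. d2 (conj_by (a t) (fst t), conj_by (b t) (snd t)) = d1 t"
    by (elim exE conjE) (rule that, assumption+)
  have "equivariant a" "equivariant b" unfolding equivariant_def using R(1,2) by blast+
  then show ?thesis using R(3,4) by (intro that[of a b]) (simp_all add: d1_def d2_def)
qed

end

subsection \<open>Characters of Yetter--Drinfeld modules and the S-matrix\<close>

text \<open>Take n congruent to r modulo e and to 1 modulo every small prime not dividing e. The
  primes dividing e are excluded because n is coprime to e.\<close>

lemma cong_with_large_prime_factors:
  fixes r :: int and e N :: nat
  assumes "e > 0" "coprime r (int e)"
  obtains n :: nat where "n > 0" "[r = int n] (mod int e)" "coprime n e"
    "\<And>q. prime q \<Longrightarrow> q dvd n \<Longrightarrow> q > N"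
proof -
  define Q where "Q = \<Prod>{q. prime q \<and> q \<le> N \<and> \<not> q dvd e}"
  have fin: "finite {q::nat. prime q \<and> q \<le> N \<and> \<not> q dvd e}" by (rule finite_subset[of _ "{..N}"]) auto
  have Q: "coprime e Q" unfolding Q_def
    by (rule prod_coprime_right) (auto simp: prime_imp_coprime coprime_commute)
  have Q0: "Q > 0" unfolding Q_def using fin by (auto intro!: prod_pos prime_gt_0_nat)
  define r0 where "r0 = nat (r mod int e)"
  obtain x where x: "[x = r0] (mod e)" "[x = 1] (mod Q)"
    using binary_chinese_remainder_nat[OF Q] by blast
  \<comment> \<open>The summand \<open>e * Q\<close> makes n positive and changes neither
    residue.\<close>
  define n where "n = x + e * Q"
  have n: "[n = r0] (mod e)" "[n = 1] (mod Q)" using x by (auto simp: n_def cong_def)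
  have "int r0 = r mod int e" using assms(1) by (simp add: r0_def)
  moreover have "[int n = int r0] (mod int e)" using n(1) by (simp only: cong_int_iff)
  ultimately have rn: "[r = int n] (mod int e)" by (simp add: cong_def)
  then have "coprime (int n) (int e)" using assms(2) by (metis cong_imp_coprime)
  then have cop: "coprime n e" by simp
  have "q > N" if q: "prime q" "q dvd n" for q
  proof (rule ccontr)
    assume le: "\<not> q > N"
    show False
    proof (cases "q dvd e")
      case True
      then show False using cop q by (metis coprime_common_divisor_nat not_prime_1)
    next
      case False
      then have "q dvd Q" unfolding Q_def using le q fin by (intro dvd_prodI) auto
      then have "[n = 1] (mod q)" using n(2) by (metis cong_dvd_modulus_nat)
      then have "q dvd 1" using q(2) by (metis cong_dvd_iff)
      then show False using q by simp
    qed
  qed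
  moreover have "n > 0" using assms(1) Q0 by (simp add: n_def)
  ultimately show ?thesis using that rn cop by blast
qed

text \<open>The character of the Drinfeld double at \<open>\<delta>\<^sub>y g\<close>.\<close>
definition chi :: "'g yd \<Rightarrow> 'g \<Rightarrow> 'g \<Rightarrow> complex" where
  "chi X y g = (\<Sum>i | i < ydim X \<and> ydeg X i = y. yact X g $$ (i, i))"

text \<open>The graph of the automorphism that raises \<open>zeta e\<close> to the n-th power. As a
  relation it is visibly closed under sums and products; the choice made in \<open>gal_gamma\<close>
  is met only in \<open>gal_gamma_eq\<close>.\<close>

definition gal_pair :: "nat \<Rightarrow> nat \<Rightarrow> complex \<Rightarrow> complex \<Rightarrow> bool" where
  "gal_pair e n z w \<longleftrightarrow> (\<exists>p :: rat poly. z = poly (map_poly of_rat p) (zeta e) \<and>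
     w = poly (map_poly of_rat p) (zeta e ^ n))"

lemma gal_pair_of_rat: "gal_pair e n (of_rat c) (of_rat c)"
proof -
  have "map_poly of_rat [:c:] = ([:of_rat c:] :: complex poly)"
    by (rule poly_eqI) (simp add: coeff_map_poly coeff_pCons split: nat.split)
  then have "of_rat c = poly (map_poly of_rat [:c:]) z" for z :: complex by simp
  then show ?thesis unfolding gal_pair_def by blast
qed

lemma gal_pair_add:
  assumes "gal_pair e n z w" "gal_pair e n z' w'"
  shows "gal_pair e n (z + z') (w + w')"
proof -
  have hom: "map_poly of_rat (p + q) = (map_poly of_rat p + map_poly of_rat q :: complex poly)" for p q
    by (rule poly_eqI) (simp add: coeff_map_poly of_rat_add)
  obtain p q where "z = poly (map_poly of_rat p) (zeta e)" "w = poly (map_poly of_rat p) (zeta e ^ n)"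
    "z' = poly (map_poly of_rat q) (zeta e)" "w' = poly (map_poly of_rat q) (zeta e ^ n)"
    using assms by (auto simp: gal_pair_def)
  then show ?thesis unfolding gal_pair_def by (intro exI[of _ "p + q"]) (simp add: hom)
qed

lemma gal_pair_mult:
  assumes "gal_pair e n z w" "gal_pair e n z' w'"
  shows "gal_pair e n (z * z') (w * w')"
proof -
  have hom: "map_poly of_rat (p * q) = (map_poly of_rat p * map_poly of_rat q :: complex poly)" for p q
    by (rule poly_eqI) (simp add: coeff_map_poly coeff_mult of_rat_sum of_rat_mult)
  obtain p q where "z = poly (map_poly of_rat p) (zeta e)" "w = poly (map_poly of_rat p) (zeta e ^ n)"
    "z' = poly (map_poly of_rat q) (zeta e)" "w' = poly (map_poly of_rat q) (zeta e ^ n)"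
    using assms by (auto simp: gal_pair_def)
  then show ?thesis unfolding gal_pair_def by (intro exI[of _ "p * q"]) (simp add: hom)
qed

lemma gal_pair_sum:
  assumes "\<And>x. x \<in> S \<Longrightarrow> gal_pair e n (f x) (f' x)"
  shows "gal_pair e n (sum f S) (sum f' S)"
  using assms
proof (induction S rule: infinite_finite_induct)
  case (insert x S)
  then show ?case by (simp add: gal_pair_add)
qed (use gal_pair_of_rat[of e n 0] in simp_all)

lemma gal_gamma_eq:
  assumes "gal_pair e n z w" "e > 0" "coprime n e" "n > 0" "[r = int n] (mod int e)"
  shows "gal_gamma e r z = w"
  using assms gal_gamma_poly unfolding gal_pair_def by blast

context group
begin

lemma ydD:
  assumes "is_yd G X"
  shows "i < ydim X \<Longrightarrow> ydeg X i \<in> carrier G"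
    and "g \<in> carrier G \<Longrightarrow> yact X g \<in> carrier_mat (ydim X) (ydim X)"
    and "yact X \<one> = 1\<^sub>m (ydim X)"
    and "g \<in> carrier G \<Longrightarrow> h \<in> carrier G \<Longrightarrow> yact X (g \<otimes> h) = yact X g * yact X h"
    and "g \<in> carrier G \<Longrightarrow> i < ydim X \<Longrightarrow> j < ydim X \<Longrightarrow> yact X g $$ (i, j) \<noteq> 0 \<Longrightarrow> ydeg X i = conj_by g (ydeg X j)"
  using assms unfolding is_yd_def conj_by_def by blast+

lemma proj_carrier [simp]: "yd_proj X y \<in> carrier_mat (ydim X) (ydim X)"
  by (simp add: yd_proj_def)

lemma proj_mult_index:
  assumes "A \<in> carrier_mat (ydim X) m" "i < ydim X" "j < m"
  shows "(yd_proj X y * A) $$ (i, j) = (if ydeg X i = y then A $$ (i, j) else 0)"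
proof -
  have "(yd_proj X y * A) $$ (i, j) = (\<Sum>k<ydim X. (if i = k \<and> ydeg X i = y then 1 else 0) * A $$ (k, j))"
    using assms by (auto simp: yd_proj_def scalar_prod_def lessThan_atLeast0)
  also have "\<dots> = (\<Sum>k<ydim X. if k = i then (if ydeg X i = y then A $$ (i, j) else 0) else 0)"
    by (intro sum.cong) auto
  finally show ?thesis using assms by simp
qed

lemma mult_proj_index:
  assumes "A \<in> carrier_mat m (ydim X)" "i < m" "j < ydim X"
  shows "(A * yd_proj X y) $$ (i, j) = (if ydeg X j = y then A $$ (i, j) else 0)"
proof -
  have "(A * yd_proj X y) $$ (i, j) = (\<Sum>k<ydim X. A $$ (i, k) * (if k = j \<and> ydeg X k = y then 1 else 0))"
    using assms by (auto simp: yd_proj_def scalar_prod_def lessThan_atLeast0)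
  also have "\<dots> = (\<Sum>k<ydim X. if k = j then (if ydeg X j = y then A $$ (i, j) else 0) else 0)"
    by (intro sum.cong) auto
  finally show ?thesis using assms by simp
qed

lemma trace_proj: "A \<in> carrier_mat (ydim X) (ydim X) \<Longrightarrow>
    mat_trace (yd_proj X y * A) = (\<Sum>i | i < ydim X \<and> ydeg X i = y. A $$ (i, i))"
proof -
  assume A: "A \<in> carrier_mat (ydim X) (ydim X)"
  have "mat_trace (yd_proj X y * A) = (\<Sum>i<ydim X. (yd_proj X y * A) $$ (i, i))"
    by (simp add: mat_trace_def yd_proj_def)
  also have "\<dots> = (\<Sum>i<ydim X. if ydeg X i = y then A $$ (i, i) else 0)"
    using proj_mult_index[OF A] by (intro sum.cong) auto
  also have "\<dots> = (\<Sum>i\<in>{i \<in> {..<ydim X}. ydeg X i = y}. A $$ (i, i))"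
    by (intro sum.inter_filter[symmetric]) simp
  finally show ?thesis by simp
qed

lemma chi_eq_trace: "is_yd G X \<Longrightarrow> g \<in> carrier G \<Longrightarrow> chi X y g = mat_trace (yd_proj X y * yact X g)"
  by (simp add: chi_def trace_proj ydD(2))

lemma act_proj:
  assumes X: "is_yd G X" and g: "g \<in> carrier G" and y: "y \<in> carrier G"
  shows "yact X g * yd_proj X y = yd_proj X (conj_by g y) * yact X g"
proof (rule eq_matI)
  note A = ydD(2)[OF X g]
  show "dim_row (yact X g * yd_proj X y) = dim_row (yd_proj X (conj_by g y) * yact X g)"
    "dim_col (yact X g * yd_proj X y) = dim_col (yd_proj X (conj_by g y) * yact X g)"
    using A by (auto simp: yd_proj_def)
  fix i j assume "i < dim_row (yd_proj X (conj_by g y) * yact X g)" "j < dim_col (yd_proj X (conj_by g y) * yact X g)"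
  then have ij: "i < ydim X" "j < ydim X" using A by (auto simp: yd_proj_def)
  have "ydeg X i = conj_by g y \<longleftrightarrow> ydeg X j = y" if "yact X g $$ (i, j) \<noteq> 0"
    using ydD(5)[OF X g ij that] conj_inj[OF g ydD(1)[OF X ij(2)] y] by auto
  then show "(yact X g * yd_proj X y) $$ (i, j) = (yd_proj X (conj_by g y) * yact X g) $$ (i, j)"
    using proj_mult_index[OF A ij] mult_proj_index[OF A ij] by auto
qed

lemma proj_proj: "yd_proj X y * yd_proj X z = (if y = z then yd_proj X y else 0\<^sub>m (ydim X) (ydim X))"
proof (rule eq_matI)
  fix i j assume "i < dim_row (if y = z then yd_proj X y else 0\<^sub>m (ydim X) (ydim X))"
    "j < dim_col (if y = z then yd_proj X y else 0\<^sub>m (ydim X) (ydim X))"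
  then have ij: "i < ydim X" "j < ydim X" by (auto simp: yd_proj_def split: if_splits)
  show "(yd_proj X y * yd_proj X z) $$ (i, j) = (if y = z then yd_proj X y else 0\<^sub>m (ydim X) (ydim X)) $$ (i, j)"
    unfolding proj_mult_index[OF proj_carrier ij] using ij by (auto simp: yd_proj_def)
qed (auto simp: yd_proj_def)

lemma pow_group_exp: "g \<in> carrier G \<Longrightarrow> g [^] group_exp G = \<one>"
  using pow_eq_id by (simp add: group_exp_def)

lemma chi_noncommuting:
  assumes X: "is_yd G X" and "g \<in> carrier G" "y \<in> carrier G" "conj_by g y \<noteq> y"
  shows "chi X y g = 0"
  unfolding chi_def
proof (intro sum.neutral ballI)
  fix i assume i: "i \<in> {i. i < ydim X \<and> ydeg X i = y}"
  then show "yact X g $$ (i, i) = 0" using ydD(5)[OF X assms(2), of i i] assms(4) by auto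
qed

lemma group_exp_pos: "finite (carrier G) \<Longrightarrow> group_exp G > 0"
proof -
  assume fin: "finite (carrier G)"
  have "0 \<notin> group.ord G ` carrier G" using ord_ge_1[OF fin] by fastforce
  then have "Lcm (group.ord G ` carrier G) \<noteq> 0" using fin by (simp add: Lcm_0_iff_nat)
  then show "group_exp G > 0" unfolding group_exp_def by simp
qed

lemma conj_by_fixed_commute:
  "g \<in> carrier G \<Longrightarrow> y \<in> carrier G \<Longrightarrow> conj_by g y = y \<longleftrightarrow> conj_by y g = g"
  unfolding conj_by_fixed_iff by (rule eq_commute)

text \<open>If g commutes with y, then A = P_y g has A^k = P_y g^k for k > 0. So the trace of A^k is
  the character at (y, g^k), and A^(e+1) = A, as \<open>trace_powers_poly\<close> requires.
  Otherwise both values vanish: if g^n commuted with y, then g and its conjugate by y would have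
  equal n-th powers and coincide.\<close>

lemma chi_gal_pair:
  assumes X: "is_yd G X" and fin: "finite (carrier G)" and n: "n > 0" "coprime n (order G)"
    and g: "g \<in> carrier G" and y: "y \<in> carrier G"
  shows "gal_pair (group_exp G) n (chi X y g) (chi X y (g [^] n))"
proof (cases "conj_by g y = y")
  case True
  let ?e = "group_exp G" and ?P = "yd_proj X y" and ?d = "ydim X"
  define A where "A = ?P * yact X g"
  note R = ydD(2)[OF X]
  have A: "A \<in> carrier_mat ?d ?d" unfolding A_def using R[OF g] by (intro mult_carrier_mat[of _ ?d ?d]) auto
  have pw: "A ^\<^sub>m Suc k = ?P * yact X (g [^] Suc k)" for k
  proof (induction k)
    case 0
    then show ?case using g A by (simp add: A_def)
  next
    case (Suc k)
    define B where "B = yact X (g [^] Suc k)"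
    have B: "B \<in> carrier_mat ?d ?d" unfolding B_def using R g by simp
    have com: "B * ?P = ?P * B"
    proof -
      have "conj_by (g [^] Suc k) y = y"
      proof -
        have "conj_by (g [^] j) y = y" for j :: nat
        proof (induction j)
          case (Suc j)
          then show ?case using conj_conj[of "g [^] j" g y] True g y by simp
        qed (use y in simp)
        then show ?thesis .
      qed
      then show ?thesis using act_proj[OF X _ y, of "g [^] Suc k"] g by (simp add: B_def del: nat_pow_Suc)
    qed
    have P: "?P \<in> carrier_mat ?d ?d" by simp
    have BR: "B * yact X g \<in> carrier_mat ?d ?d" using B R[OF g] by simp
    have "A ^\<^sub>m Suc (Suc k) = (?P * B) * (?P * yact X g)"
      using Suc by (simp add: B_def A_def del: nat_pow_Suc)
    also have "\<dots> = ?P * (B * (?P * yact X g))"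
      by (rule assoc_mult_mat[OF P B A[unfolded A_def]])
    also have "B * (?P * yact X g) = (B * ?P) * yact X g"
      by (rule assoc_mult_mat[OF B P R[OF g], symmetric])
    also have "\<dots> = ?P * (B * yact X g)" unfolding com by (rule assoc_mult_mat[OF P B R[OF g]])
    also have "?P * (?P * (B * yact X g)) = (?P * ?P) * (B * yact X g)"
      by (rule assoc_mult_mat[OF P P BR, symmetric])
    also have "\<dots> = ?P * yact X (g [^] Suc (Suc k))"
      using ydD(4)[OF X, of "g [^] Suc k" g] g by (simp add: proj_proj B_def)
    finally show ?case .
  qed
  have e: "?e > 0" using group_exp_pos[OF fin] .
  have Ae: "A ^\<^sub>m Suc ?e = A" unfolding pw using g by (simp add: A_def pow_group_exp)
  have "\<exists>p :: rat poly. \<forall>k>0. mat_trace (A ^\<^sub>m k) = poly (map_poly of_rat p) (zeta ?e ^ k)"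
    by (rule trace_powers_poly[OF A e Ae], intro exI allI impI)
  then obtain p :: "rat poly" where p: "\<forall>k>0. mat_trace (A ^\<^sub>m k) = poly (map_poly of_rat p) (zeta ?e ^ k)"
    by blast
  have "chi X y (g [^] Suc k) = poly (map_poly of_rat p) (zeta ?e ^ Suc k)" for k :: nat
  proof -
    have "chi X y (g [^] Suc k) = mat_trace (A ^\<^sub>m Suc k)"
      unfolding pw using g by (intro chi_eq_trace[OF X]) simp
    then show ?thesis using p by (metis zero_less_Suc)
  qed
  from this[of 0] this[of "n - 1"] show ?thesis
    unfolding gal_pair_def using n(1) g by (intro exI[of _ p]) simp
next
  case False
  have "conj_by (g [^] n) y \<noteq> y"
  proof
    assume "conj_by (g [^] n) y = y"
    then have *: "conj_by y (g [^] n) = g [^] n"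
      using g y conj_by_fixed_commute[of "g [^] n" y] by simp
    then have "conj_by y g [^] n = g [^] n" using conj_pow[OF y g] by simp
    then have "conj_by y g = g"
      using inj_onD[OF pow_inj_on[OF fin n(2)], of "conj_by y g" g] g y by simp
    then show False using False g y conj_by_fixed_commute[of g y] by simp
  qed
  then have "chi X y g = 0" "chi X y (g [^] n) = 0" using False chi_noncommuting[OF X] g y by auto
  then show ?thesis using gal_pair_of_rat[of "group_exp G" n 0] by simp
qed

end

section \<open>The S-matrix in terms of characters\<close>

lemma sum_div_mod:
  fixes a b :: nat
  shows "(\<Sum>k<a * b. F (k div b) (k mod b)) = (\<Sum>i<a. \<Sum>j<b. F i j)"
proof (cases "b = 0")
  case False
  then have b: "b > 0" by simp
  have lt: "i * b + j < a * b" if "i < a" "j < b" for i j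
  proof -
    have "i * b + j < Suc i * b" using that by simp
    also have "\<dots> \<le> a * b" using that by (intro mult_le_mono1) simp
    finally show ?thesis .
  qed
  have "(\<Sum>i<a. \<Sum>j<b. F i j) = (\<Sum>(i, j)\<in>{..<a} \<times> {..<b}. F i j)"
    by (rule sum.cartesian_product)
  also have "\<dots> = (\<Sum>k<a * b. F (k div b) (k mod b))"
    by (rule sum.reindex_bij_witness[where i = "\<lambda>k. (k div b, k mod b)" and j = "\<lambda>(i, j). i * b + j"])
      (use b lt in \<open>auto simp: less_mult_imp_div_less\<close>)
  finally show ?thesis by simp
qed simp

text \<open>The double braiding sends e_i (x) f_j to the sum over k of |f_k| e_i (x) f_k, weighted
  by the coefficient of f_k in |e_i| f_j. Only k = j reaches the diagonal.\<close>

lemma yd_S_eq: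
  "yd_S X Y = (\<Sum>i<ydim X. \<Sum>j<ydim Y. yact X (ydeg Y j) $$ (i, i) * yact Y (ydeg X i) $$ (j, j))"
proof -
  let ?a = "ydim X" and ?b = "ydim Y"
  have "yd_S X Y = (\<Sum>c<?a * ?b. \<Sum>r<?b * ?a. yd_braid Y X $$ (c, r) * yd_braid X Y $$ (r, c))"
    unfolding yd_S_def mat_trace_def yd_braid_def
    by (simp add: scalar_prod_def lessThan_atLeast0)
  also have "\<dots> = (\<Sum>c<?a * ?b. yact X (ydeg Y (c mod ?b)) $$ (c div ?b, c div ?b) *
      yact Y (ydeg X (c div ?b)) $$ (c mod ?b, c mod ?b))"
  proof (intro sum.cong refl)
    fix c assume c: "c \<in> {..<?a * ?b}"
    then have b: "?b > 0" by (cases "?b") auto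
    have ij: "c div ?b < ?a" "c mod ?b < ?b" using c b by (auto simp: less_mult_imp_div_less)
    define T where "T k l = (if c mod ?b = k then yact X (ydeg Y k) $$ (c div ?b, l) else 0) *
      (if l = c div ?b then yact Y (ydeg X (c div ?b)) $$ (k, c mod ?b) else 0)" for k l
    have "(\<Sum>r<?b * ?a. yd_braid Y X $$ (c, r) * yd_braid X Y $$ (r, c)) = (\<Sum>r<?b * ?a. T (r div ?a) (r mod ?a))"
      using c by (intro sum.cong refl) (auto simp: yd_braid_def T_def)
    also have "\<dots> = (\<Sum>k<?b. \<Sum>l<?a. T k l)" by (rule sum_div_mod)
    also have "\<dots> = (\<Sum>k<?b. if k = c mod ?b then T k (c div ?b) else 0)"
    proof (intro sum.cong refl)
      fix k
      have "(\<Sum>l<?a. T k l) = (\<Sum>l<?a. if l = c div ?b then T k l else 0)"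
        by (intro sum.cong refl) (simp add: T_def)
      also have "\<dots> = T k (c div ?b)" using ij by simp
      finally show "(\<Sum>l<?a. T k l) = (if k = c mod ?b then T k (c div ?b) else 0)"
        by (simp add: T_def)
    qed
    also have "\<dots> = T (c mod ?b) (c div ?b)" using ij by simp
    finally show "(\<Sum>r<?b * ?a. yd_braid Y X $$ (c, r) * yd_braid X Y $$ (r, c)) =
      yact X (ydeg Y (c mod ?b)) $$ (c div ?b, c div ?b) * yact Y (ydeg X (c div ?b)) $$ (c mod ?b, c mod ?b)"
      by (simp add: T_def)
  qed
  also have "\<dots> = (\<Sum>i<?a. \<Sum>j<?b. yact X (ydeg Y j) $$ (i, i) * yact Y (ydeg X i) $$ (j, j))"
    by (rule sum_div_mod)
  finally show ?thesis .
qed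

context group
begin

lemma yd_S_chi:
  assumes fin: "finite (carrier G)" and X: "is_yd G X" and Y: "is_yd G Y"
  shows "yd_S X Y = (\<Sum>x\<in>carrier G. \<Sum>y\<in>carrier G. chi X x y * chi Y y x)"
proof -
  let ?I = "\<lambda>x. {i \<in> {..<ydim X}. ydeg X i = x}" and ?J = "\<lambda>y. {j \<in> {..<ydim Y}. ydeg Y j = y}"
  define F where "F x y i j = yact X y $$ (i, i) * yact Y x $$ (j, j)" for x y i j
  have "yd_S X Y = (\<Sum>i<ydim X. \<Sum>j<ydim Y. F (ydeg X i) (ydeg Y j) i j)"
    unfolding yd_S_eq F_def ..
  also have "\<dots> = (\<Sum>x\<in>carrier G. \<Sum>i\<in>?I x. \<Sum>j<ydim Y. F (ydeg X i) (ydeg Y j) i j)"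
    using fin ydD(1)[OF X] by (intro sum.group[symmetric]) auto
  also have "\<dots> = (\<Sum>x\<in>carrier G. \<Sum>i\<in>?I x.
      \<Sum>y\<in>carrier G. \<Sum>j\<in>?J y. F (ydeg X i) (ydeg Y j) i j)"
    using fin ydD(1)[OF Y] by (intro sum.cong refl sum.group[symmetric]) auto
  also have "\<dots> = (\<Sum>x\<in>carrier G. \<Sum>i\<in>?I x.
      \<Sum>y\<in>carrier G. \<Sum>j\<in>?J y. F x y i j)"
    by (intro sum.cong refl) auto
  also have "\<dots> = (\<Sum>x\<in>carrier G. \<Sum>y\<in>carrier G. \<Sum>i\<in>?I x.
      \<Sum>j\<in>?J y. F x y i j)"
    by (intro sum.cong refl sum.swap)
  also have "\<dots> = (\<Sum>x\<in>carrier G. \<Sum>y\<in>carrier G. chi X x y * chi Y y x)"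
    by (simp add: F_def chi_def sum_product)
  finally show ?thesis .
qed

lemma proj_mor:
  assumes "is_yd_mor G X Y f"
  shows "yd_proj Y y * f = f * yd_proj X y"
proof -
  have f: "f \<in> carrier_mat (ydim Y) (ydim X)"
    and d: "\<And>i j. i < ydim Y \<Longrightarrow> j < ydim X \<Longrightarrow> f $$ (i, j) \<noteq> 0 \<Longrightarrow> ydeg Y i = ydeg X j"
    using assms by (auto simp: is_yd_mor_def)
  show ?thesis
  proof (rule eq_matI)
    fix i j assume "i < dim_row (f * yd_proj X y)" "j < dim_col (f * yd_proj X y)"
    then have ij: "i < ydim Y" "j < ydim X" using f by (auto simp: yd_proj_def)
    show "(yd_proj Y y * f) $$ (i, j) = (f * yd_proj X y) $$ (i, j)"
      unfolding proj_mult_index[OF f ij] mult_proj_index[OF f ij] using d[OF ij] by (cases "f $$ (i, j) = 0") auto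
  qed (use f in \<open>auto simp: yd_proj_def\<close>)
qed

text \<open>The statement on the S-matrix concerns arbitrary objects isomorphic to the twisted ones.
  Morphisms commute with the action and with the projections, so the traces agree.\<close>

lemma chi_isomorphic:
  assumes X: "is_yd G X" and Y: "is_yd G Y" and iso: "yd_isomorphic G X Y" and g: "g \<in> carrier G"
  shows "chi X y g = chi Y y g"
proof -
  obtain f f' where f: "is_yd_mor G X Y f" and f': "is_yd_mor G Y X f'"
    and inv: "f' * f = 1\<^sub>m (ydim X)" "f * f' = 1\<^sub>m (ydim Y)"
    using iso unfolding yd_isomorphic_def is_yd_iso_def by blast
  let ?m = "ydim X" and ?n = "ydim Y"
  have fc: "f \<in> carrier_mat ?n ?m" "f' \<in> carrier_mat ?m ?n" using f f' by (auto simp: is_yd_mor_def)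
  have comm: "f * yact X g = yact Y g * f" using f g by (auto simp: is_yd_mor_def)
  note RX = ydD(2)[OF X g] and RY = ydD(2)[OF Y g]
  have PX: "yd_proj X y \<in> carrier_mat ?m ?m" and PY: "yd_proj Y y \<in> carrier_mat ?n ?n" by simp_all
  have A: "yd_proj X y * yact X g \<in> carrier_mat ?m ?m" using PX RX by (rule mult_carrier_mat)
  have B: "yd_proj Y y * yact Y g \<in> carrier_mat ?n ?n" using PY RY by (rule mult_carrier_mat)
  have com2: "yd_proj Y y * yact Y g * f = f * (yd_proj X y * yact X g)"
  proof -
    have "yd_proj Y y * yact Y g * f = yd_proj Y y * (f * yact X g)"
      unfolding comm by (rule assoc_mult_mat[OF PY RY fc(1)])
    also have "\<dots> = (yd_proj Y y * f) * yact X g" by (rule assoc_mult_mat[OF PY fc(1) RX, symmetric])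
    also have "\<dots> = f * (yd_proj X y * yact X g)"
      unfolding proj_mor[OF f] by (rule assoc_mult_mat[OF fc(1) PX RX])
    finally show ?thesis .
  qed
  have "chi Y y g = mat_trace (yd_proj Y y * yact Y g)" by (rule chi_eq_trace[OF Y g])
  also have "yd_proj Y y * yact Y g = (yd_proj Y y * yact Y g) * (f * f')"
    unfolding inv by (rule right_mult_one_mat[OF B, symmetric])
  also have "\<dots> = (yd_proj Y y * yact Y g * f) * f'"
    by (rule assoc_mult_mat[OF B fc, symmetric])
  also have "\<dots> = f * ((yd_proj X y * yact X g) * f')"
    unfolding com2 by (rule assoc_mult_mat[OF fc(1) A fc(2)])
  also have "mat_trace \<dots> = mat_trace ((yd_proj X y * yact X g) * f' * f)"
    using A fc by (intro mat_trace_mult_swap[of _ ?n ?m]) auto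
  also have "(yd_proj X y * yact X g) * f' * f = yd_proj X y * yact X g"
    unfolding assoc_mult_mat[OF A fc(2,1)] inv by (rule right_mult_one_mat[OF A])
  also have "mat_trace \<dots> = chi X y g" by (rule chi_eq_trace[OF X g, symmetric])
  finally show ?thesis by simp
qed

lemma yd_tau_simps [simp]:
  "ydim (yd_tau G r X) = ydim X" "yact (yd_tau G r X) = yact X"
  "ydeg (yd_tau G r X) i = ydeg X i [^] r"
  by (simp_all add: yd_tau_def)

lemma conj_int_pow:
  fixes r :: int
  assumes "g \<in> carrier G" "x \<in> carrier G"
  shows "conj_by g (x [^] r) = conj_by g x [^] r"
proof -
  show ?thesis
  proof (cases r)
    case (nonneg k)
    then show ?thesis using assms by (simp add: int_pow_int conj_pow)
  next
    case (neg k)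
    have "conj_by g (x [^] r) = inv (conj_by g (x [^] Suc k))"
      unfolding neg int_pow_neg_int[OF assms(2)] using assms by (intro conj_by_inv[symmetric]) auto
    also have "\<dots> = inv (conj_by g x [^] Suc k)" unfolding conj_pow[OF assms] ..
    also have "\<dots> = conj_by g x [^] r" unfolding neg using assms by (intro int_pow_neg_int[symmetric]) simp
    finally show ?thesis .
  qed
qed

lemma is_yd_tau: "is_yd G X \<Longrightarrow> is_yd G (yd_tau G r X)"
  unfolding is_yd_def using conj_int_pow[unfolded conj_by_def] by simp

lemma pow_bij:
  assumes "finite (carrier G)" "coprime n (order G)"
  shows "bij_betw (\<lambda>x. x [^] (n::nat)) (carrier G) (carrier G)"
proof -
  have "(\<lambda>x. x [^] n) ` carrier G \<subseteq> carrier G" by auto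
  then show ?thesis
    using pow_inj_on[OF assms] endo_inj_surj[OF assms(1)] by (auto simp: bij_betw_def)
qed

lemma chi_tau:
  assumes fin: "finite (carrier G)" and n: "coprime n (order G)"
    and r: "\<And>x. x \<in> carrier G \<Longrightarrow> x [^] r = x [^] n"
    and X: "is_yd G X" and y: "y \<in> carrier G"
  shows "chi (yd_tau G r X) (y [^] n) g = chi X y g"
proof -
  have "ydeg X i [^] r = y [^] n \<longleftrightarrow> ydeg X i = y" if "i < ydim X" for i
    using r[OF ydD(1)[OF X that]] inj_on_eq_iff[OF pow_inj_on[OF fin n] ydD(1)[OF X that] y] by simp
  then have "{i. i < ydim X \<and> ydeg X i [^] r = y [^] n} = {i. i < ydim X \<and> ydeg X i = y}" by auto
  then show ?thesis by (simp add: chi_def)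
qed

text \<open>Both sums are reindexed by n-th powers, a bijection of G. The character of the twisted X
  at (x^n, y^n) is that of X at (x, y^n), the Galois conjugate of its value at (x, y), and likewise
  for Y with x and y exchanged.\<close>

lemma yd_S_tau_gal_pair:
  assumes fin: "finite (carrier G)" and n: "n > 0" "coprime n (order G)"
    and r: "\<And>x. x \<in> carrier G \<Longrightarrow> x [^] r = x [^] n"
    and X: "is_yd G X" and Y: "is_yd G Y" and X': "is_yd G X'" and Y': "is_yd G Y'"
    and iso: "yd_isomorphic G (yd_tau G r X) X'" "yd_isomorphic G (yd_tau G r Y) Y'"
  shows "gal_pair (group_exp G) n (yd_S X Y) (yd_S X' Y')"
proof -
  let ?f = "\<lambda>x. x [^] n"
  note bij = pow_bij[OF fin n(2)]
  have "yd_S X' Y' = (\<Sum>x\<in>carrier G. \<Sum>y\<in>carrier G. chi X' x y * chi Y' y x)"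
    by (rule yd_S_chi[OF fin X' Y'])
  also have "\<dots> = (\<Sum>x\<in>carrier G. \<Sum>y\<in>carrier G. chi X' (?f x) (?f y) * chi Y' (?f y) (?f x))"
    unfolding sum.reindex_bij_betw[OF bij, of "\<lambda>y. chi X' (?f x) y * chi Y' y (?f x)" for x]
    by (rule sum.reindex_bij_betw[OF bij, of "\<lambda>x. \<Sum>y\<in>carrier G. chi X' x y * chi Y' y x", symmetric])
  also have "\<dots> = (\<Sum>x\<in>carrier G. \<Sum>y\<in>carrier G. chi X x (?f y) * chi Y y (?f x))"
  proof (intro sum.cong refl)
    fix x y assume xy: "x \<in> carrier G" "y \<in> carrier G"
    have "chi X' (?f x) (?f y) = chi X x (?f y)"
      using chi_isomorphic[OF is_yd_tau[OF X] X' iso(1), of "?f y" "?f x"] chi_tau[OF fin n(2) r X xy(1)] xy by simp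
    moreover have "chi Y' (?f y) (?f x) = chi Y y (?f x)"
      using chi_isomorphic[OF is_yd_tau[OF Y] Y' iso(2), of "?f x" "?f y"] chi_tau[OF fin n(2) r Y xy(2)] xy by simp
    ultimately show "chi X' (?f x) (?f y) * chi Y' (?f y) (?f x) = chi X x (?f y) * chi Y y (?f x)" by simp
  qed
  finally have "yd_S X' Y' = (\<Sum>x\<in>carrier G. \<Sum>y\<in>carrier G. chi X x (?f y) * chi Y y (?f x))" .
  then show ?thesis unfolding yd_S_chi[OF fin X Y]
    by (auto intro!: gal_pair_sum gal_pair_mult chi_gal_pair fin n X Y)
qed

end

subsection \<open>The quasitensor structure\<close>

text \<open>\<open>a\<close> and \<open>b\<close> are evaluated at the original degrees of X and Y,
  although the source of the map is graded by their powers. These degrees are read off from the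
  column, that is, from the source basis vector.\<close>

definition twist_mat :: "('g \<times> 'g \<Rightarrow> 'g) \<Rightarrow> ('g \<times> 'g \<Rightarrow> 'g) \<Rightarrow> 'g yd \<Rightarrow> 'g yd \<Rightarrow> complex mat" where
  "twist_mat a b X Y = mat (ydim X * ydim Y) (ydim X * ydim Y)
     (\<lambda>(r, c). let t = (ydeg X (c div ydim Y), ydeg Y (c mod ydim Y)) in
        yact X (a t) $$ (r div ydim Y, c div ydim Y) * yact Y (b t) $$ (r mod ydim Y, c mod ydim Y))"

lemma twist_mat_carrier [simp]: "twist_mat a b X Y \<in> carrier_mat (ydim X * ydim Y) (ydim X * ydim Y)"
  by (simp add: twist_mat_def)

lemma div_mod_less:
  fixes r a b :: nat
  assumes "r < a * b"
  shows "r div b < a" "r mod b < b"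
proof -
  have "b > 0" using assms by (cases b) auto
  then show "r div b < a" "r mod b < b" using assms by (auto simp: less_mult_imp_div_less)
qed

lemma twist_mat_index:
  assumes "r < ydim X * ydim Y" "c < ydim X * ydim Y"
  shows "twist_mat a b X Y $$ (r, c) =
    yact X (a (ydeg X (c div ydim Y), ydeg Y (c mod ydim Y))) $$ (r div ydim Y, c div ydim Y) *
    yact Y (b (ydeg X (c div ydim Y), ydeg Y (c mod ydim Y))) $$ (r mod ydim Y, c mod ydim Y)"
  using assms by (simp add: twist_mat_def Let_def)

lemma kron_carrier:
  assumes "A \<in> carrier_mat m n" "B \<in> carrier_mat p q"
  shows "kron A B \<in> carrier_mat (m * p) (n * q)"
  using assms by (auto simp: kron_def)

lemma kron_index:
  assumes "A \<in> carrier_mat m n" "B \<in> carrier_mat p q" "r < m * p" "c < n * q"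
  shows "kron A B $$ (r, c) = A $$ (r div p, c div q) * B $$ (r mod p, c mod q)"
  using assms by (auto simp: kron_def)

lemma mult_index_sum:
  assumes "A \<in> carrier_mat m n" "B \<in> carrier_mat n p" "i < m" "j < p"
  shows "(A * B) $$ (i, j) = (\<Sum>k<n. A $$ (i, k) * B $$ (k, j))"
  using assms by (auto simp: scalar_prod_def lessThan_atLeast0)

text \<open>A column of M that is a tensor product, and whose support has degrees with constant
  conjugators, is acted on by the plain tensor product of the actions of \<alpha> and \<beta>.
  Compatibility with the action, naturality and invertibility are all instances.\<close>

lemma twist_mat_mult_index:
  assumes M: "M \<in> carrier_mat (ydim X * ydim Y) m" and r: "r < ydim X * ydim Y" and c: "c < m"
    and Mc: "\<And>k. k < ydim X * ydim Y \<Longrightarrow> M $$ (k, c) = f $$ (k div ydim Y, c1) * g $$ (k mod ydim Y, c2)"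
    and f: "f \<in> carrier_mat (ydim X) m1" "c1 < m1" and g: "g \<in> carrier_mat (ydim Y) m2" "c2 < m2"
    and A: "yact X \<alpha> \<in> carrier_mat (ydim X) (ydim X)" and B: "yact Y \<beta> \<in> carrier_mat (ydim Y) (ydim Y)"
    and ab: "\<And>i j. i < ydim X \<Longrightarrow> j < ydim Y \<Longrightarrow> f $$ (i, c1) \<noteq> 0 \<Longrightarrow> g $$ (j, c2) \<noteq> 0 \<Longrightarrow>
      a (ydeg X i, ydeg Y j) = \<alpha> \<and> b (ydeg X i, ydeg Y j) = \<beta>"
  shows "(twist_mat a b X Y * M) $$ (r, c) =
    (yact X \<alpha> * f) $$ (r div ydim Y, c1) * (yact Y \<beta> * g) $$ (r mod ydim Y, c2)"
proof -
  let ?p = "r div ydim Y" and ?q = "r mod ydim Y"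
  note pq = div_mod_less[OF r]
  have "(twist_mat a b X Y * M) $$ (r, c) = (\<Sum>k<ydim X * ydim Y. twist_mat a b X Y $$ (r, k) * M $$ (k, c))"
    by (rule mult_index_sum[OF twist_mat_carrier M r c])
  also have "\<dots> = (\<Sum>k<ydim X * ydim Y. (\<lambda>i j. yact X \<alpha> $$ (?p, i) * f $$ (i, c1) * (yact Y \<beta> $$ (?q, j) * g $$ (j, c2)))
      (k div ydim Y) (k mod ydim Y))"
  proof (intro sum.cong refl)
    fix k assume "k \<in> {..<ydim X * ydim Y}"
    then have k: "k < ydim X * ydim Y" by simp
    show "twist_mat a b X Y $$ (r, k) * M $$ (k, c) =
      yact X \<alpha> $$ (?p, k div ydim Y) * f $$ (k div ydim Y, c1) * (yact Y \<beta> $$ (?q, k mod ydim Y) * g $$ (k mod ydim Y, c2))"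
      using ab[OF div_mod_less[OF k]] unfolding twist_mat_index[OF r k] Mc[OF k]
      by (cases "f $$ (k div ydim Y, c1) = 0 \<or> g $$ (k mod ydim Y, c2) = 0") auto
  qed
  also have "\<dots> = (\<Sum>i<ydim X. \<Sum>j<ydim Y. yact X \<alpha> $$ (?p, i) * f $$ (i, c1) * (yact Y \<beta> $$ (?q, j) * g $$ (j, c2)))"
    by (rule sum_div_mod)
  also have "\<dots> = (yact X \<alpha> * f) $$ (?p, c1) * (yact Y \<beta> * g) $$ (?q, c2)"
    unfolding mult_index_sum[OF A f(1) pq(1) f(2)] mult_index_sum[OF B g(1) pq(2) g(2)]
    by (rule sum_product[symmetric])
  finally show ?thesis .
qed

lemma kron_mult_twist_mat_index:
  assumes f: "f \<in> carrier_mat m1 (ydim X)" and g: "g \<in> carrier_mat m2 (ydim Y)"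
    and r: "r < m1 * m2" and c: "c < ydim X * ydim Y"
    and t: "t = (ydeg X (c div ydim Y), ydeg Y (c mod ydim Y))"
    and A: "yact X (a t) \<in> carrier_mat (ydim X) (ydim X)" and B: "yact Y (b t) \<in> carrier_mat (ydim Y) (ydim Y)"
  shows "(kron f g * twist_mat a b X Y) $$ (r, c) =
    (f * yact X (a t)) $$ (r div m2, c div ydim Y) * (g * yact Y (b t)) $$ (r mod m2, c mod ydim Y)"
proof -
  let ?p = "r div m2" and ?q = "r mod m2" and ?c1 = "c div ydim Y" and ?c2 = "c mod ydim Y"
  note pq = div_mod_less[OF r] and cc = div_mod_less[OF c]
  have "(kron f g * twist_mat a b X Y) $$ (r, c) = (\<Sum>k<ydim X * ydim Y. kron f g $$ (r, k) * twist_mat a b X Y $$ (k, c))"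
    by (rule mult_index_sum[OF kron_carrier[OF f g] twist_mat_carrier r c])
  also have "\<dots> = (\<Sum>k<ydim X * ydim Y. (\<lambda>i j. f $$ (?p, i) * yact X (a t) $$ (i, ?c1) * (g $$ (?q, j) * yact Y (b t) $$ (j, ?c2)))
      (k div ydim Y) (k mod ydim Y))"
    by (intro sum.cong refl) (simp add: twist_mat_index c kron_index[OF f g r] t)
  also have "\<dots> = (\<Sum>i<ydim X. \<Sum>j<ydim Y. f $$ (?p, i) * yact X (a t) $$ (i, ?c1) * (g $$ (?q, j) * yact Y (b t) $$ (j, ?c2)))"
    by (rule sum_div_mod)
  also have "\<dots> = (f * yact X (a t)) $$ (?p, ?c1) * (g * yact Y (b t)) $$ (?q, ?c2)"
    unfolding mult_index_sum[OF f A pq(1) cc(1)] mult_index_sum[OF g B pq(2) cc(2)]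
    by (rule sum_product[symmetric])
  finally show ?thesis .
qed

context group
begin

lemma yact_conj_mult:
  assumes X: "is_yd G X" and "g \<in> carrier G" "h \<in> carrier G"
  shows "yact X (conj_by g h) * yact X g = yact X g * yact X h"
proof -
  have "conj_by g h \<otimes> g = g \<otimes> h" using assms by (simp add: conj_by_def m_assoc)
  then show ?thesis using ydD(4)[OF X, of "conj_by g h" g] ydD(4)[OF X, of g h] assms by simp
qed

text \<open>Acting by g moves the degrees t to \<open>act g t\<close>, where equivariance supplies
  the conjugator g a(t) g^-1; and (g a(t) g^-1) g = g a(t).\<close>

lemma twist_mat_act:
  assumes X: "is_yd G X" and Y: "is_yd G Y" and a: "equivariant a" and b: "equivariant b" and g: "g \<in> carrier G"
  shows "twist_mat a b X Y * kron (yact X g) (yact Y g) = kron (yact X g) (yact Y g) * twist_mat a b X Y"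
proof (rule eq_matI)
  note RX = ydD(2)[OF X] and RY = ydD(2)[OF Y]
  note K = kron_carrier[OF RX[OF g] RY[OF g]]
  fix r c assume "r < dim_row (kron (yact X g) (yact Y g) * twist_mat a b X Y)"
    "c < dim_col (kron (yact X g) (yact Y g) * twist_mat a b X Y)"
  then have rc: "r < ydim X * ydim Y" "c < ydim X * ydim Y" using K by (auto simp: twist_mat_def)
  note c = div_mod_less[OF rc(2)]
  define t where "t = (ydeg X (c div ydim Y), ydeg Y (c mod ydim Y))"
  have tG: "t \<in> carrier G \<times> carrier G" using ydD(1)[OF X c(1)] ydD(1)[OF Y c(2)] by (simp add: t_def)
  have abt: "a t \<in> carrier G" "b t \<in> carrier G" using equivariantD(1)[OF a tG] equivariantD(1)[OF b tG] by auto
  have "(twist_mat a b X Y * kron (yact X g) (yact Y g)) $$ (r, c) =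
    (yact X (conj_by g (a t)) * yact X g) $$ (r div ydim Y, c div ydim Y) *
    (yact Y (conj_by g (b t)) * yact Y g) $$ (r mod ydim Y, c mod ydim Y)"
  proof (rule twist_mat_mult_index[OF K rc _ RX[OF g] c(1) RY[OF g] c(2)])
    fix i j assume ij: "i < ydim X" "j < ydim Y"
      and nz: "yact X g $$ (i, c div ydim Y) \<noteq> 0" "yact Y g $$ (j, c mod ydim Y) \<noteq> 0"
    have "(ydeg X i, ydeg Y j) = act g t"
      using ydD(5)[OF X g ij(1) c(1) nz(1)] ydD(5)[OF Y g ij(2) c(2) nz(2)] by (simp add: act_def t_def)
    then show "a (ydeg X i, ydeg Y j) = conj_by g (a t) \<and> b (ydeg X i, ydeg Y j) = conj_by g (b t)"
      using equivariantD(2)[OF a tG g] equivariantD(2)[OF b tG g] by simp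
  qed (use abt g RX RY rc in \<open>auto simp: kron_index[OF RX[OF g] RY[OF g]]\<close>)
  also have "\<dots> = (kron (yact X g) (yact Y g) * twist_mat a b X Y) $$ (r, c)"
    unfolding kron_mult_twist_mat_index[where a = a and b = b, OF RX[OF g] RY[OF g] rc t_def RX[OF abt(1)] RY[OF abt(2)]]
      yact_conj_mult[OF X g abt(1)] yact_conj_mult[OF Y g abt(2)] ..
  finally show "(twist_mat a b X Y * kron (yact X g) (yact Y g)) $$ (r, c) = (kron (yact X g) (yact Y g) * twist_mat a b X Y) $$ (r, c)" .
qed (use ydD(2)[OF X g] ydD(2)[OF Y g] in \<open>auto simp: twist_mat_def kron_def\<close>)

text \<open>Morphisms preserve degrees, so source and target use the same conjugators, whose action
  commutes with the morphisms.\<close>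

lemma twist_mat_natural:
  assumes X: "is_yd G X" and Y: "is_yd G Y" and X': "is_yd G X'" and Y': "is_yd G Y'"
    and a: "equivariant a" and b: "equivariant b" and f: "is_yd_mor G X X' f" and g: "is_yd_mor G Y Y' g"
  shows "twist_mat a b X' Y' * kron f g = kron f g * twist_mat a b X Y"
proof (rule eq_matI)
  have fc: "f \<in> carrier_mat (ydim X') (ydim X)" and gc: "g \<in> carrier_mat (ydim Y') (ydim Y)"
    using f g by (auto simp: is_yd_mor_def)
  note K = kron_carrier[OF fc gc]
  fix r c assume "r < dim_row (kron f g * twist_mat a b X Y)" "c < dim_col (kron f g * twist_mat a b X Y)"
  then have rc: "r < ydim X' * ydim Y'" "c < ydim X * ydim Y" using K by (auto simp: twist_mat_def)
  note c = div_mod_less[OF rc(2)]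
  define t where "t = (ydeg X (c div ydim Y), ydeg Y (c mod ydim Y))"
  have tG: "t \<in> carrier G \<times> carrier G" using ydD(1)[OF X c(1)] ydD(1)[OF Y c(2)] by (simp add: t_def)
  have abt: "a t \<in> carrier G" "b t \<in> carrier G" using equivariantD(1)[OF a tG] equivariantD(1)[OF b tG] by auto
  have "(twist_mat a b X' Y' * kron f g) $$ (r, c) =
    (yact X' (a t) * f) $$ (r div ydim Y', c div ydim Y) * (yact Y' (b t) * g) $$ (r mod ydim Y', c mod ydim Y)"
  proof (rule twist_mat_mult_index[OF K rc _ fc c(1) gc c(2)])
    fix i j assume ij: "i < ydim X'" "j < ydim Y'"
      and nz: "f $$ (i, c div ydim Y) \<noteq> 0" "g $$ (j, c mod ydim Y) \<noteq> 0"
    have "ydeg X' i = ydeg X (c div ydim Y)" "ydeg Y' j = ydeg Y (c mod ydim Y)"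
      using f g ij c nz by (auto simp: is_yd_mor_def)
    then show "a (ydeg X' i, ydeg Y' j) = a t \<and> b (ydeg X' i, ydeg Y' j) = b t" by (simp add: t_def)
  qed (use abt ydD(2)[OF X'] ydD(2)[OF Y'] rc in \<open>auto simp: kron_index[OF fc gc]\<close>)
  also have "\<dots> = (f * yact X (a t)) $$ (r div ydim Y', c div ydim Y) * (g * yact Y (b t)) $$ (r mod ydim Y', c mod ydim Y)"
    using f g abt by (simp add: is_yd_mor_def)
  also have "\<dots> = (kron f g * twist_mat a b X Y) $$ (r, c)"
    by (rule kron_mult_twist_mat_index[where a = a and b = b, OF fc gc rc t_def ydD(2)[OF X abt(1)] ydD(2)[OF Y abt(2)], symmetric])
  finally show "(twist_mat a b X' Y' * kron f g) $$ (r, c) = (kron f g * twist_mat a b X Y) $$ (r, c)" .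
qed (use f g in \<open>auto simp: twist_mat_def kron_def is_yd_mor_def\<close>)

text \<open>The first twist carries the degrees t to their conjugates by a(t) and b(t), where a' and
  b' return the inverse elements.\<close>

lemma twist_mat_inverse:
  assumes X: "is_yd G X" and Y: "is_yd G Y" and a: "equivariant a" and b: "equivariant b"
    and a': "\<And>t. t \<in> carrier G \<times> carrier G \<Longrightarrow> a' (conj_by (a t) (fst t), conj_by (b t) (snd t)) = inv (a t)"
    and b': "\<And>t. t \<in> carrier G \<times> carrier G \<Longrightarrow> b' (conj_by (a t) (fst t), conj_by (b t) (snd t)) = inv (b t)"
  shows "twist_mat a' b' X Y * twist_mat a b X Y = 1\<^sub>m (ydim X * ydim Y)"
proof (rule eq_matI)
  note RX = ydD(2)[OF X] and RY = ydD(2)[OF Y]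
  fix r c assume "r < dim_row (1\<^sub>m (ydim X * ydim Y) :: complex mat)" "c < dim_col (1\<^sub>m (ydim X * ydim Y) :: complex mat)"
  then have rc: "r < ydim X * ydim Y" "c < ydim X * ydim Y" by auto
  note c = div_mod_less[OF rc(2)] and r = div_mod_less[OF rc(1)]
  define t where "t = (ydeg X (c div ydim Y), ydeg Y (c mod ydim Y))"
  have tG: "t \<in> carrier G \<times> carrier G" using ydD(1)[OF X c(1)] ydD(1)[OF Y c(2)] by (simp add: t_def)
  have abt: "a t \<in> carrier G" "b t \<in> carrier G" using equivariantD(1)[OF a tG] equivariantD(1)[OF b tG] by auto
  have "(twist_mat a' b' X Y * twist_mat a b X Y) $$ (r, c) =
    (yact X (inv (a t)) * yact X (a t)) $$ (r div ydim Y, c div ydim Y) *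
    (yact Y (inv (b t)) * yact Y (b t)) $$ (r mod ydim Y, c mod ydim Y)"
  proof (rule twist_mat_mult_index[OF twist_mat_carrier rc _ RX[OF abt(1)] c(1) RY[OF abt(2)] c(2)])
    fix i j assume ij: "i < ydim X" "j < ydim Y"
      and nz: "yact X (a t) $$ (i, c div ydim Y) \<noteq> 0" "yact Y (b t) $$ (j, c mod ydim Y) \<noteq> 0"
    have "(ydeg X i, ydeg Y j) = (conj_by (a t) (fst t), conj_by (b t) (snd t))"
      using ydD(5)[OF X abt(1) ij(1) c(1) nz(1)] ydD(5)[OF Y abt(2) ij(2) c(2) nz(2)] by (simp add: t_def)
    then show "a' (ydeg X i, ydeg Y j) = inv (a t) \<and> b' (ydeg X i, ydeg Y j) = inv (b t)"
      using a'[OF tG] b'[OF tG] by simp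
  qed (use abt RX RY rc in \<open>auto simp: twist_mat_index t_def\<close>)
  also have "yact X (inv (a t)) * yact X (a t) = 1\<^sub>m (ydim X)"
    using ydD(4)[OF X, of "inv (a t)" "a t"] ydD(3)[OF X] abt by simp
  also have "yact Y (inv (b t)) * yact Y (b t) = 1\<^sub>m (ydim Y)"
    using ydD(4)[OF Y, of "inv (b t)" "b t"] ydD(3)[OF Y] abt by simp
  also have "1\<^sub>m (ydim X) $$ (r div ydim Y, c div ydim Y) * 1\<^sub>m (ydim Y) $$ (r mod ydim Y, c mod ydim Y) =
      (1\<^sub>m (ydim X * ydim Y) $$ (r, c) :: complex)"
  proof -
    have "r = c \<longleftrightarrow> r div ydim Y = c div ydim Y \<and> r mod ydim Y = c mod ydim Y" by (metis div_mult_mod_eq)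
    then show ?thesis using r c rc by auto
  qed
  finally show "(twist_mat a' b' X Y * twist_mat a b X Y) $$ (r, c) = 1\<^sub>m (ydim X * ydim Y) $$ (r, c)" .
qed (auto simp: twist_mat_def)

lemma tau_tensor_twist_mat_iso:
  assumes X: "is_yd G X" and Y: "is_yd G Y"
    and r: "\<And>x. x \<in> carrier G \<Longrightarrow> x [^] (r::int) = x [^] (n::nat)"
    and a: "equivariant a" and b: "equivariant b" and a': "equivariant a'" and b': "equivariant b'"
    and ab: "\<And>t. t \<in> carrier G \<times> carrier G \<Longrightarrow>
      (conj_by (a t) (fst t) \<otimes> conj_by (b t) (snd t)) [^] n = fst t [^] n \<otimes> snd t [^] n"
    and ab': "\<And>s. s \<in> carrier G \<times> carrier G \<Longrightarrow>
      (fst s \<otimes> snd s) [^] n = conj_by (a' s) (fst s) [^] n \<otimes> conj_by (b' s) (snd s) [^] n"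
    and inv1: "\<And>t. t \<in> carrier G \<times> carrier G \<Longrightarrow> a' (conj_by (a t) (fst t), conj_by (b t) (snd t)) = inv (a t)"
      "\<And>t. t \<in> carrier G \<times> carrier G \<Longrightarrow> b' (conj_by (a t) (fst t), conj_by (b t) (snd t)) = inv (b t)"
    and inv2: "\<And>t. t \<in> carrier G \<times> carrier G \<Longrightarrow> a (conj_by (a' t) (fst t), conj_by (b' t) (snd t)) = inv (a' t)"
      "\<And>t. t \<in> carrier G \<times> carrier G \<Longrightarrow> b (conj_by (a' t) (fst t), conj_by (b' t) (snd t)) = inv (b' t)"
  shows "is_yd_iso G (yd_tensor G (yd_tau G r X) (yd_tau G r Y)) (yd_tau G r (yd_tensor G X Y)) (twist_mat a b X Y)"
proof -
  let ?S = "yd_tensor G (yd_tau G r X) (yd_tau G r Y)" and ?T = "yd_tau G r (yd_tensor G X Y)"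
  have dims: "ydim ?S = ydim X * ydim Y" "ydim ?T = ydim X * ydim Y"
    "yact ?S = (\<lambda>g. kron (yact X g) (yact Y g))" "yact ?T = (\<lambda>g. kron (yact X g) (yact Y g))"
    by (simp_all add: yd_tensor_def)
  have degs: "ydeg ?S c = ydeg X (c div ydim Y) [^] n \<otimes> ydeg Y (c mod ydim Y) [^] n"
    "ydeg ?T c = (ydeg X (c div ydim Y) \<otimes> ydeg Y (c mod ydim Y)) [^] n" if "c < ydim X * ydim Y" for c
    using ydD(1)[OF X] ydD(1)[OF Y] div_mod_less[OF that] by (simp_all add: yd_tensor_def r)
  \<comment> \<open>A nonzero entry forces the degrees of its row to be the conjugates of those of
    its column. With this the grading condition becomes the hypothesis on n-th powers.\<close>
  have conj: "ydeg X (p div ydim Y) = conj_by (u t) (fst t) \<and> ydeg Y (p mod ydim Y) = conj_by (v t) (snd t)"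
    if "equivariant u" "equivariant v" "p < ydim X * ydim Y" "c < ydim X * ydim Y" "twist_mat u v X Y $$ (p, c) \<noteq> 0"
      "t = (ydeg X (c div ydim Y), ydeg Y (c mod ydim Y))" for u v p c t
  proof -
    note pq = div_mod_less[OF that(3)] and cc = div_mod_less[OF that(4)]
    have tG: "t \<in> carrier G \<times> carrier G" using ydD(1)[OF X cc(1)] ydD(1)[OF Y cc(2)] that(6) by simp
    have "yact X (u t) $$ (p div ydim Y, c div ydim Y) \<noteq> 0" "yact Y (v t) $$ (p mod ydim Y, c mod ydim Y) \<noteq> 0"
      using that(5,6) unfolding twist_mat_index[OF that(3,4)] by auto
    then show ?thesis
      using ydD(5)[OF X equivariantD(1)[OF that(1) tG] pq(1) cc(1)] ydD(5)[OF Y equivariantD(1)[OF that(2) tG] pq(2) cc(2)] that(6)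
      by simp
  qed
  have tG: "(ydeg X (c div ydim Y), ydeg Y (c mod ydim Y)) \<in> carrier G \<times> carrier G" if "c < ydim X * ydim Y" for c
    using ydD(1)[OF X] ydD(1)[OF Y] div_mod_less[OF that] by simp
  have "is_yd_mor G ?S ?T (twist_mat a b X Y)"
    unfolding is_yd_mor_def dims
  proof (intro conjI ballI allI impI)
    fix p c assume pc: "p < ydim X * ydim Y" "c < ydim X * ydim Y" "twist_mat a b X Y $$ (p, c) \<noteq> 0"
    show "ydeg ?T p = ydeg ?S c"
      unfolding degs[OF pc(1)] degs[OF pc(2)] using conj[OF a b pc refl] ab[OF tG[OF pc(2)]] by simp
  qed (use twist_mat_act[OF X Y a b] in auto)
  moreover have "is_yd_mor G ?T ?S (twist_mat a' b' X Y)"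
    unfolding is_yd_mor_def dims
  proof (intro conjI ballI allI impI)
    fix p c assume pc: "p < ydim X * ydim Y" "c < ydim X * ydim Y" "twist_mat a' b' X Y $$ (p, c) \<noteq> 0"
    show "ydeg ?S p = ydeg ?T c"
      unfolding degs[OF pc(1)] degs[OF pc(2)] using conj[OF a' b' pc refl] ab'[OF tG[OF pc(2)]] by simp
  qed (use twist_mat_act[OF X Y a' b'] in auto)
  ultimately show ?thesis
    unfolding is_yd_iso_def dims
    using twist_mat_inverse[OF X Y a b inv1] twist_mat_inverse[OF X Y a' b' inv2] by blast
qed

lemma tau_quasitensor:
  assumes fin: "finite (carrier G)" and n: "n > 0" "\<And>q. prime q \<Longrightarrow> q dvd n \<Longrightarrow> q > order G ^ 2"
    and r: "\<And>x. x \<in> carrier G \<Longrightarrow> x [^] (r::int) = x [^] n"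
  shows "\<exists>\<phi>. (\<forall>X Y. is_yd G X \<and> is_yd G Y \<longrightarrow>
            is_yd_iso G (yd_tensor G (yd_tau G r X) (yd_tau G r Y)) (yd_tau G r (yd_tensor G X Y)) (\<phi> X Y))
         \<and> (\<forall>X X' Y Y' f g. is_yd G X \<and> is_yd G X' \<and> is_yd G Y \<and> is_yd G Y' \<and>
              is_yd_mor G X X' f \<and> is_yd_mor G Y Y' g \<longrightarrow> \<phi> X' Y' * kron f g = kron f g * \<phi> X Y)"
proof -
  let ?GG = "carrier G \<times> carrier G"
  obtain a b :: "'a \<times> 'a \<Rightarrow> 'a" where eqa: "equivariant a" "equivariant b"
    and bij: "bij_betw (\<lambda>t. (conj_by (a t) (fst t), conj_by (b t) (snd t))) ?GG ?GG"
    and ab: "\<forall>t\<in>?GG. (conj_by (a t) (fst t) \<otimes> conj_by (b t) (snd t)) [^] n = fst t [^] n \<otimes> snd t [^] n"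
    using power_mult_matching[OF fin n] by blast
  note cl = equivariantD(1)[OF eqa(1)] equivariantD(1)[OF eqa(2)]
  note eq = equivariantD(2)[OF eqa(1)] equivariantD(2)[OF eqa(2)]
  define P where "P = (\<lambda>t. (conj_by (a t) (fst t), conj_by (b t) (snd t)))"
  \<comment> \<open>The inverse permutation of pairs. It inherits equivariance, and its conjugators
    are the inverses of those at the preimage.\<close>
  define R where "R = inv_into ?GG P"
  have bijP: "bij_betw P ?GG ?GG" using bij by (simp add: P_def)
  have RP: "R (P t) = t" if "t \<in> ?GG" for t
    using bijP that unfolding R_def bij_betw_def by (simp add: inv_into_f_f)
  have PR: "P (R s) = s" and RG: "R s \<in> ?GG" if "s \<in> ?GG" for s
    using bijP that unfolding R_def bij_betw_def by (auto intro: f_inv_into_f inv_into_into)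
  have Pact: "P (act g t) = act g (P t)" if t: "t \<in> ?GG" and g: "g \<in> carrier G" for t g
  proof -
    have "fst t \<in> carrier G" "snd t \<in> carrier G" using t by auto
    then show ?thesis unfolding P_def eq[OF t g] using cl[OF t] g by (simp add: act_def conj_by_conj_by del: conj_conj)
  qed
  have Ract: "R (act g s) = act g (R s)" if s: "s \<in> ?GG" and g: "g \<in> carrier G" for s g
    using RP[of "act g (R s)"] Pact[OF RG[OF s] g] PR[OF s] RG[OF s] g by (simp only: act_closed)
  have PR': "fst s = conj_by (a (R s)) (fst (R s))" "snd s = conj_by (b (R s)) (snd (R s))" if "s \<in> ?GG" for s
    using sym[OF arg_cong[OF PR[OF that], of fst]] sym[OF arg_cong[OF PR[OF that], of snd]]
    unfolding P_def fst_conv snd_conv .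
  define a' where "a' = (\<lambda>s. inv (a (R s)))"
  define b' where "b' = (\<lambda>s. inv (b (R s)))"
  have equivI: "equivariant c" if "\<And>t. t \<in> ?GG \<Longrightarrow> c t \<in> carrier G"
    "\<And>t g. t \<in> ?GG \<Longrightarrow> g \<in> carrier G \<Longrightarrow> c (act g t) = conj_by g (c t)" for c
    unfolding equivariant_def by (intro ballI conjI that)
  have eqa': "equivariant a'" "equivariant b'"
    using cl eq RG Ract conj_by_inv by (intro equivI; simp add: a'_def b'_def)+
  have inv1: "a' (conj_by (a t) (fst t), conj_by (b t) (snd t)) = inv (a t)"
    "b' (conj_by (a t) (fst t), conj_by (b t) (snd t)) = inv (b t)" if "t \<in> ?GG" for t
    using RP[OF that] by (simp_all add: a'_def b'_def P_def)
  have R: "(conj_by (a' s) (fst s), conj_by (b' s) (snd s)) = R s" if s: "s \<in> ?GG" for s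
  proof -
    have "fst (R s) \<in> carrier G" "snd (R s) \<in> carrier G" using RG[OF s] by auto
    moreover note PR'[OF s]
    ultimately show ?thesis using cl[OF RG[OF s]] unfolding a'_def b'_def by (simp add: conj_inv_conj)
  qed
  have inv2: "a (conj_by (a' t) (fst t), conj_by (b' t) (snd t)) = inv (a' t)"
    "b (conj_by (a' t) (fst t), conj_by (b' t) (snd t)) = inv (b' t)" if "t \<in> ?GG" for t
    unfolding R[OF that] using cl[OF RG[OF that]] by (simp_all add: a'_def b'_def)
  have ab': "(fst s \<otimes> snd s) [^] n = conj_by (a' s) (fst s) [^] n \<otimes> conj_by (b' s) (snd s) [^] n" if s: "s \<in> ?GG" for s
  proof -
    have "conj_by (a' s) (fst s) = fst (R s)" "conj_by (b' s) (snd s) = snd (R s)" 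
      using arg_cong[OF R[OF s], of fst] arg_cong[OF R[OF s], of snd] unfolding fst_conv snd_conv .
    moreover note PR'[OF s]
    ultimately show ?thesis using bspec[OF ab RG[OF s]] by simp
  qed
  show ?thesis
  proof (intro exI[of _ "twist_mat a b"] conjI allI impI)
    fix X Y assume "is_yd G X \<and> is_yd G Y"
    then have "is_yd G X" "is_yd G Y" by simp_all
    then show "is_yd_iso G (yd_tensor G (yd_tau G r X) (yd_tau G r Y)) (yd_tau G r (yd_tensor G X Y)) (twist_mat a b X Y)"
      using r eqa eqa' bspec[OF ab] ab' inv1 inv2 by (rule tau_tensor_twist_mat_iso)
  next
    fix X X' Y Y' f g
    assume "is_yd G X \<and> is_yd G X' \<and> is_yd G Y \<and> is_yd G Y' \<and> is_yd_mor G X X' f \<and> is_yd_mor G Y Y' g"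
    then show "twist_mat a b X' Y' * kron f g = kron f g * twist_mat a b X Y"
      using twist_mat_natural[OF _ _ _ _ eqa] by blast
  qed
qed

end

subsection \<open>Frobenius--Schur indicators\<close>

context group
begin

text \<open>Each g is pushed to the right by g P_z = P_(g z g^-1) g; neighbouring projections then
  multiply to zero unless their degrees agree. The \<open>Suc d\<close> factors leave d
  conditions.\<close>

lemma foldr_proj_act:
  assumes X: "is_yd G X" and g: "g \<in> carrier G" and z: "\<And>i. j \<le> i \<Longrightarrow> i < j + Suc d \<Longrightarrow> z i \<in> carrier G"
  shows "foldr (\<lambda>i A. (yd_proj X (z i) * yact X g) * A) [j..<j + Suc d] (1\<^sub>m (ydim X)) =
    (if \<forall>i. j \<le> i \<and> i < j + d \<longrightarrow> z i = conj_by g (z (Suc i))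
     then yd_proj X (z j) * yact X (g [^] Suc d) else 0\<^sub>m (ydim X) (ydim X))"
  using z
proof (induction d arbitrary: j)
  case 0
  have "yd_proj X (z j) * yact X g \<in> carrier_mat (ydim X) (ydim X)"
    using ydD(2)[OF X g] by (intro mult_carrier_mat[of _ _ "ydim X"]) auto
  then have "yd_proj X (z j) * yact X g * 1\<^sub>m (ydim X) = yd_proj X (z j) * yact X g"
    by (rule right_mult_one_mat)
  then show ?case using g by auto
next
  case (Suc d)
  let ?n = "ydim X" and ?F = "\<lambda>i A. (yd_proj X (z i) * yact X g) * A"
  let ?c = "\<lambda>j d. \<forall>i. j \<le> i \<and> i < j + d \<longrightarrow> z i = conj_by g (z (Suc i))"
  have zj: "z j \<in> carrier G" "z (Suc j) \<in> carrier G" using Suc.prems by auto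
  have P: "yd_proj X (z i) \<in> carrier_mat ?n ?n" for i by simp
  note R = ydD(2)[OF X]
  have Rd: "yact X (g [^] Suc d) \<in> carrier_mat ?n ?n" using R g by simp
  have PR: "yd_proj X (z j) * yact X g \<in> carrier_mat ?n ?n" using P R[OF g] by (rule mult_carrier_mat)
  have "[j..<j + Suc (Suc d)] = j # [Suc j..<Suc j + Suc d]" by (simp add: upt_conv_Cons del: upt_Suc)
  then have "foldr ?F [j..<j + Suc (Suc d)] (1\<^sub>m ?n) = ?F j (foldr ?F [Suc j..<Suc j + Suc d] (1\<^sub>m ?n))"
    by simp
  also have "foldr ?F [Suc j..<Suc j + Suc d] (1\<^sub>m ?n) =
    (if ?c (Suc j) d then yd_proj X (z (Suc j)) * yact X (g [^] Suc d) else 0\<^sub>m ?n ?n)"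
    by (rule Suc.IH) (use Suc.prems in auto)
  also have "?F j \<dots> = (if ?c j (Suc d) then yd_proj X (z j) * yact X (g [^] Suc (Suc d)) else 0\<^sub>m ?n ?n)"
  proof (cases "?c (Suc j) d")
    case True
    have c: "?c j (Suc d) \<longleftrightarrow> z j = conj_by g (z (Suc j))"
    proof
      assume zz: "z j = conj_by g (z (Suc j))"
      show "?c j (Suc d)"
      proof (intro allI impI)
        fix i assume "j \<le> i \<and> i < j + Suc d"
        then show "z i = conj_by g (z (Suc i))" using zz True by (cases "i = j") auto
      qed
    qed auto
    have "(yd_proj X (z j) * yact X g) * (yd_proj X (z (Suc j)) * yact X (g [^] Suc d)) =
      yd_proj X (z j) * (yact X g * (yd_proj X (z (Suc j)) * yact X (g [^] Suc d)))"
      by (rule assoc_mult_mat[OF P R[OF g] mult_carrier_mat[OF P Rd]])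
    also have "yact X g * (yd_proj X (z (Suc j)) * yact X (g [^] Suc d)) =
      yact X g * yd_proj X (z (Suc j)) * yact X (g [^] Suc d)"
      by (rule assoc_mult_mat[OF R[OF g] P Rd, symmetric])
    also have "\<dots> = yd_proj X (conj_by g (z (Suc j))) * (yact X g * yact X (g [^] Suc d))"
      unfolding act_proj[OF X g zj(2)] by (rule assoc_mult_mat[OF proj_carrier R[OF g] Rd])
    also have "yact X g * yact X (g [^] Suc d) = yact X (g [^] Suc (Suc d))"
      using ydD(4)[OF X g, of "g [^] Suc d"] g nat_pow_Suc2[OF g, of "Suc d"] by simp
    also have "yd_proj X (z j) * (yd_proj X (conj_by g (z (Suc j))) * yact X (g [^] Suc (Suc d))) =
      yd_proj X (z j) * yd_proj X (conj_by g (z (Suc j))) * yact X (g [^] Suc (Suc d))"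
      using g by (intro assoc_mult_mat[OF proj_carrier proj_carrier R, symmetric]) simp
    also have "\<dots> = (if z j = conj_by g (z (Suc j)) then yd_proj X (z j) * yact X (g [^] Suc (Suc d)) else 0\<^sub>m ?n ?n)"
    proof -
      have "0\<^sub>m ?n ?n * yact X (g [^] Suc (Suc d)) = 0\<^sub>m ?n ?n"
        by (rule left_mult_zero_mat) (use R g in simp)
      then show ?thesis unfolding proj_proj by simp
    qed
    finally show ?thesis using True c by simp
  next
    case False
    have nc: "\<not> ?c j (Suc d)"
    proof
      assume c: "?c j (Suc d)"
      have "?c (Suc j) d"
      proof (intro allI impI)
        fix i assume "Suc j \<le> i \<and> i < Suc j + d"
        then have "j \<le> i \<and> i < j + Suc d" by simp
        then show "z i = conj_by g (z (Suc i))" using c by blast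
      qed
      then show False using False by blast
    qed
    show ?thesis unfolding if_not_P[OF False] if_not_P[OF nc] by (rule right_mult_zero_mat[OF PR])
  qed
  finally show ?case .
qed

lemma trace_foldr_proj_act:
  assumes X: "is_yd G X" and g: "g \<in> carrier G" and z: "\<And>i. i < Suc d \<Longrightarrow> z i \<in> carrier G"
  shows "mat_trace (foldr (\<lambda>i A. (yd_proj X (z i) * yact X g) * A) [0..<Suc d] (1\<^sub>m (ydim X))) =
    (if \<forall>i<d. z i = conj_by g (z (Suc i)) then chi X (z 0) (g [^] Suc d) else 0)"
proof -
  have 0: "mat_trace (0\<^sub>m (ydim X) (ydim X)) = 0" by (simp add: mat_trace_def)
  have F: "foldr (\<lambda>i A. (yd_proj X (z i) * yact X g) * A) [0..<Suc d] (1\<^sub>m (ydim X)) =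
    (if \<forall>i<d. z i = conj_by g (z (Suc i)) then yd_proj X (z 0) * yact X (g [^] Suc d) else 0\<^sub>m (ydim X) (ydim X))"
    using foldr_proj_act[OF X g, of 0 d z] z by (simp del: upt_Suc nat_pow_Suc)
  have "chi X (z 0) (g [^] Suc d) = mat_trace (yd_proj X (z 0) * yact X (g [^] Suc d))"
    using g by (intro chi_eq_trace[OF X]) simp
  then show ?thesis unfolding F using 0 by (simp only: if_distrib[of mat_trace])
qed

lemma gprod_list_lprod: "gprod_list G k y = lprod G (map y [0..<k])"
  by (simp add: gprod_list_def lprod_def foldr_map comp_def)

text \<open>The factors form the chain y_i = h y_(i+1) h^-1 that starts at y_0 = u h; the powers of
  h between neighbouring copies of u cancel.\<close>

lemma lprod_telescope:
  assumes u: "u \<in> carrier G" and h: "h \<in> carrier G"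
  shows "lprod G (map (\<lambda>i. inv h [^] i \<otimes> u \<otimes> h [^] Suc i) [0..<k]) = u [^] k \<otimes> h [^] (k::nat)"
proof (induction k)
  case (Suc k)
  have c: "h [^] k \<otimes> inv h [^] k = \<one>" using h by (simp add: nat_pow_inv)
  have "lprod G (map (\<lambda>i. inv h [^] i \<otimes> u \<otimes> h [^] Suc i) [0..<Suc k]) =
    lprod G (map (\<lambda>i. inv h [^] i \<otimes> u \<otimes> h [^] Suc i) [0..<k]) \<otimes> (inv h [^] k \<otimes> u \<otimes> h [^] Suc k)"
    using u h by (simp add: lprod_append image_subset_iff)
  also have "\<dots> = u [^] k \<otimes> (h [^] k \<otimes> inv h [^] k) \<otimes> u \<otimes> h [^] Suc k"
    unfolding Suc.IH using u h by (simp add: m_assoc del: nat_pow_Suc)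
  also have "\<dots> = u [^] Suc k \<otimes> h [^] Suc k" unfolding c using u by simp
  finally show ?case .
qed simp

lemma sum_chain_tuples:
  fixes f :: "'a \<Rightarrow> complex" and d :: nat
  assumes fin: "finite (carrier G)" and h: "h \<in> carrier G"
  defines "k \<equiv> Suc d"
  shows "(\<Sum>y | y \<in> {0..<k} \<rightarrow>\<^sub>E carrier G \<and> gprod_list G k y = \<one>.
      if \<forall>i<d. y i = conj_by h (y (Suc i)) then f (y 0) else 0) =
    (\<Sum>u | u \<in> carrier G \<and> u [^] k \<otimes> h [^] k = \<one>. f (u \<otimes> h))"
proof -
  \<comment> \<open>The chain with first member u h, made extensional by \<open>restrict\<close> so
    that it lies in the function space of tuples.\<close>
  define T where "T u = restrict (\<lambda>i. inv h [^] i \<otimes> u \<otimes> h [^] Suc i) {0..<k}" for u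
  define A where "A = {y. y \<in> {0..<k} \<rightarrow>\<^sub>E carrier G \<and> gprod_list G k y = \<one>}"
  have finA: "finite A" unfolding A_def using fin
    by (intro finite_subset[OF _ finite_PiE[of "{0..<k}" "\<lambda>_. carrier G"]]) auto
  have gT: "gprod_list G k (T u) = u [^] k \<otimes> h [^] k" if u: "u \<in> carrier G" for u
  proof -
    have "map (T u) [0..<k] = map (\<lambda>i. inv h [^] i \<otimes> u \<otimes> h [^] Suc i) [0..<k]"
      by (simp add: T_def)
    then show ?thesis unfolding gprod_list_lprod using lprod_telescope[OF u h, of k] by (simp only:)
  qed
  have T0: "T u 0 = u \<otimes> h" if "u \<in> carrier G" for u using that h by (simp add: T_def k_def)
  have Tchain: "T u i = conj_by h (T u (Suc i))" if u: "u \<in> carrier G" and i: "i < d" for u i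
  proof -
    define a where "a = inv h [^] i"
    define b where "b = h [^] Suc i"
    have ab: "a \<in> carrier G" "b \<in> carrier G" using h by (auto simp: a_def b_def)
    have "T u (Suc i) = inv h \<otimes> a \<otimes> u \<otimes> (b \<otimes> h)"
      using i h nat_pow_Suc2[of "inv h" i] by (simp add: T_def k_def a_def b_def)
    moreover have "T u i = a \<otimes> u \<otimes> b" using i by (simp add: T_def k_def a_def b_def)
    moreover have "conj_by h (inv h \<otimes> a \<otimes> u \<otimes> (b \<otimes> h)) = a \<otimes> u \<otimes> b"
    proof -
      have "h \<otimes> (inv h \<otimes> a \<otimes> u \<otimes> (b \<otimes> h)) \<otimes> inv h = (h \<otimes> inv h) \<otimes> (a \<otimes> u \<otimes> b) \<otimes> (h \<otimes> inv h)"
        using ab u h by (simp only: m_assoc m_closed inv_closed)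
      then show ?thesis using ab u h by (simp add: conj_by_def)
    qed
    ultimately show ?thesis by simp
  qed
  have yT: "y = T (y 0 \<otimes> inv h)" if y: "y \<in> {0..<k} \<rightarrow>\<^sub>E carrier G" and c: "\<forall>i<d. y i = conj_by h (y (Suc i))" for y
  proof
    fix i
    have y0: "y 0 \<in> carrier G" using y by (auto simp: k_def PiE_iff)
    have "y i = T (y 0 \<otimes> inv h) i" if "i < k" for i
      using that
    proof (induction i)
      case 0
      then show ?case using T0[of "y 0 \<otimes> inv h"] y0 h by (simp add: m_assoc)
    next
      case (Suc i)
      then have i: "i < d" by (simp add: k_def)
      have e: "conj_by h (y (Suc i)) = conj_by h (T (y 0 \<otimes> inv h) (Suc i))"
        using c i Suc Tchain[of "y 0 \<otimes> inv h" i] y0 h by simp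
      have "y (Suc i) \<in> carrier G" using y Suc.prems by auto
      moreover have "T (y 0 \<otimes> inv h) (Suc i) \<in> carrier G" using Suc.prems y0 h by (simp add: T_def)
      ultimately show ?case using e by (rule conj_inj[OF h])
    qed
    moreover have "y i = undefined" if "\<not> i < k" using PiE_arb[OF y] that by simp
    moreover have "T (y 0 \<otimes> inv h) i = undefined" if "\<not> i < k" using that by (simp add: T_def)
    ultimately show "y i = T (y 0 \<otimes> inv h) i" by metis
  qed
  have "(\<Sum>y\<in>A. if \<forall>i<d. y i = conj_by h (y (Suc i)) then f (y 0) else 0) =
    (\<Sum>y\<in>{y \<in> A. \<forall>i<d. y i = conj_by h (y (Suc i))}. f (y 0))"
    using finA by (simp add: sum.inter_filter)
  also have "\<dots> = (\<Sum>u | u \<in> carrier G \<and> u [^] k \<otimes> h [^] k = \<one>. f (u \<otimes> h))"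
  proof (rule sum.reindex_bij_witness[where i = T and j = "\<lambda>y. y 0 \<otimes> inv h"])
    fix y assume "y \<in> {y \<in> A. \<forall>i<d. y i = conj_by h (y (Suc i))}"
    then have y: "y \<in> {0..<k} \<rightarrow>\<^sub>E carrier G" "gprod_list G k y = \<one>" and c: "\<forall>i<d. y i = conj_by h (y (Suc i))"
      by (auto simp: A_def)
    have y0: "y 0 \<in> carrier G" using y by (auto simp: k_def PiE_iff)
    show e: "T (y 0 \<otimes> inv h) = y" by (rule sym[OF yT[OF y(1) c]])
    show "y 0 \<otimes> inv h \<in> {u \<in> carrier G. u [^] k \<otimes> h [^] k = \<one>}"
      using gT[of "y 0 \<otimes> inv h", unfolded e] y(2) y0 h by simp
    show "f (y 0 \<otimes> inv h \<otimes> h) = f (y 0)" using y0 h by (simp add: m_assoc)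
  next
    fix u assume "u \<in> {u \<in> carrier G. u [^] k \<otimes> h [^] k = \<one>}"
    then have u: "u \<in> carrier G" "u [^] k \<otimes> h [^] k = \<one>" by auto
    show "T u 0 \<otimes> inv h = u" using T0[OF u(1)] u h by (simp add: m_assoc)
    have "T u \<in> {0..<k} \<rightarrow>\<^sub>E carrier G" unfolding T_def using u h by auto
    then show "T u \<in> {y \<in> A. \<forall>i<d. y i = conj_by h (y (Suc i))}"
      using gT[OF u(1)] u(2) Tchain[OF u(1)] by (simp add: A_def)
  qed
  finally show ?thesis unfolding A_def .
qed

text \<open>A product of projections and actions vanishes unless its degrees form a chain determined by
  the first one, which is written \<open>u h\<close>; the telescoping product of the chain is \<open>u\<^sup>m h\<^sup>m\<close>.\<close>
lemma FS_ind_eq: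
  assumes fin: "finite (carrier G)" and V: "is_yd G V"
  shows "FS_ind G m V = 1 / of_nat (order G) *
    (\<Sum>h\<in>carrier G. \<Sum>u | u \<in> carrier G \<and> u [^] m \<otimes> h [^] m = \<one>. chi V (u \<otimes> h) (h [^] m))"
proof -
  define tup where "tup k = {y. y \<in> {0..<k} \<rightarrow>\<^sub>E carrier G \<and> gprod_list G k y = \<one>}" for k
  have tup: "{y \<in> {0..<k} \<rightarrow>\<^sub>E carrier G. gprod_list G k y = \<one>} = tup k" for k
    by (auto simp: tup_def)
  have tupG: "y i \<in> carrier G" if "y \<in> tup k" "i < k" for y i k using that by (auto simp: tup_def PiE_iff)
  \<comment> \<open>Zero is separate because the chain argument needs at least one factor.\<close>
  consider (zero) "m = 0" | (pos) d where "m = int (Suc d)" | (neg) d where "m = - int (Suc d)"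
    by (metis int_cases int_cases3 not0_implies_Suc of_nat_0 nat_int zero_less_imp_eq_int neq0_conv)
  then show ?thesis
  proof cases
    case zero
    have "tup 0 = {\<lambda>_. undefined}" by (auto simp: tup_def gprod_list_def)
    then have "FS_ind G m V = 1 / of_nat (order G) * (\<Sum>h\<in>carrier G. of_nat (ydim V))"
      unfolding FS_ind_def zero by (simp add: tup Coset.order_def mat_trace_def)
    moreover have "(\<Sum>u\<in>carrier G. chi V (u \<otimes> h) \<one>) = of_nat (ydim V)" if h: "h \<in> carrier G" for h
    proof -
      have "(\<Sum>u\<in>carrier G. chi V (u \<otimes> h) \<one>) = (\<Sum>w\<in>carrier G. chi V w \<one>)"
        by (rule sum.reindex_bij_witness[where i = "\<lambda>w. w \<otimes> inv h" and j = "\<lambda>u. u \<otimes> h"])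
          (use h in \<open>auto simp: m_assoc\<close>)
      also have "\<dots> = (\<Sum>w\<in>carrier G. \<Sum>i\<in>{i \<in> {..<ydim V}. ydeg V i = w}. 1)"
        unfolding chi_def ydD(3)[OF V] by (intro sum.cong refl) auto
      also have "\<dots> = (\<Sum>i<ydim V. 1)"
        using fin ydD(1)[OF V] by (intro sum.group) auto
      finally show ?thesis by simp
    qed
    ultimately show ?thesis by (simp add: zero)
  next
    case (pos d)
    let ?k = "Suc d"
    have k: "nat \<bar>m\<bar> = ?k" "m \<ge> 0" using pos by auto
    have "(\<Sum>y\<in>tup ?k. mat_trace (foldr (\<lambda>i A. (yd_proj V (y i) * yact V h) * A) [0..<?k] (1\<^sub>m (ydim V)))) =
      (\<Sum>u | u \<in> carrier G \<and> u [^] m \<otimes> h [^] m = \<one>. chi V (u \<otimes> h) (h [^] m))" if h: "h \<in> carrier G" for h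
    proof -
      have "(\<Sum>y\<in>tup ?k. mat_trace (foldr (\<lambda>i A. (yd_proj V (y i) * yact V h) * A) [0..<?k] (1\<^sub>m (ydim V)))) =
        (\<Sum>y\<in>tup ?k. if \<forall>i<d. y i = conj_by h (y (Suc i)) then chi V (y 0) (h [^] ?k) else 0)"
        by (intro sum.cong refl trace_foldr_proj_act[OF V h] tupG)
      also have "\<dots> = (\<Sum>u | u \<in> carrier G \<and> u [^] ?k \<otimes> h [^] ?k = \<one>. chi V (u \<otimes> h) (h [^] ?k))"
        unfolding tup_def by (rule sum_chain_tuples[OF fin h])
      finally show ?thesis unfolding pos int_pow_int .
    qed
    then show ?thesis unfolding FS_ind_def Let_def k(1) tup using k(2) by (simp add: Coset.order_def del: upt_Suc)
  next
    case (neg d)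
    let ?k = "Suc d"
    have k: "nat \<bar>m\<bar> = ?k" "\<not> m \<ge> 0" using neg by auto
    have pm: "x [^] m = inv x [^] ?k" if "x \<in> carrier G" for x
      unfolding neg int_pow_neg_int[OF that] by (rule nat_pow_inv[OF that, symmetric])
    have "(\<Sum>y\<in>tup ?k. mat_trace (foldr (\<lambda>i A. (yact V (inv h) * yd_proj V (inv (y i))) * A) [0..<?k] (1\<^sub>m (ydim V)))) =
      (\<Sum>u | u \<in> carrier G \<and> u [^] m \<otimes> h [^] m = \<one>. chi V (u \<otimes> h) (h [^] m))" if h: "h \<in> carrier G" for h
    proof -
      have h': "inv h \<in> carrier G" using h by simp
      have "mat_trace (foldr (\<lambda>i A. (yact V (inv h) * yd_proj V (inv (y i))) * A) [0..<?k] (1\<^sub>m (ydim V))) =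
        (if \<forall>i<d. y i = conj_by (inv h) (y (Suc i)) then chi V (conj_by (inv h) (inv (y 0))) (inv h [^] ?k) else 0)"
        if y: "y \<in> tup ?k" for y
      proof -
        have yG: "y i \<in> carrier G" if "i < ?k" for i using tupG[OF y that] .
        \<comment> \<open>Moving the action past the projection brings the antipode factors into the
          form of the positive case, with \<open>inv h\<close> for h and with conjugated inverse
          degrees.\<close>
        have "foldr (\<lambda>i A. (yact V (inv h) * yd_proj V (inv (y i))) * A) [0..<?k] (1\<^sub>m (ydim V)) =
          foldr (\<lambda>i A. (yd_proj V (conj_by (inv h) (inv (y i))) * yact V (inv h)) * A) [0..<?k] (1\<^sub>m (ydim V))"
          by (rule foldr_cong[OF refl refl]) (use act_proj[OF V h'] yG in auto)
        also have "mat_trace \<dots> = (if \<forall>i<d. conj_by (inv h) (inv (y i)) = conj_by (inv h) (conj_by (inv h) (inv (y (Suc i))))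
            then chi V (conj_by (inv h) (inv (y 0))) (inv h [^] ?k) else 0)"
          by (rule trace_foldr_proj_act[OF V h']) (use yG h in auto)
        also have "(\<forall>i<d. conj_by (inv h) (inv (y i)) = conj_by (inv h) (conj_by (inv h) (inv (y (Suc i))))) \<longleftrightarrow>
          (\<forall>i<d. y i = conj_by (inv h) (y (Suc i)))"
        proof -
          have "conj_by (inv h) (inv a) = conj_by (inv h) (conj_by (inv h) (inv b)) \<longleftrightarrow> a = conj_by (inv h) b"
            if "a \<in> carrier G" "b \<in> carrier G" for a b
          proof
            assume e: "conj_by (inv h) (inv a) = conj_by (inv h) (conj_by (inv h) (inv b))"
            have "inv a = conj_by (inv h) (inv b)" using that h' by (intro conj_inj[OF h' _ _ e]) simp_all
            also have "\<dots> = inv (conj_by (inv h) b)" using conj_by_inv[OF h' that(2)] by simp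
            finally have "inv (inv a) = inv (inv (conj_by (inv h) b))" by simp
            then show "a = conj_by (inv h) b" using that h' by simp
          next
            assume "a = conj_by (inv h) b"
            then show "conj_by (inv h) (inv a) = conj_by (inv h) (conj_by (inv h) (inv b))"
              using conj_by_inv[OF h' that(2)] by simp
          qed
          then show ?thesis using yG by simp
        qed
        finally show ?thesis .
      qed
      then have "(\<Sum>y\<in>tup ?k. mat_trace (foldr (\<lambda>i A. (yact V (inv h) * yd_proj V (inv (y i))) * A) [0..<?k] (1\<^sub>m (ydim V)))) =
        (\<Sum>y\<in>tup ?k. if \<forall>i<d. y i = conj_by (inv h) (y (Suc i)) then chi V (conj_by (inv h) (inv (y 0))) (inv h [^] ?k) else 0)"
        by (intro sum.cong refl)
      also have "\<dots> = (\<Sum>u | u \<in> carrier G \<and> u [^] ?k \<otimes> inv h [^] ?k = \<one>.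
          chi V (conj_by (inv h) (inv (u \<otimes> inv h))) (inv h [^] ?k))"
        unfolding tup_def by (rule sum_chain_tuples[OF fin h'])
      also have "\<dots> = (\<Sum>u | u \<in> carrier G \<and> u [^] m \<otimes> h [^] m = \<one>. chi V (u \<otimes> h) (h [^] m))"
      \<comment> \<open>Inverting u undoes the inversion of degrees: h^-1 (u h^-1)^-1 h = u^-1
        h.\<close>
      proof (rule sum.reindex_bij_witness[where i = "\<lambda>u. inv u" and j = "\<lambda>u. inv u"])
        fix u assume u: "u \<in> {u \<in> carrier G. u [^] ?k \<otimes> inv h [^] ?k = \<one>}"
        have "conj_by (inv h) (inv (u \<otimes> inv h)) = inv u \<otimes> h"
          using u h by (simp add: conj_by_def inv_mult_group m_assoc[symmetric])
        then show "chi V (inv u \<otimes> h) (h [^] m) = chi V (conj_by (inv h) (inv (u \<otimes> inv h))) (inv h [^] ?k)"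
          using pm[OF h] by simp
      qed (use h pm in \<open>auto simp del: nat_pow_Suc\<close>)
      finally show ?thesis .
    qed
    then show ?thesis unfolding FS_ind_def Let_def k(1) tup using k(2) by (simp add: Coset.order_def del: upt_Suc)
  qed
qed

lemma centr_closed_commute:
  fixes m :: int
  assumes "x \<in> carrier G"
  shows "x \<otimes> x [^] m = x [^] m \<otimes> x"
proof -
  have "conj_by x (x [^] m) = x [^] m"
    using conj_int_pow[OF assms assms] assms by (simp add: conj_by_def m_assoc)
  then show ?thesis using conj_by_fixed_iff[OF assms] assms by simp
qed

text \<open>From h^m = g and u^m = g^-1 both u and h commute with g. They range over subsets of the
  centralizer of g that are invariant under it, so the count applies there if y centralizes g;
  otherwise neither equation has a solution.\<close>

lemma card_root_pairs:
  fixes m :: int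
  assumes fin: "finite (carrier G)" and n: "n > 0" "\<And>q. prime q \<Longrightarrow> q dvd n \<Longrightarrow> q > order G ^ 2"
    and g: "g \<in> carrier G" and y: "y \<in> carrier G"
  defines "W \<equiv> {(u, h) \<in> carrier G \<times> carrier G. u [^] m \<otimes> h [^] m = \<one>}"
  shows "card {(u, h) \<in> W. h [^] m = g \<and> u [^] n \<otimes> h [^] n = y [^] n} = card {(u, h) \<in> W. h [^] m = g \<and> u \<otimes> h = y}"
proof -
  define H where "H = centr {g}"
  have H: "subgroup H G" unfolding H_def using g by (intro centr_subgroup) auto
  have HG: "H \<subseteq> carrier G" using H by (rule subgroup.subset)
  define C where "C = {u \<in> H. u [^] m = inv g}"
  define D where "D = {h \<in> H. h [^] m = g}"
  have hH: "h \<in> H" if "h \<in> carrier G" "h [^] m = g" for h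
    using that centr_closed_commute[of h m] by (simp add: H_def centr_def)
  have uH: "u \<in> H" if u: "u \<in> carrier G" "u [^] m = inv g" for u
  proof -
    have "conj_by u (inv g) = inv g"
      using centr_closed_commute[OF u(1), of m] u g conj_by_fixed_iff[of u "inv g"] by simp
    then have "inv (conj_by u (inv g)) = g" using g by simp
    then have "conj_by u g = g" using u g by (simp add: conj_by_def inv_mult_group m_assoc)
    then show ?thesis using conj_by_fixed_iff[OF u(1) g] u by (simp add: H_def centr_def)
  qed
  have W: "(u, h) \<in> W \<and> h [^] m = g \<longleftrightarrow> u \<in> C \<and> h \<in> D" for u h
  proof -
    have "u [^] m \<otimes> g = \<one> \<longleftrightarrow> u [^] m = inv g" if "u \<in> carrier G"
      using that g by (metis inv_equality inv_inv int_pow_closed inv_closed l_inv)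
    then show ?thesis using hH uH HG by (auto simp: W_def C_def D_def)
  qed
  have eq: "{(u, h) \<in> W. h [^] m = g \<and> P u h} = {(u, h) \<in> C \<times> D. P u h}" for P
    using W by auto
  have Cinv: "conj_by x u \<in> C" if "x \<in> H" "u \<in> C" for x u
  proof -
    have xu: "x \<in> carrier G" "u \<in> carrier G" using that HG by (auto simp: C_def)
    have "conj_by x g = g" using that conj_by_fixed_iff[OF xu(1) g] by (simp add: H_def centr_def)
    then have "conj_by x (inv g) = inv g" using conj_int_pow[OF xu(1) g, of "-1"] g by (simp add: int_pow_neg)
    then have "conj_by x u [^] m = inv g" using conj_int_pow[OF xu, of m] that by (simp add: C_def)
    then show ?thesis using uH[of "conj_by x u"] xu by (simp add: C_def)
  qed
  have Dinv: "conj_by x h \<in> D" if "x \<in> H" "h \<in> D" for x h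
  proof -
    have xh: "x \<in> carrier G" "h \<in> carrier G" using that HG by (auto simp: D_def)
    have "conj_by x g = g" using that conj_by_fixed_iff[OF xh(1) g] by (simp add: H_def centr_def)
    then have "conj_by x h [^] m = g" using conj_int_pow[OF xh, of m] that by (simp add: D_def)
    then show ?thesis using hH[of "conj_by x h"] xh by (simp add: D_def)
  qed
  have CDH: "C \<subseteq> H" "D \<subseteq> H" by (auto simp: C_def D_def)
  show ?thesis unfolding eq
  proof (cases "y \<in> H")
    case True
    show "card {(u, h) \<in> C \<times> D. u [^] n \<otimes> h [^] n = y [^] n} = card {(u, h) \<in> C \<times> D. u \<otimes> h = y}"
      using subgroup_card_product_eq_power[OF fin n H CDH(1) Cinv CDH(2) Dinv True] by simp
  next
    case False
    have cop: "coprime n (order G)" using coprime_order_if_large_primes[OF fin n] .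
    have yn: "y [^] n \<notin> H"
    proof
      assume "y [^] n \<in> H"
      then obtain z where z: "z \<in> H" "y [^] n = z [^] n" using subgroup_root[OF fin cop H] by blast
      then have "y = z" using inj_onD[OF pow_inj_on[OF fin cop] z(2)] y HG by blast
      then show False using z False by simp
    qed
    have "u [^] n \<otimes> h [^] n \<noteq> y [^] n" "u \<otimes> h \<noteq> y" if "u \<in> C" "h \<in> D" for u h
    proof -
      have "u \<in> H" "h \<in> H" using that CDH by auto
      then have "u \<otimes> h \<in> H" "u [^] n \<otimes> h [^] n \<in> H"
        by (simp_all add: subgroup.m_closed[OF H] subgroup_nat_pow_closed[OF H])
      then show "u [^] n \<otimes> h [^] n \<noteq> y [^] n" "u \<otimes> h \<noteq> y" using yn False by auto
    qed
    then have "{(u, h) \<in> C \<times> D. u [^] n \<otimes> h [^] n = y [^] n} = {}" "{(u, h) \<in> C \<times> D. u \<otimes> h = y} = {}"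
      by blast+
    then show "card {(u, h) \<in> C \<times> D. u [^] n \<otimes> h [^] n = y [^] n} = card {(u, h) \<in> C \<times> D. u \<otimes> h = y}"
      by (simp only:)
  qed
qed

lemma power_mult_eq_one_iff:
  assumes "finite (carrier G)" "coprime n (order G)" "a \<in> carrier G" "b \<in> carrier G"
  shows "a [^] (n::nat) \<otimes> b [^] n = \<one> \<longleftrightarrow> a \<otimes> b = \<one>"
proof -
  have "x \<otimes> y = \<one> \<longleftrightarrow> x = inv y" if "x \<in> carrier G" "y \<in> carrier G" for x y
    using that by (metis inv_equality l_inv)
  moreover have "a [^] n = inv b [^] n \<longleftrightarrow> a = inv b"
    using inj_on_eq_iff[OF pow_inj_on[OF assms(1,2)]] assms(3,4) by simp
  ultimately show ?thesis using assms(3,4) by (simp add: nat_pow_inv)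
qed

lemma int_pow_nat_pow_commute:
  assumes "x \<in> carrier G"
  shows "(x [^] (m::int)) [^] (n::nat) = (x [^] n) [^] m"
  using assms by (simp add: int_pow_pow mult.commute flip: int_pow_int)

lemma pow_pairs_iff:
  assumes "finite (carrier G)" "coprime n (order G)" "u \<in> carrier G" "h \<in> carrier G"
  shows "(u [^] n) [^] m \<otimes> (h [^] n) [^] m = \<one> \<longleftrightarrow> u [^] m \<otimes> h [^] (m::int) = \<one>"
  using power_mult_eq_one_iff[OF assms(1,2), of "u [^] m" "h [^] m"] assms(3,4)
  by (simp add: int_pow_nat_pow_commute)

text \<open>The second value is the common expression to which \<open>FS_ind_mult\<close> and
  \<open>FS_ind_tau\<close> reduce the other two indicators.\<close>

lemma FS_ind_gal_pair:
  assumes fin: "finite (carrier G)" and n: "n > 0" "coprime n (order G)" and V: "is_yd G V"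
  shows "gal_pair (group_exp G) n (FS_ind G m V)
    (1 / of_nat (order G) * (\<Sum>h\<in>carrier G. \<Sum>u | u \<in> carrier G \<and> u [^] m \<otimes> h [^] m = \<one>.
      chi V (u \<otimes> h) ((h [^] m) [^] n)))"
proof -
  have "gal_pair (group_exp G) n (1 / of_nat (order G)) (1 / of_nat (order G))"
    using gal_pair_of_rat[of "group_exp G" n "1 / of_nat (order G)"] by (simp add: of_rat_divide)
  then show ?thesis unfolding FS_ind_eq[OF fin V]
    by (rule gal_pair_mult) (intro gal_pair_sum chi_gal_pair[OF V fin n]; simp)
qed

text \<open>Here x^(m r) = (x^m)^n, and by injectivity of n-th powers the condition on u and h is
  the same for m r as for m.\<close>

lemma FS_ind_mult:
  assumes fin: "finite (carrier G)" and n: "coprime n (order G)" and V: "is_yd G V"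
    and r: "\<And>x. x \<in> carrier G \<Longrightarrow> x [^] (r::int) = x [^] (n::nat)"
  shows "FS_ind G (m * r) V =
    1 / of_nat (order G) * (\<Sum>h\<in>carrier G. \<Sum>u | u \<in> carrier G \<and> u [^] m \<otimes> h [^] m = \<one>.
      chi V (u \<otimes> h) ((h [^] m) [^] n))"
proof -
  have p: "x [^] (m * r) = (x [^] m) [^] n" if "x \<in> carrier G" for x
    using r[of "x [^] m"] that by (simp add: int_pow_pow)
  have "{u \<in> carrier G. u [^] (m * r) \<otimes> h [^] (m * r) = \<one>} = {u \<in> carrier G. u [^] m \<otimes> h [^] m = \<one>}"
    if "h \<in> carrier G" for h
    using power_mult_eq_one_iff[OF fin n] that by (auto simp: p)
  then show ?thesis unfolding FS_ind_eq[OF fin V] using p by simp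
qed

text \<open>Replacing u and h by their n-th powers permutes the solutions of u^m h^m = 1, and the
  summand then depends only on (h^m, u^n h^n). Grouped by these values,
  \<open>card_root_pairs\<close> trades the multiplicity of (g, y^n) for the number of solutions
  with (h^m, u h) = (g, y), and \<open>chi_tau\<close> removes the twist.\<close>

lemma FS_ind_tau:
  assumes fin: "finite (carrier G)" and n: "n > 0" "\<And>q. prime q \<Longrightarrow> q dvd n \<Longrightarrow> q > order G ^ 2"
    and V: "is_yd G V" and r: "\<And>x. x \<in> carrier G \<Longrightarrow> x [^] (r::int) = x [^] n"
  shows "FS_ind G m (yd_tau G r V) =
    1 / of_nat (order G) * (\<Sum>h\<in>carrier G. \<Sum>u | u \<in> carrier G \<and> u [^] m \<otimes> h [^] m = \<one>.
      chi V (u \<otimes> h) ((h [^] m) [^] n))"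
proof -
  let ?f = "\<lambda>x. x [^] n" and ?T = "yd_tau G r V" and ?GG = "carrier G \<times> carrier G"
  let ?k = "\<lambda>(u, h). (h [^] m, ?f u \<otimes> ?f h)" and ?l = "\<lambda>(u, h). (h [^] m, u \<otimes> h)"
  have cop: "coprime n (order G)" using coprime_order_if_large_primes[OF fin n] .
  note bij = pow_bij[OF fin cop]
  define W where "W = {(u, h) \<in> ?GG. u [^] m \<otimes> h [^] m = \<one>}"
  have finW: "finite W" unfolding W_def using fin by (auto intro: finite_subset[of _ ?GG])
  have pairs: "(\<Sum>h\<in>carrier G. \<Sum>u | u \<in> carrier G \<and> u [^] m \<otimes> h [^] m = \<one>. F u h) = (\<Sum>(u, h)\<in>W. F u h)"
    for F :: "'a \<Rightarrow> 'a \<Rightarrow> complex"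
  proof -
    have "(\<Sum>h\<in>carrier G. \<Sum>u | u \<in> carrier G \<and> u [^] m \<otimes> h [^] m = \<one>. F u h) =
      (\<Sum>(h, u)\<in>Sigma (carrier G) (\<lambda>h. {u. u \<in> carrier G \<and> u [^] m \<otimes> h [^] m = \<one>}). F u h)"
      using fin by (intro sum.Sigma) auto
    also have "\<dots> = (\<Sum>(u, h)\<in>W. F u h)"
      by (rule sum.reindex_bij_witness[where i = "\<lambda>(u, h). (h, u)" and j = "\<lambda>(h, u). (u, h)"])
        (auto simp: W_def)
    finally show ?thesis .
  qed
  have inj: "inj_on (\<lambda>(u, h). (?f u, ?f h)) W"
    using inj_onD[OF pow_inj_on[OF fin cop]] by (auto simp: inj_on_def W_def)
  have "(\<lambda>(u, h). (?f u, ?f h)) ` W \<subseteq> W"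
    using pow_pairs_iff[OF fin cop] by (auto simp: W_def)
  then have bijW: "bij_betw (\<lambda>(u, h). (?f u, ?f h)) W W"
    using inj endo_inj_surj[OF finW] by (auto simp: bij_betw_def)
  have cnt: "card {p \<in> W. ?k p = (g, ?f y)} =
      card {p \<in> W. ?l p = (g, y)}" if "g \<in> carrier G" "y \<in> carrier G" for g y
  proof -
    have "{p \<in> W. ?k p = (g, ?f y)} = {(u, h) \<in> W. h [^] m = g \<and> ?f u \<otimes> ?f h = ?f y}"
      "{p \<in> W. ?l p = (g, y)} = {(u, h) \<in> W. h [^] m = g \<and> u \<otimes> h = y}"
      by auto
    then show ?thesis using card_root_pairs[OF fin n that, of m] by (simp only: W_def)
  qed
  have finGG: "finite ?GG" using fin by simp
  have im: "?k ` W \<subseteq> ?GG" "?l ` W \<subseteq> ?GG"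
    by (auto simp: W_def)
  have "(\<Sum>(u, h)\<in>W. chi ?T (u \<otimes> h) (h [^] m)) = (\<Sum>(u, h)\<in>W. chi ?T (?f u \<otimes> ?f h) (?f h [^] m))"
    using sum.reindex_bij_betw[OF bijW, of "\<lambda>(u, h). chi ?T (u \<otimes> h) (h [^] m)"] by (simp add: case_prod_unfold)
  also have "\<dots> = (\<Sum>p\<in>W. (\<lambda>(g, y). chi ?T y (?f g)) (?k p))"
    by (intro sum.cong) (auto simp: W_def int_pow_nat_pow_commute)
  also have "\<dots> = (\<Sum>q\<in>?GG. of_nat (card {p \<in> W. ?k p = q}) * (\<lambda>(g, y). chi ?T y (?f g)) q)"
    by (rule sum_fun_comp[OF finW finGG im(1)])
  also have "\<dots> = (\<Sum>g\<in>carrier G. \<Sum>y\<in>carrier G.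
      of_nat (card {p \<in> W. ?k p = (g, y)}) * chi ?T y (?f g))"
    unfolding sum.cartesian_product by (intro sum.cong) auto
  also have "\<dots> = (\<Sum>g\<in>carrier G. \<Sum>y\<in>carrier G.
      of_nat (card {p \<in> W. ?k p = (g, ?f y)}) * chi ?T (?f y) (?f g))"
    by (intro sum.cong refl sum.reindex_bij_betw[OF bij, symmetric])
  also have "\<dots> = (\<Sum>g\<in>carrier G. \<Sum>y\<in>carrier G.
      of_nat (card {p \<in> W. ?l p = (g, y)}) * chi V y (?f g))"
    by (intro sum.cong refl) (simp only: cnt chi_tau[OF fin cop r V])
  also have "\<dots> = (\<Sum>q\<in>?GG. of_nat (card {p \<in> W. ?l p = q}) * (\<lambda>(g, y). chi V y (?f g)) q)"
    unfolding sum.cartesian_product by (intro sum.cong) auto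
  also have "\<dots> = (\<Sum>p\<in>W. (\<lambda>(g, y). chi V y (?f g)) (?l p))"
    by (rule sum_fun_comp[OF finW finGG im(2), symmetric])
  also have "\<dots> = (\<Sum>(u, h)\<in>W. chi V (u \<otimes> h) ((h [^] m) [^] n))"
    by (intro sum.cong) auto
  finally show ?thesis unfolding FS_ind_eq[OF fin is_yd_tau[OF V]] pairs by (rule arg_cong)
qed

section \<open>The functor \<open>yd_tau\<close> as an equivalence of categories\<close>

lemma is_yd_mor_tau_iff:
  assumes fin: "finite (carrier G)" and n: "coprime n (order G)"
    and r: "\<And>x. x \<in> carrier G \<Longrightarrow> x [^] (r::int) = x [^] (n::nat)"
    and X: "is_yd G X" and Y: "is_yd G Y"
  shows "is_yd_mor G (yd_tau G r X) (yd_tau G r Y) f \<longleftrightarrow> is_yd_mor G X Y f"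
proof -
  have "ydeg Y i [^] r = ydeg X j [^] r \<longleftrightarrow> ydeg Y i = ydeg X j" if "i < ydim Y" "j < ydim X" for i j
    using inj_on_eq_iff[OF pow_inj_on[OF fin n] ydD(1)[OF Y that(1)] ydD(1)[OF X that(2)]]
      r ydD(1)[OF Y that(1)] ydD(1)[OF X that(2)] by simp
  then show ?thesis unfolding is_yd_mor_def by auto
qed

text \<open>A preimage is Y twisted by s, where n s = 1 modulo the group order. Twisting back is
  known to restore the degrees at indices below the dimension, so the identity matrix is used as an
  isomorphism instead of an equality of records.\<close>

lemma tau_essentially_surjective:
  assumes n: "coprime n (order G)"
    and r: "\<And>x. x \<in> carrier G \<Longrightarrow> x [^] (r::int) = x [^] (n::nat)" and Y: "is_yd G Y"
  shows "\<exists>X. is_yd G X \<and> yd_isomorphic G (yd_tau G r X) Y"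
proof -
  obtain s where "[n * s = 1] (mod order G)" using cong_solve_coprime_nat[OF n] by auto
  then have "[int (n * s) = 1] (mod int (order G))" by (metis cong_int_iff of_nat_1)
  have s: "(x [^] int s) [^] r = x" if x: "x \<in> carrier G" for x
  proof -
    have "ord x dvd order G" using ord_dvd_group_order[OF x] .
    then have "int (ord x) dvd 1 - int (n * s)"
      using \<open>[int (n * s) = 1] (mod int (order G))\<close>
      by (metis cong_iff_dvd_diff cong_sym dvd_trans int_dvd_int_iff)
    then have "x [^] int (n * s) = x [^] (1::int)" using int_pow_eq[OF x] by simp
    moreover have "(x [^] int s) [^] r = x [^] int (n * s)"
      using r[of "x [^] int s"] x by (simp add: int_pow_int nat_pow_pow mult.commute del: of_nat_mult)
    ultimately show ?thesis using x by (simp add: int_pow_def2)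
  qed
  define X where "X = yd_tau G (int s) Y"
  have X: "is_yd G X" unfolding X_def by (rule is_yd_tau[OF Y])
  have deg: "ydeg (yd_tau G r X) i = ydeg Y i" if "i < ydim Y" for i
    using s[OF ydD(1)[OF Y that]] by (simp add: X_def)
  have dims: "ydim (yd_tau G r X) = ydim Y" "yact (yd_tau G r X) = yact Y" by (simp_all add: X_def)
  have one: "1\<^sub>m (ydim Y) * A = A * 1\<^sub>m (ydim Y)" if "A \<in> carrier_mat (ydim Y) (ydim Y)" for A :: "complex mat"
    using left_mult_one_mat[OF that] right_mult_one_mat[OF that] by simp
  have "is_yd_mor G (yd_tau G r X) Y (1\<^sub>m (ydim Y))" "is_yd_mor G Y (yd_tau G r X) (1\<^sub>m (ydim Y))"
    unfolding is_yd_mor_def dims using one[OF ydD(2)[OF Y]] deg by (auto split: if_splits)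
  then have "is_yd_iso G (yd_tau G r X) Y (1\<^sub>m (ydim Y))"
    unfolding is_yd_iso_def dims by (intro conjI exI[of _ "1\<^sub>m (ydim Y)"]) simp_all
  then show ?thesis using X unfolding yd_isomorphic_def by blast
qed

lemma int_pow_cong_exp:
  assumes x: "x \<in> carrier G" and "[r = int n] (mod int (group_exp G))"
  shows "x [^] r = x [^] n"
proof -
  have "ord x dvd group_exp G" unfolding group_exp_def using x by (intro dvd_Lcm) simp
  then have "int (ord x) dvd int n - r"
    using assms(2) by (metis cong_iff_dvd_diff cong_sym dvd_trans int_dvd_int_iff)
  then have "x [^] r = x [^] int n" using int_pow_eq[OF x] by simp
  then show ?thesis by (simp add: int_pow_int)
qed

end

theorem theorem4p1:
  fixes G :: "('g, 'b) monoid_scheme" and r :: int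
  assumes "group G" and "finite (carrier G)"
    and "coprime r (int (group_exp G))"
  shows
    \<comment> \<open>tau_r is a functor\<close>
    "(\<forall>X. is_yd G X \<longrightarrow> is_yd G (yd_tau G r X))
   \<and> (\<forall>X Y f. is_yd G X \<and> is_yd G Y \<and> is_yd_mor G X Y f \<longrightarrow>
        is_yd_mor G (yd_tau G r X) (yd_tau G r Y) (yd_tau_mor r f))
   \<and> (\<forall>X. is_yd G X \<longrightarrow> yd_tau_mor r (1\<^sub>m (ydim X)) = 1\<^sub>m (ydim (yd_tau G r X)))
   \<and> (\<forall>X Y Z f g. is_yd G X \<and> is_yd G Y \<and> is_yd G Z \<and> is_yd_mor G X Y f \<and> is_yd_mor G Y Z g
        \<longrightarrow> yd_tau_mor r (g * f) = yd_tau_mor r g * yd_tau_mor r f)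
    \<comment> \<open>faithful\<close>
   \<and> (\<forall>X Y f f'. is_yd G X \<and> is_yd G Y \<and> is_yd_mor G X Y f \<and> is_yd_mor G X Y f' \<and>
        yd_tau_mor r f = yd_tau_mor r f' \<longrightarrow> f = f')
    \<comment> \<open>full\<close>
   \<and> (\<forall>X Y h. is_yd G X \<and> is_yd G Y \<and> is_yd_mor G (yd_tau G r X) (yd_tau G r Y) h \<longrightarrow>
        (\<exists>f. is_yd_mor G X Y f \<and> yd_tau_mor r f = h))
    \<comment> \<open>essentially surjective\<close>
   \<and> (\<forall>Y. is_yd G Y \<longrightarrow> (\<exists>X. is_yd G X \<and> yd_isomorphic G (yd_tau G r X) Y))
    \<comment> \<open>quasitensor: natural isomorphism tau(X) (x) tau(Y) = tau(X (x) Y)\<close>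
   \<and> (\<exists>\<phi>. (\<forall>X Y. is_yd G X \<and> is_yd G Y \<longrightarrow>
            is_yd_iso G (yd_tensor G (yd_tau G r X) (yd_tau G r Y)) (yd_tau G r (yd_tensor G X Y)) (\<phi> X Y))
         \<and> (\<forall>X X' Y Y' f g. is_yd G X \<and> is_yd G X' \<and> is_yd G Y \<and> is_yd G Y' \<and>
              is_yd_mor G X X' f \<and> is_yd_mor G Y Y' g \<longrightarrow>
              \<phi> X' Y' * yd_tensor_mor (yd_tau_mor r f) (yd_tau_mor r g)
                = yd_tau_mor r (yd_tensor_mor f g) * \<phi> X Y))
    \<comment> \<open>S-matrix\<close>
   \<and> (\<forall>X Y X' Y'. yd_simple G X \<and> yd_simple G Y \<and> is_yd G X' \<and> is_yd G Y' \<and>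
        yd_isomorphic G (yd_tau G r X) X' \<and> yd_isomorphic G (yd_tau G r Y) Y' \<longrightarrow>
        yd_S X' Y' = gal_gamma (group_exp G) r (yd_S X Y))
    \<comment> \<open>Frobenius-Schur indicators\<close>
   \<and> (\<forall>V (m :: int). is_yd G V \<longrightarrow>
        FS_ind G m (yd_tau G r V) = gal_gamma (group_exp G) r (FS_ind G m V)
      \<and> gal_gamma (group_exp G) r (FS_ind G m V) = FS_ind G (m * r) V)"
proof -
  interpret group G by fact
  note fin = assms(2)
  have e: "group_exp G > 0" using group_exp_pos[OF fin] .
  obtain n :: nat where n0: "n > 0" and rn: "[r = int n] (mod int (group_exp G))"
    and cop: "coprime n (group_exp G)" and large: "\<And>q. prime q \<Longrightarrow> q dvd n \<Longrightarrow> q > order G ^ 2"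
    using cong_with_large_prime_factors[OF e assms(3), of "order G ^ 2"] by blast
  have r: "x [^]\<^bsub>G\<^esub> r = x [^]\<^bsub>G\<^esub> n" if "x \<in> carrier G" for x
    using int_pow_cong_exp[OF that rn] .
  have copo: "coprime n (order G)" using coprime_order_if_large_primes[OF fin n0 large] .
  note gal = gal_gamma_eq[OF _ e cop n0 rn]
  have S: "yd_S X' Y' = gal_gamma (group_exp G) r (yd_S X Y)"
    if "yd_simple G X" "yd_simple G Y" "is_yd G X'" "is_yd G Y'"
      "yd_isomorphic G (yd_tau G r X) X'" "yd_isomorphic G (yd_tau G r Y) Y'" for X Y X' Y'
    using gal[OF yd_S_tau_gal_pair[OF fin n0 copo r _ _ that(3-6)]] that(1,2) by (simp add: yd_simple_def)
  have FS: "FS_ind G m (yd_tau G r V) = gal_gamma (group_exp G) r (FS_ind G m V)"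
    "gal_gamma (group_exp G) r (FS_ind G m V) = FS_ind G (m * r) V" if "is_yd G V" for V m
    unfolding gal[OF FS_ind_gal_pair[OF fin n0 copo that]]
    using FS_ind_tau[OF fin n0 large that r] FS_ind_mult[OF fin copo that r] by simp_all
  note mor = is_yd_mor_tau_iff[OF fin copo r]
  show ?thesis
    unfolding yd_tau_mor_def
    apply (intro conjI)
    subgoal by (simp add: is_yd_tau)
    subgoal by (auto simp: mor)
    subgoal by simp
    subgoal by simp
    subgoal by simp
    subgoal by (auto simp: mor)
    subgoal using tau_essentially_surjective[OF copo r] by simp
    subgoal by (rule tau_quasitensor[OF fin n0 large r])
    subgoal using S by blast
    subgoal using FS by blast
    done
qed

end
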